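(* Let $p\ge1$, $c_\infty>0$, $c_1\in(0,2c_\infty\pi]$ and $N\in\mathbb{N}_+$. The minimizers of $W_p(f_+,f_-)$ over $X(c_\infty,c_1,N,S^1)$ are step functions in $X_s(c_\infty,c_1,N,S^1)$, anti-symmetric about each nodal point (each point of $Z(f)$), with value $\pm c_\infty$ and width $c_1/(2c_\infty N)$ on each side of the nodal point. Hence $$\min_{f\in X(c_\infty,c_1,N,S^1)}W_p(f_+,f_-)=2^{-1-\frac1p}\,\frac{c_1}{Nc_\infty}\,c_1^{\frac1p}.$$
   Context: $S^1$ is the unit circle (of length $2\pi$) with arc-length measure and geodesic distance $d(e^{it},e^{is})=\min\{(t-s)\bmod 2\pi,\ (s-t)\bmod 2\pi\}$. Below $I=S^1$. Effective nodal set. For a measurable $f:I\to\mathbb{R}$ with finite $L^1$ and $L^\infty$ norms, let $Z_1(f)=\partial\{x: f(x)>0\}\cap\partial\{x: f(x)<0\}$. Let $\mathcal{Z}(f)$ be the set of connected components of $f^{-1}(\{0\})$, and $\mathcal{Z}'(f)\subseteq\mathcal{Z}(f)$ the set of those components whose closure intersects both $\partial\{f>0\}$ and $\partial\{f<0\}$. Let $Z_2(f)$ be a set consisting of a unique point $x\in J$ for every $J\in\mathcal{Z}'(f)$. The effective nodal set is $Z(f)=Z_1(f)\cup Z_2(f)$. Classes. $X(c_\infty,c_1,N,I)$ is the set of measurable $f:I\to\mathbb{R}$ with $\|f\|_\infty=c_\infty$, $\|f\|_1=c_1$, $|Z(f)|=N$ and $\int_I f\,dx=0$. $X_s(c_\infty,c_1,N,I)$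 is the set of step functions $f\in X(c_\infty,c_1,N,I)$ such that $f=\pm c_\infty$ only on intervals (arcs) adjacent to points of $Z(f)$ and $f=0$ everywhere else. Transport. $f_\pm=\pm\max(\pm f,0)$, and $W_p(f_+,f_-)$ is the Wasserstein-$p$ distance between the two finite measures of equal mass with densities $f_+$ and $|f_-|$: $W_p(\mu_1,\mu_2)=\inf_{\gamma\in\Gamma(\mu_1,\mu_2)}\left(\int_{I\times I}d(x,y)^p\,d\gamma(x,y)\right)^{1/p}$, where $\Gamma(\mu_1,\mu_2)$ is the set of Borel measures on $I\times I$ with marginals $\mu_1,\mu_2$ (no normalization to mass one).
   Formalization: N is assumed even (for N=1 the class X is empty; for odd N≥3 the minimum is strictly larger than claimed), and each minimizer is shown to agree almost everywhere, with the same Z(f), with such a step function in X_s, since changes on null sets keep minimality. *)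

theory Defs
  imports "HOL-Probability.Essential_Supremum" "HOL-Library.Real_Mod"
begin

section \<open>The circle\<close>

text \<open>
  The circle is the set of complex numbers of modulus one.  Functions on it are total functions on
  the complex plane of which only the values on the circle are used.
\<close>

abbreviation circle :: "complex set" where
  "circle \<equiv> sphere 0 1"

abbreviation circle_top :: "complex topology" where
  "circle_top \<equiv> top_of_set circle"

abbreviation circle_borel :: "complex measure" where
  "circle_borel \<equiv> restrict_space borel circle"

text \<open>Completed so that measurable functions are the Lebesgue measurable ones.\<close>

definition arc_length :: "complex measure" where
  "arc_length = completion (distr (restrict_space lborel {0..<2*pi}) circle_borel cis)"

definition arc_dist :: "complex \<Rightarrow> complex \<Rightarrow> real" where
  "arc_dist x y = min ((Arg2pi x - Arg2pi y) rmod (2*pi)) ((Arg2pi y - Arg2pi x) rmod (2*pi))"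

lemma arc_dist_cis: "arc_dist (cis t) (cis s) = min ((t - s) rmod (2*pi)) ((s - t) rmod (2*pi))"
proof -
  have *: "Arg2pi (cis a) = a rmod (2*pi)" for a
  proof (rule Arg2pi_unique[where r = 1])
    have "cis (a rmod (2*pi)) = cis a"
      by (simp add: cis_eq_iff)
    then show "complex_of_real 1 * exp (\<i> * complex_of_real (a rmod (2*pi))) = cis a"
      by (simp add: cis_conv_exp)
  qed (simp_all add: rmod_less rmod_nonneg)
  show ?thesis
    by (simp add: arc_dist_def * rmod_diff)
qed

lemma measurable_cis_circle: "cis \<in> restrict_space lborel {0..<2*pi} \<rightarrow>\<^sub>M circle_borel"
proof (rule measurable_restrict_space2)
  have "cis \<in> borel_measurable borel"
    by (intro borel_measurable_continuous_onI continuous_intros)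
  then show "cis \<in> restrict_space lborel {0..<2*pi} \<rightarrow>\<^sub>M borel"
    by (intro measurable_restrict_space1) simp
qed auto

lemma space_arc_length [simp]: "space arc_length = circle"
  by (simp add: arc_length_def space_restrict_space)

lemma emeasure_arc_length_circle: "emeasure arc_length circle = ennreal (2*pi)"
proof -
  have *: "circle \<in> sets circle_borel"
    using sets.top[of circle_borel] by (simp add: space_restrict_space)
  have "emeasure arc_length circle
      = emeasure (restrict_space lborel {0..<2*pi}) (cis -` circle \<inter> {0..<2*pi})"
    using * by (simp add: arc_length_def emeasure_distr[OF measurable_cis_circle]
        space_restrict_space)
  also have "cis -` circle \<inter> {0..<2*pi} = {0..<2*pi}"
    by auto
  also have "emeasure (restrict_space lborel {0..<2*pi}) {0..<2*pi} = ennreal (2*pi)"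
    by (simp add: emeasure_restrict_space)
  finally show ?thesis .
qed


section \<open>The effective nodal set\<close>

definition boundary_pos :: "(complex \<Rightarrow> real) \<Rightarrow> complex set" where
  "boundary_pos f = circle_top frontier_of {x \<in> circle. f x > 0}"

definition boundary_neg :: "(complex \<Rightarrow> real) \<Rightarrow> complex set" where
  "boundary_neg f = circle_top frontier_of {x \<in> circle. f x < 0}"

definition nodal1 :: "(complex \<Rightarrow> real) \<Rightarrow> complex set" where
  "nodal1 f = boundary_pos f \<inter> boundary_neg f"

definition zero_components :: "(complex \<Rightarrow> real) \<Rightarrow> complex set set" where
  "zero_components f = components {x \<in> circle. f x = 0}"

definition sign_change_components :: "(complex \<Rightarrow> real) \<Rightarrow> complex set set" where
  "sign_change_components f =
     {J \<in> zero_components f.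
        circle_top closure_of J \<inter> boundary_pos f \<noteq> {} \<and>
        circle_top closure_of J \<inter> boundary_neg f \<noteq> {}}"

text \<open>
  The selection of one point in each component is an arbitrary choice, made explicit as the
  parameter \<open>sel\<close>; it is meaningful only for selections satisfying the following predicate.
\<close>

definition nodal_selection :: "((complex \<Rightarrow> real) \<Rightarrow> complex set \<Rightarrow> complex) \<Rightarrow> bool" where
  "nodal_selection sel \<longleftrightarrow> (\<forall>f. \<forall>J \<in> sign_change_components f. sel f J \<in> J)"

definition nodal2 ::
  "((complex \<Rightarrow> real) \<Rightarrow> complex set \<Rightarrow> complex) \<Rightarrow> (complex \<Rightarrow> real) \<Rightarrow> complex set" where
  "nodal2 sel f = sel f ` sign_change_components f"

definition nodal_set ::
  "((complex \<Rightarrow> real) \<Rightarrow> complex set \<Rightarrow> complex) \<Rightarrow> (complex \<Rightarrow> real) \<Rightarrow> complex set" where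
  "nodal_set sel f = nodal1 f \<union> nodal2 sel f"


section \<open>The function classes\<close>

definition class_X ::
  "((complex \<Rightarrow> real) \<Rightarrow> complex set \<Rightarrow> complex) \<Rightarrow> real \<Rightarrow> real \<Rightarrow> nat \<Rightarrow> (complex \<Rightarrow> real) set" where
  "class_X sel c_inf c_1 N =
     {f. f \<in> borel_measurable arc_length \<and>
         esssup arc_length (\<lambda>x. ereal \<bar>f x\<bar>) = ereal c_inf \<and>
         integrable arc_length f \<and> (\<integral>x. \<bar>f x\<bar> \<partial>arc_length) = c_1 \<and>
         finite (nodal_set sel f) \<and> card (nodal_set sel f) = N \<and>
         (\<integral>x. f x \<partial>arc_length) = 0}"

definition step_function :: "(complex \<Rightarrow> real) \<Rightarrow> bool" where
  "step_function f \<longleftrightarrow>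
     (\<exists>\<A>. finite \<A> \<and> \<Union>\<A> = circle \<and> (\<forall>A\<in>\<A>. connected A \<and> f constant_on A))"

text \<open>
  The maximal arcs on which \<open>f\<close> takes the value \<open>\<plusminus>c_inf\<close> have to be nondegenerate and to have a
  nodal point in their closure.
\<close>

definition class_X_step ::
  "((complex \<Rightarrow> real) \<Rightarrow> complex set \<Rightarrow> complex) \<Rightarrow> real \<Rightarrow> real \<Rightarrow> nat \<Rightarrow> (complex \<Rightarrow> real) set" where
  "class_X_step sel c_inf c_1 N =
     {f \<in> class_X sel c_inf c_1 N.
        step_function f \<and>
        (\<forall>x\<in>circle. f x \<in> {c_inf, - c_inf, 0}) \<and>
        (\<forall>v\<in>{c_inf, - c_inf}. \<forall>A \<in> components {x \<in> circle. f x = v}.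
           circle_top interior_of A \<noteq> {} \<and> circle_top closure_of A \<inter> nodal_set sel f \<noteq> {})}"

text \<open>
  On the arc of half-width \<open>w\<close> around each point \<open>z\<close> of \<open>Z\<close>, \<open>f\<close> is odd with respect to the
  reflection in \<open>z\<close> and equal to a constant \<open>\<plusminus>c\<close> on each side; outside these arcs \<open>f\<close> vanishes.
\<close>

definition antisymmetric_steps :: "real \<Rightarrow> real \<Rightarrow> complex set \<Rightarrow> (complex \<Rightarrow> real) \<Rightarrow> bool" where
  "antisymmetric_steps c w Z f \<longleftrightarrow>
     (\<forall>z\<in>Z. (\<forall>t. \<bar>t\<bar> < w \<longrightarrow> f (z * cis (- t)) = - f (z * cis t)) \<and>
             (\<exists>v\<in>{c, - c}. \<forall>t\<in>{0<..<w}. f (z * cis t) = v)) \<and>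
     (\<forall>x\<in>circle. (\<forall>z\<in>Z. w \<le> arc_dist x z) \<longrightarrow> f x = 0)"


section \<open>The transport distance\<close>

definition couplings ::
  "complex measure \<Rightarrow> complex measure \<Rightarrow> (complex \<times> complex) measure set" where
  "couplings \<mu> \<nu> =
     {\<gamma>. sets \<gamma> = sets (circle_borel \<Otimes>\<^sub>M circle_borel) \<and>
         (\<forall>A \<in> sets circle_borel. emeasure \<gamma> (A \<times> circle) = emeasure \<mu> A) \<and>
         (\<forall>A \<in> sets circle_borel. emeasure \<gamma> (circle \<times> A) = emeasure \<nu> A)}"

definition wasserstein :: "real \<Rightarrow> complex measure \<Rightarrow> complex measure \<Rightarrow> real" where
  "wasserstein p \<mu> \<nu> =
     (INF \<gamma> \<in> couplings \<mu> \<nu>. (\<integral>z. arc_dist (fst z) (snd z) powr p \<partial>\<gamma>) powr (1 / p))"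

definition pos_part :: "(complex \<Rightarrow> real) \<Rightarrow> complex \<Rightarrow> real" where
  "pos_part f x = max (f x) 0"

definition neg_part :: "(complex \<Rightarrow> real) \<Rightarrow> complex \<Rightarrow> real" where
  "neg_part f x = - max (- f x) 0"

definition W :: "real \<Rightarrow> (complex \<Rightarrow> real) \<Rightarrow> real" where
  "W p f = wasserstein p (density arc_length (\<lambda>x. ennreal (pos_part f x)))
                         (density arc_length (\<lambda>x. ennreal \<bar>neg_part f x\<bar>))"

end

theory Submission
  imports Defs
begin

text \<open>
  Cut the circle at a nodal point and let \<open>F\<close> be the primitive of \<open>f\<close>, the flux that a transport of the
  positive part of \<open>f\<close> onto its negative part has to realize.  Whatever the transport plan, the
  net mass crossing an angle \<open>u\<close> is \<open>F u - k\<close>, where \<open>- k\<close> is the net mass crossing the cut, so the cost with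
  exponent one is at least \<open>\<integral>\<bar>F - k\<bar>\<close> (\<open>transport_cost_ge\<close>).

  Between two consecutive points of the effective nodal set \<open>f\<close> does not change its sign
  (\<open>constant_sign_between_nodal_points\<close>).  Hence \<open>F\<close> is monotone on each of \<open>N\<close> intervals, its total variation is \<open>c\<^sub>1\<close>,
  and it is Lipschitz with constant \<open>c\<close>, the bound of \<open>\<bar>f\<bar>\<close>.  A function with increment \<open>v\<close> and slope at most \<open>c\<close> cannot pass
  through zero quickly: its integral in absolute value is at least \<open>v\<^sup>2 / (4 * c)\<close>.  Summing over
  the intervals, and using that \<open>N\<close> numbers with sum \<open>c\<^sub>1\<close> have squares with sum at least \<open>c\<^sub>1\<^sup>2 / N\<close>, one finds
  \<open>\<integral>\<bar>F - k\<bar> \<ge> c\<^sub>1\<^sup>2 / (4 * c * N) = w * (c\<^sub>1 / 2)\<close> with \<open>w = c\<^sub>1 / (2 * c * N)\<close> (\<open>lipschitz_partition_integral_abs_ge\<close>).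
  The mass to be transported is \<open>c\<^sub>1 / 2\<close>, so the mean distance is at least \<open>w\<close>, and by convexity the distance
  with exponent \<open>p\<close> is at least \<open>w * (c\<^sub>1 / 2) powr (1 / p)\<close>.

  Equality in both estimates leaves no freedom.  All increments are \<open>\<plusminus>c\<^sub>1 / N\<close>, and on each interval \<open>F - k\<close> leaves
  an extremal value at one end with slope \<open>\<plusminus>c\<close>, rests at zero after the width \<open>w\<close>, and reaches the opposite
  value at the other end in the same way (\<open>transported_eq\<close>).  So \<open>f\<close> is almost everywhere a step function with
  values \<open>\<plusminus>c\<close> of opposite sign on the two arcs of width \<open>w\<close> at each nodal point, and these
  step functions, the profiles of the locale \<open>alternating_arcs\<close>, have exactly the prescribed nodal points.
  Conversely, moving the positive mass of such a profile by \<open>w\<close> across the adjacent nodal point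
  attains the bound (\<open>W_profile_le\<close>), and for even \<open>N\<close> equidistant nodal points provide a profile because \<open>w * N \<le> pi\<close>.
\<close>

section \<open>The mass of a Lipschitz function with a given increment\<close>

lemma has_integral_right_ramp:
  fixes a b c r :: real
  assumes "c > 0" "0 \<le> r" "r \<le> c * (b - a)"
  shows "((\<lambda>x. max 0 (r - c * (b - x))) has_integral r\<^sup>2 / (2*c)) {a..b}"
proof -
  define m where "m = b - r / c"
  have m: "a \<le> m" "m \<le> b" using assms by (auto simp: m_def field_simps)
  have zero: "((\<lambda>x. max 0 (r - c * (b - x))) has_integral 0) {a..m}"
    using assms by (intro has_integral_is_0) (auto simp: m_def field_simps)
  have "((\<lambda>x. r - c * (b - x)) has_integral
      ((r - c * (b - b))\<^sup>2 / (2*c) - (r - c * (b - m))\<^sup>2 / (2*c))) {m..b}"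
    using m assms(1)
    by (intro fundamental_theorem_of_calculus)
       (auto intro!: derivative_eq_intros simp: has_real_derivative_iff_has_vector_derivative [symmetric])
  then have lin: "((\<lambda>x. r - c * (b - x)) has_integral r\<^sup>2 / (2*c)) {m..b}"
    using assms(1) by (simp add: m_def)
  have "((\<lambda>x. max 0 (r - c * (b - x))) has_integral r\<^sup>2 / (2*c)) {m..b}"
  proof (rule has_integral_eq[OF _ lin])
    fix x assume "x \<in> {m..b}"
    then have "c * (b - x) \<le> c * (b - m)" using assms(1) by simp
    also have "c * (b - m) = r" using assms(1) by (simp add: m_def)
    finally show "r - c * (b - x) = max 0 (r - c * (b - x))" by simp
  qed
  then show ?thesis
    using has_integral_combine[OF m zero] by simp
qed

lemma has_integral_left_ramp:
  fixes a b c r :: real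
  assumes "c > 0" "0 \<le> r" "r \<le> c * (b - a)"
  shows "((\<lambda>x. max 0 (r - c * (x - a))) has_integral r\<^sup>2 / (2*c)) {a..b}"
proof -
  have "((\<lambda>x. max 0 (r - c * (- a - x))) has_integral r\<^sup>2 / (2*c)) {-b..-a}"
    using has_integral_right_ramp[of c r "-a" "-b"] assms by simp
  then have "((\<lambda>x. max 0 (r - c * (- a - - x))) has_integral r\<^sup>2 / (2*c)) {a..b}"
    by (subst has_integral_reflect_real[symmetric]) simp
  then show ?thesis by (simp add: algebra_simps)
qed

text \<open>
  Close to \<open>b\<close> the Lipschitz bound keeps \<open>G\<close> above a ramp ending at height \<open>G b\<close>, close to \<open>a\<close> it keeps
  \<open>- G\<close> above a ramp starting at height \<open>- G a\<close>.  The two ramps cannot be positive at the same point,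
  because \<open>G\<close> would have both signs there, so \<open>\<bar>G\<bar>\<close> dominates their sum.  If their heights \<open>p\<close>
  and \<open>q\<close> add up to the increment of \<open>G\<close>, their areas add up to \<open>(p\<^sup>2 + q\<^sup>2) / (2 * c)\<close>, which is smallest
  for \<open>p = q\<close>.  In the case of equality nothing but the two ramps is left of \<open>G\<close>.
\<close>

lemma lipschitz_integral_abs_ge_increasing:
  fixes G :: "real \<Rightarrow> real"
  assumes "a \<le> b" "c > 0"
    and Lip: "\<And>x y. a \<le> x \<Longrightarrow> x \<le> y \<Longrightarrow> y \<le> b \<Longrightarrow> \<bar>G y - G x\<bar> \<le> c * (y - x)"
    and le: "G a \<le> G b"
  shows "(G b - G a)\<^sup>2 / (4*c) \<le> integral {a..b} (\<lambda>x. \<bar>G x\<bar>)"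
    and "integral {a..b} (\<lambda>x. \<bar>G x\<bar>) = (G b - G a)\<^sup>2 / (4*c) \<Longrightarrow> G a \<noteq> G b \<Longrightarrow> x \<in> {a..b} \<Longrightarrow>
      G x = max 0 ((G b - G a)/2 - c * (b - x)) - max 0 ((G b - G a)/2 - c * (x - a))"
proof -
  define v where "v = G b - G a"
  have v: "0 \<le> v" "v \<le> c * (b - a)"
    using Lip[of a b] assms(1) le by (auto simp: v_def)
  have cont: "continuous_on {a..b} G"
  proof (rule continuous_onI)
    fix x e :: real assume x: "x \<in> {a..b}" "e > 0"
    show "\<exists>d>0. \<forall>x'\<in>{a..b}. dist x' x < d \<longrightarrow> dist (G x') (G x) \<le> e"
    proof (intro exI[of _ "e / c"] conjI ballI impI)
      fix y assume y: "y \<in> {a..b}" "dist y x < e / c"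
      have "\<bar>G y - G x\<bar> \<le> c * \<bar>y - x\<bar>"
        using Lip[of x y] Lip[of y x] x y by (cases "x \<le> y") (auto simp: abs_minus_commute)
      also have "\<dots> \<le> e" using y(2) assms(2) by (simp add: dist_real_def field_simps)
      finally show "dist (G y) (G x) \<le> e" by (simp add: dist_real_def)
    qed (use x assms in auto)
  qed
  \<comment> \<open>If \<open>G\<close> does not change sign, a single ramp of the height of the whole increment is available,
      and its area is twice the required one.\<close>
  define p where "p = (if G a > 0 then v else if G b < 0 then 0 else G b)"
  define q where "q = (if G a > 0 then 0 else if G b < 0 then v else - G a)"
  have pq: "0 \<le> p" "0 \<le> q" "p + q = v" "p > 0 \<Longrightarrow> p \<le> G b" "q > 0 \<Longrightarrow> q \<le> - G a"
    using le v by (auto simp: p_def q_def v_def)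
  define R where "R x = max 0 (p - c * (b - x)) + max 0 (q - c * (x - a))" for x
  have R_le: "R x \<le> \<bar>G x\<bar>" if "x \<in> {a..b}" for x
  proof -
    have l: "\<bar>G b - G x\<bar> \<le> c * (b - x)" "\<bar>G x - G a\<bar> \<le> c * (x - a)" using Lip that by auto
    have nn: "0 \<le> c * (b - x)" "0 \<le> c * (x - a)" using that assms(2) by auto
    have "p - c * (b - x) > 0 \<Longrightarrow> G x \<ge> p - c * (b - x)"
      using pq(4) l(1) nn by linarith
    moreover have "q - c * (x - a) > 0 \<Longrightarrow> - G x \<ge> q - c * (x - a)"
      using pq(5) l(2) nn by linarith
    ultimately show ?thesis unfolding R_def by linarith
  qed
  have intR: "(R has_integral p\<^sup>2 / (2*c) + q\<^sup>2 / (2*c)) {a..b}"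
    unfolding R_def using pq v assms(2)
    by (intro has_integral_add has_integral_right_ramp has_integral_left_ramp) auto
  have intG: "(\<lambda>x. \<bar>G x\<bar>) integrable_on {a..b}"
    by (intro integrable_continuous_interval continuous_intros cont)
  have ge: "p\<^sup>2 / (2*c) + q\<^sup>2 / (2*c) \<le> integral {a..b} (\<lambda>x. \<bar>G x\<bar>)"
    using integral_le[of R "{a..b}" "\<lambda>x. \<bar>G x\<bar>"] R_le intR intG
    by (auto simp: integral_unique has_integral_integrable)
  have id: "p\<^sup>2 / (2*c) + q\<^sup>2 / (2*c) = v\<^sup>2 / (4*c) + (p - q)\<^sup>2 / (4*c)"
    using assms(2) unfolding pq(3)[symmetric] by (simp add: field_simps power2_eq_square)
  have nn: "0 \<le> (p - q)\<^sup>2 / (4*c)" using assms(2) by simp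
  show "(G b - G a)\<^sup>2 / (4*c) \<le> integral {a..b} (\<lambda>x. \<bar>G x\<bar>)"
    using ge id nn by (simp add: v_def)
  assume eq: "integral {a..b} (\<lambda>x. \<bar>G x\<bar>) = (G b - G a)\<^sup>2 / (4*c)" and ne: "G a \<noteq> G b"
    and x: "x \<in> {a..b}"
  have "(p - q)\<^sup>2 / (4*c) = 0" using eq ge id nn by (simp add: v_def)
  then have h: "p = v/2" "q = v/2" using assms(2) pq(3) by auto
  have "v > 0" using ne le by (simp add: v_def)
  then have ab: "G b = v/2" "G a = - (v/2)" using pq(4,5) h unfolding v_def by argo+
  have "integral {a..b} (\<lambda>x. \<bar>G x\<bar> - R x) = 0"
  proof -
    have "integral {a..b} R = v\<^sup>2 / (4*c)"
      using intR id unfolding h by (simp add: integral_unique)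
    then show ?thesis
      using eq intR by (subst integral_diff) (simp_all add: intG v_def has_integral_integrable)
  qed
  moreover have "continuous_on {a..b} (\<lambda>x. \<bar>G x\<bar> - R x)"
    unfolding R_def by (intro continuous_intros cont)
  moreover have "a < b" using ne assms(1) by (cases "a = b") auto
  ultimately have "\<bar>G x\<bar> - R x = 0"
    using integral_eq_0_iff[of a b "\<lambda>x. \<bar>G x\<bar> - R x"] R_le x by (meson diff_ge_0_iff_ge)
  then have "\<bar>G x\<bar> = max 0 (v/2 - c * (b - x)) + max 0 (v/2 - c * (x - a))"
    by (simp add: R_def h)
  moreover have "\<bar>v/2 - G x\<bar> \<le> c * (b - x)" "\<bar>G x + v/2\<bar> \<le> c * (x - a)"
    using Lip[of x b] Lip[of a x] x ab by auto
  ultimately have "G x = max 0 (v/2 - c * (b - x)) - max 0 (v/2 - c * (x - a))"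
    by (smt (verit))
  then show "G x = max 0 ((G b - G a)/2 - c * (b - x)) - max 0 ((G b - G a)/2 - c * (x - a))"
    by (simp add: v_def)
qed

lemma lipschitz_integral_abs_ge:
  fixes G :: "real \<Rightarrow> real"
  assumes "a \<le> b" "c > 0"
    and Lip: "\<And>x y. a \<le> x \<Longrightarrow> x \<le> y \<Longrightarrow> y \<le> b \<Longrightarrow> \<bar>G y - G x\<bar> \<le> c * (y - x)"
  shows "(G b - G a)\<^sup>2 / (4*c) \<le> integral {a..b} (\<lambda>x. \<bar>G x\<bar>)"
    and "integral {a..b} (\<lambda>x. \<bar>G x\<bar>) = (G b - G a)\<^sup>2 / (4*c) \<Longrightarrow> G a \<noteq> G b \<Longrightarrow> x \<in> {a..b} \<Longrightarrow>
      G x = sgn (G b - G a) * (max 0 (\<bar>G b - G a\<bar>/2 - c * (b - x)) - max 0 (\<bar>G b - G a\<bar>/2 - c * (x - a)))"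
proof -
  have Lip': "\<bar>- G y - - G x\<bar> \<le> c * (y - x)" if "a \<le> x" "x \<le> y" "y \<le> b" for x y
    using Lip[OF that] by linarith
  show "(G b - G a)\<^sup>2 / (4*c) \<le> integral {a..b} (\<lambda>x. \<bar>G x\<bar>)"
  proof (cases "G a \<le> G b")
    case True
    then show ?thesis by (intro lipschitz_integral_abs_ge_increasing(1) assms)
  next
    case False
    then show ?thesis
      using lipschitz_integral_abs_ge_increasing(1)[OF assms(1,2) Lip'] by (simp add: power2_commute[of "G b" "G a"])
  qed
  assume eq: "integral {a..b} (\<lambda>x. \<bar>G x\<bar>) = (G b - G a)\<^sup>2 / (4*c)"
    and ne: "G a \<noteq> G b" and x: "x \<in> {a..b}"
  show "G x = sgn (G b - G a) * (max 0 (\<bar>G b - G a\<bar>/2 - c * (b - x)) - max 0 (\<bar>G b - G a\<bar>/2 - c * (x - a)))"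
  proof (cases "G a \<le> G b")
    case True
    then have "G x = max 0 ((G b - G a)/2 - c * (b - x)) - max 0 ((G b - G a)/2 - c * (x - a))"
      by (intro lipschitz_integral_abs_ge_increasing(2) assms eq ne x)
    then show ?thesis using True ne by simp
  next
    case False
    have "- G x = max 0 ((- G b - - G a)/2 - c * (b - x)) - max 0 ((- G b - - G a)/2 - c * (x - a))"
      using False eq ne x
      by (intro lipschitz_integral_abs_ge_increasing(2)[OF assms(1,2) Lip']) (auto simp: power2_commute[of "G b" "G a"])
    then show ?thesis using False by simp
  qed
qed

lemma partition_mono:
  fixes a :: "nat \<Rightarrow> real"
  assumes "\<And>i. i < N \<Longrightarrow> a i \<le> a (Suc i)" "i \<le> j" "j \<le> N"
  shows "a i \<le> a j"
  using assms(2,3) by (induction rule: dec_induct) (auto intro: order_trans[OF _ assms(1)])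

lemma integral_partition_sum:
  fixes a :: "nat \<Rightarrow> real" and g :: "real \<Rightarrow> real"
  assumes mono: "\<And>i. i < N \<Longrightarrow> a i \<le> a (Suc i)" and int: "g integrable_on {a 0..a N}"
  shows "integral {a 0..a N} g = (\<Sum>i<N. integral {a i..a (Suc i)} g)"
proof -
  have "integral {a 0..a n} g = (\<Sum>i<n. integral {a i..a (Suc i)} g)" if "n \<le> N" for n
    using that
  proof (induction n)
    case (Suc n)
    have le: "a 0 \<le> a n" "a n \<le> a (Suc n)" "a (Suc n) \<le> a N"
      using Suc.prems by (auto intro!: partition_mono[of N a] mono)
    have "g integrable_on {a 0..a (Suc n)}"
      using le by (intro integrable_subinterval_real[OF int]) auto
    then have "integral {a 0..a (Suc n)} g = integral {a 0..a n} g + integral {a n..a (Suc n)} g"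
      using le by (simp add: Henstock_Kurzweil_Integration.integral_combine)
    then show ?case using Suc by simp
  qed simp
  then show ?thesis by simp
qed

lemma square_sum_le_sum_squares:
  fixes v :: "nat \<Rightarrow> real"
  assumes "N > 0"
  shows "(\<Sum>i<N. v i)\<^sup>2 / real N \<le> (\<Sum>i<N. (v i)\<^sup>2)"
    and "(\<Sum>i<N. (v i)\<^sup>2) = (\<Sum>i<N. v i)\<^sup>2 / real N \<Longrightarrow> i < N \<Longrightarrow> v i = (\<Sum>i<N. v i) / real N"
proof -
  define m where "m = (\<Sum>i<N. v i) / real N"
  have "(\<Sum>i<N. (v i - m)\<^sup>2) = (\<Sum>i<N. (v i)\<^sup>2) - 2 * m * (\<Sum>i<N. v i) + real N * m\<^sup>2"
    by (simp add: power2_diff sum.distrib sum_subtractf sum_distrib_left sum_distrib_right mult_ac)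
  also have "\<dots> = (\<Sum>i<N. (v i)\<^sup>2) - (\<Sum>i<N. v i)\<^sup>2 / real N"
    using assms by (simp add: m_def field_simps power2_eq_square)
  finally have *: "(\<Sum>i<N. (v i - m)\<^sup>2) = (\<Sum>i<N. (v i)\<^sup>2) - (\<Sum>i<N. v i)\<^sup>2 / real N" .
  have "0 \<le> (\<Sum>i<N. (v i - m)\<^sup>2)" by (intro sum_nonneg) auto
  then show "(\<Sum>i<N. v i)\<^sup>2 / real N \<le> (\<Sum>i<N. (v i)\<^sup>2)" using * by simp
  assume "(\<Sum>i<N. (v i)\<^sup>2) = (\<Sum>i<N. v i)\<^sup>2 / real N" "i < N"
  then have "(v i - m)\<^sup>2 = 0" using * sum_nonneg_eq_0_iff[of "{..<N}" "\<lambda>i. (v i - m)\<^sup>2"] by auto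
  then show "v i = (\<Sum>i<N. v i) / real N" by (simp add: m_def)
qed

text \<open>
  The bound on a single interval is quadratic in the increment, so for a given total variation it is
  best to spread the variation evenly over the \<open>N\<close> intervals.  This is the uncertainty principle behind
  the theorem: small flux, in \<open>L\<^sup>1\<close>, needs many changes of sign.
\<close>

lemma lipschitz_partition_integral_abs_ge:
  fixes G :: "real \<Rightarrow> real" and a :: "nat \<Rightarrow> real"
  assumes "N > 0" "c > 0" and mono: "\<And>i. i < N \<Longrightarrow> a i \<le> a (Suc i)"
    and Lip: "\<And>x y. a 0 \<le> x \<Longrightarrow> x \<le> y \<Longrightarrow> y \<le> a N \<Longrightarrow> \<bar>G y - G x\<bar> \<le> c * (y - x)"
    and V: "V = (\<Sum>i<N. \<bar>G (a (Suc i)) - G (a i)\<bar>)"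
    and int: "(\<lambda>x. \<bar>G x\<bar>) integrable_on {a 0..a N}"
  shows "V\<^sup>2 / (4 * c * N) \<le> integral {a 0..a N} (\<lambda>x. \<bar>G x\<bar>)"
    and "integral {a 0..a N} (\<lambda>x. \<bar>G x\<bar>) = V\<^sup>2 / (4 * c * N) \<Longrightarrow> i < N \<Longrightarrow>
      \<bar>G (a (Suc i)) - G (a i)\<bar> = V / N \<and>
      integral {a i..a (Suc i)} (\<lambda>x. \<bar>G x\<bar>) = (G (a (Suc i)) - G (a i))\<^sup>2 / (4*c)"
proof -
  define v where "v i = \<bar>G (a (Suc i)) - G (a i)\<bar>" for i
  define I where "I i = integral {a i..a (Suc i)} (\<lambda>x. \<bar>G x\<bar>)" for i
  have am: "a i \<le> a j" if "i \<le> j" "j \<le> N" for i j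
    using partition_mono[of N a i j] mono that by blast
  have I: "(v i)\<^sup>2 / (4*c) \<le> I i" if "i < N" for i
    unfolding v_def I_def power2_abs using that am[of 0 i] am[of "Suc i" N]
    by (intro lipschitz_integral_abs_ge(1) mono Lip assms) auto
  have sum: "integral {a 0..a N} (\<lambda>x. \<bar>G x\<bar>) = (\<Sum>i<N. I i)"
    unfolding I_def by (intro integral_partition_sum mono int)
  have Vv: "V = (\<Sum>i<N. v i)" by (simp add: V v_def)
  have 1: "V\<^sup>2 / (4 * c * N) \<le> (\<Sum>i<N. (v i)\<^sup>2) / (4 * c)"
  proof -
    have "V\<^sup>2 / (4 * c * N) = (\<Sum>i<N. v i)\<^sup>2 / real N / (4 * c)"
      by (simp add: Vv)
    also have "\<dots> \<le> (\<Sum>i<N. (v i)\<^sup>2) / (4 * c)"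
      using assms(1,2) by (intro divide_right_mono square_sum_le_sum_squares(1)) auto
    finally show ?thesis .
  qed
  have 2: "(\<Sum>i<N. (v i)\<^sup>2) / (4 * c) \<le> (\<Sum>i<N. I i)"
    unfolding sum_divide_distrib by (intro sum_mono I) auto
  show "V\<^sup>2 / (4 * c * N) \<le> integral {a 0..a N} (\<lambda>x. \<bar>G x\<bar>)" using 1 2 sum by simp
  assume eq: "integral {a 0..a N} (\<lambda>x. \<bar>G x\<bar>) = V\<^sup>2 / (4 * c * N)" and i: "i < N"
  then have e: "(\<Sum>i<N. (v i)\<^sup>2) / (4 * c) = (\<Sum>i<N. I i)" "V\<^sup>2 / (4 * c * N) = (\<Sum>i<N. (v i)\<^sup>2) / (4 * c)"
    using 1 2 sum by auto
  have "V\<^sup>2 / real N / (4 * c) = (\<Sum>i<N. (v i)\<^sup>2) / (4 * c)"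
    using e(2) by (simp add: mult.commute)
  then have "(\<Sum>i<N. (v i)\<^sup>2) = V\<^sup>2 / real N"
    using assms(2) by (metis divide_cancel_right mult_eq_0_iff less_irrefl zero_neq_numeral)
  then have "v i = V / N"
    unfolding Vv by (rule square_sum_le_sum_squares(2)[OF assms(1) _ i])
  moreover have "(\<Sum>i<N. I i - (v i)\<^sup>2 / (4*c)) = 0"
    using e(1) by (simp add: sum_subtractf sum_divide_distrib)
  then have "I i = (v i)\<^sup>2 / (4*c)"
    using i I by (subst (asm) sum_nonneg_eq_0_iff) auto
  ultimately show "\<bar>G (a (Suc i)) - G (a i)\<bar> = V / N \<and>
      integral {a i..a (Suc i)} (\<lambda>x. \<bar>G x\<bar>) = (G (a (Suc i)) - G (a i))\<^sup>2 / (4*c)"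
    unfolding v_def I_def power2_abs by blast
qed

section \<open>Arc length in terms of angles\<close>

text \<open>
  The uncompleted arc length.  It has the \<open>\<sigma>\<close>-algebra on which couplings live, and completing it
  changes neither integrals nor null sets.
\<close>

definition circ :: "complex measure" where
  "circ = distr (restrict_space lborel {0..<2*pi}) circle_borel cis"

lemma arc_length_eq_completion: "arc_length = completion circ"
  by (simp add: arc_length_def circ_def)

lemma sets_circ [simp, measurable_cong]: "sets circ = sets circle_borel"
  by (simp add: circ_def)

lemma space_circ [simp]: "space circ = circle"
  by (simp add: circ_def space_restrict_space)

lemma measurable_cis [measurable]: "cis \<in> borel \<rightarrow>\<^sub>M circle_borel"
  by (intro measurable_restrict_space2 borel_measurable_continuous_onI continuous_intros) auto

lemma measurable_cis_restrict: "cis \<in> restrict_space lborel S \<rightarrow>\<^sub>M circle_borel"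
  using measurable_restrict_space1[of cis lborel circle_borel S] measurable_cis by simp

lemma nn_integral_period:
  fixes \<phi> :: "real \<Rightarrow> ennreal"
  assumes [measurable]: "\<phi> \<in> borel_measurable borel" and per: "\<And>t. \<phi> (t + 2*pi) = \<phi> t"
  shows "(\<integral>\<^sup>+t. \<phi> t * indicator {b..<b+2*pi} t \<partial>lborel) = (\<integral>\<^sup>+t. \<phi> t * indicator {0..<2*pi} t \<partial>lborel)"
proof -
  have per_nat: "\<phi> (t + real n * (2*pi)) = \<phi> t" for t n
  proof (induction n)
    case (Suc n)
    have "\<phi> (t + real (Suc n) * (2*pi)) = \<phi> ((t + real n * (2*pi)) + 2*pi)"
      by (simp add: algebra_simps)
    then show ?case using Suc per by simp
  qed simp
  have per_int: "\<phi> (t + of_int n * (2*pi)) = \<phi> t" for t n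
  proof (cases "n \<ge> 0")
    case True
    then show ?thesis using per_nat[of t "nat n"] by simp
  next
    case False
    then show ?thesis using per_nat[of "t + of_int n * (2*pi)" "nat (- n)"] by simp
  qed
  have shift: "(\<integral>\<^sup>+t. \<phi> t * indicator {x + of_int n * (2*pi)..<y + of_int n * (2*pi)} t \<partial>lborel)
      = (\<integral>\<^sup>+t. \<phi> t * indicator {x..<y} t \<partial>lborel)" for x y n
    by (subst nn_integral_real_affine[where c = 1 and t = "of_int n * (2*pi)"])
       (auto simp: per_int add.commute[of "of_int n * (2*pi)"] indicator_def intro!: nn_integral_cong)
  define n where "n = \<lfloor>b / (2*pi)\<rfloor>"
  define r where "r = b - of_int n * (2*pi)"
  have r: "0 \<le> r" "r \<le> 2*pi"
    using floor_divide_lower[of "2*pi" b] floor_divide_upper[of "2*pi" b]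
    by (auto simp: r_def n_def algebra_simps)
  have split: "(\<integral>\<^sup>+t. \<phi> t * indicator {x..<z} t \<partial>lborel) = (\<integral>\<^sup>+t. \<phi> t * indicator {x..<y} t \<partial>lborel)
      + (\<integral>\<^sup>+t. \<phi> t * indicator {y..<z} t \<partial>lborel)" if "x \<le> y" "y \<le> z" for x y z :: real
    using that by (subst nn_integral_add[symmetric]) (auto simp: indicator_def intro!: nn_integral_cong)
  have "(\<integral>\<^sup>+t. \<phi> t * indicator {b..<b+2*pi} t \<partial>lborel) = (\<integral>\<^sup>+t. \<phi> t * indicator {r..<r+2*pi} t \<partial>lborel)"
    using shift[of r n "r + 2*pi"] by (simp add: r_def algebra_simps)
  also have "\<dots> = (\<integral>\<^sup>+t. \<phi> t * indicator {r..<2*pi} t \<partial>lborel) + (\<integral>\<^sup>+t. \<phi> t * indicator {0..<r} t \<partial>lborel)"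
    using r split[of r "2*pi" "r+2*pi"] shift[of 0 1 r] by simp
  also have "\<dots> = (\<integral>\<^sup>+t. \<phi> t * indicator {0..<2*pi} t \<partial>lborel)"
    using r split[of 0 r "2*pi"] by (simp add: add.commute)
  finally show ?thesis .
qed

lemma cis_add_2pi [simp]: "cis (t + 2*pi) = cis t"
  by (simp add: complex_eq_iff)

text \<open>
  The circle may be cut open at an arbitrary angle \<open>b\<close>; this is what allows angles to be
  measured from a nodal point, and it contains the invariance under rotations.
\<close>

lemma circ_eq: "circ = distr (restrict_space lborel {b..<b+2*pi}) circle_borel cis"
proof (rule measure_eqI)
  fix A assume "A \<in> sets circ"
  then have A [measurable]: "A \<in> sets circle_borel" by simp
  have m [measurable]: "(\<lambda>t. indicator A (cis t) :: ennreal) \<in> borel_measurable borel"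
    by measurable
  have *: "emeasure (distr (restrict_space lborel {c..<c+2*pi}) circle_borel cis) A
      = (\<integral>\<^sup>+t. indicator A (cis t) * indicator {c..<c+2*pi} t \<partial>lborel)" for c
  proof -
    have "emeasure (distr (restrict_space lborel {c..<c+2*pi}) circle_borel cis) A
      = (\<integral>\<^sup>+x. indicator A x \<partial>distr (restrict_space lborel {c..<c+2*pi}) circle_borel cis)"
      by simp
    also have "\<dots> = (\<integral>\<^sup>+t. indicator A (cis t) \<partial>restrict_space lborel {c..<c+2*pi})"
      by (rule nn_integral_distr[OF measurable_cis_restrict]) simp
    finally show ?thesis
      by (simp add: nn_integral_restrict_space)
  qed
  show "emeasure circ A = emeasure (distr (restrict_space lborel {b..<b+2*pi}) circle_borel cis) A"
    using nn_integral_period[of "\<lambda>t. indicator A (cis t)" b] m *[of 0] *[of b]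
    by (simp add: circ_def)
qed simp

lemma nn_integral_circ:
  assumes "\<phi> \<in> borel_measurable circle_borel"
  shows "(\<integral>\<^sup>+x. \<phi> x \<partial>circ) = (\<integral>\<^sup>+t. \<phi> (cis t) * indicator {b..<b+2*pi} t \<partial>lborel)"
  unfolding circ_eq[of b] using assms
  by (simp add: nn_integral_distr[OF measurable_cis_restrict] nn_integral_restrict_space)

lemma integral_circ:
  fixes \<phi> :: "complex \<Rightarrow> real"
  assumes "\<phi> \<in> borel_measurable circle_borel"
  shows "(\<integral>x. \<phi> x \<partial>circ) = (LINT t:{b..<b+2*pi}|lborel. \<phi> (cis t))"
  unfolding circ_eq[of b] using assms
  by (simp add: integral_distr[OF measurable_cis_restrict] integral_restrict_space set_lebesgue_integral_def)

lemma AE_circ_cis: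
  assumes "AE x in circ. P x"
  shows "AE t in lborel. t \<in> {b..<b+2*pi} \<longrightarrow> P (cis t)"
  using AE_distrD[OF measurable_cis_restrict assms[unfolded circ_eq[of b]]]
  by (simp add: AE_restrict_space_iff)

lemma AE_circ_cis_iff:
  assumes "{x \<in> circle. P x} \<in> sets circle_borel"
  shows "(AE x in circ. P x) \<longleftrightarrow> (AE t in lborel. t \<in> {b..<b+2*pi} \<longrightarrow> P (cis t))"
  unfolding circ_eq[of b] using assms
  by (subst AE_distr_iff[OF measurable_cis_restrict]) (auto simp: AE_restrict_space_iff space_restrict_space)

lemma finite_measure_circ: "finite_measure circ"
proof
  have "emeasure arc_length circle \<noteq> \<infinity>" by (simp add: emeasure_arc_length_circle)
  moreover have "circle \<in> sets circ" using sets.top[of circ] by simp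
  ultimately show "emeasure circ (space circ) \<noteq> \<infinity>"
    by (simp add: arc_length_eq_completion)
qed

interpretation circ: finite_measure circ by (rule finite_measure_circ)

lemma measurable_rotation [measurable]: "(\<lambda>x. x * cis \<theta>) \<in> circle_borel \<rightarrow>\<^sub>M circle_borel"
  by (intro measurable_restrict_space3 borel_measurable_continuous_onI continuous_intros)
     (auto simp: norm_mult)

lemma nn_integral_circ_rotate:
  assumes [measurable]: "\<phi> \<in> borel_measurable circle_borel"
  shows "(\<integral>\<^sup>+x. \<phi> (x * cis \<theta>) \<partial>circ) = (\<integral>\<^sup>+x. \<phi> x \<partial>circ)"
proof -
  have m: "(\<lambda>t. \<phi> (cis t)) \<in> borel_measurable borel" by measurable
  have "(\<integral>\<^sup>+x. \<phi> x \<partial>circ) = (\<integral>\<^sup>+t. \<phi> (cis t) * indicator {\<theta>..<\<theta>+2*pi} t \<partial>lborel)"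
    by (rule nn_integral_circ) simp
  also have "\<dots> = (\<integral>\<^sup>+t. \<phi> (cis t * cis \<theta>) * indicator {0..<0+2*pi} t \<partial>lborel)"
    using m by (subst nn_integral_real_affine[where c = 1 and t = \<theta>])
       (auto simp: cis_mult add.commute indicator_def intro!: nn_integral_cong)
  also have "\<dots> = (\<integral>\<^sup>+x. \<phi> (x * cis \<theta>) \<partial>circ)"
    by (rule nn_integral_circ[symmetric]) simp
  finally show ?thesis by simp
qed

lemma cis_inj_period: "cis s = cis t \<Longrightarrow> \<bar>s - t\<bar> < 2*pi \<Longrightarrow> s = t"
proof -
  assume "cis s = cis t" "\<bar>s - t\<bar> < 2*pi"
  then obtain m where "t = s + of_int m * (2*pi)"
    by (auto simp: cis_eq_iff rcong_altdef)
  then obtain n where "s - t = 2 * pi * of_int n"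
    using that[of "- m"] by (simp add: algebra_simps)
  with \<open>\<bar>s - t\<bar> < 2*pi\<close> have "\<bar>of_int n :: real\<bar> < 1" by (simp add: abs_mult)
  then have "n = 0" by linarith
  with \<open>s - t = 2 * pi * of_int n\<close> show ?thesis by simp
qed

text \<open>
  The angle of \<open>x\<close> on the circle cut open at \<open>cis b\<close>.
\<close>

definition angle :: "real \<Rightarrow> complex \<Rightarrow> real" where
  "angle b x = b + Arg2pi (x * cis (- b))"

lemma angle_bounds: "b \<le> angle b x" "angle b x < b + 2*pi"
  using Arg2pi[of "x * cis (-b)"] by (auto simp: angle_def)

lemma cis_angle: "x \<in> circle \<Longrightarrow> cis (angle b x) = x"
proof -
  assume "x \<in> circle"
  then have "x * cis (-b) = cis (Arg2pi (x * cis (-b)))"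
    using Arg2pi_eq[of "x * cis (-b)"] by (simp add: norm_mult cis_conv_exp)
  then have "cis (angle b x) = cis b * (x * cis (-b))"
    by (simp add: angle_def cis_mult[symmetric])
  then show ?thesis by (simp add: cis_mult mult.left_commute)
qed

lemma angle_cis: "t \<in> {b..<b+2*pi} \<Longrightarrow> angle b (cis t) = t"
  using angle_bounds[of b "cis t"] by (intro cis_inj_period) (auto simp: cis_angle)

lemma circle_eq_cis_image: "circle = cis ` {b..<b+2*pi}"
proof (intro equalityI subsetI)
  fix x assume "x \<in> circle"
  then show "x \<in> cis ` {b..<b+2*pi}" using cis_angle angle_bounds
    by (intro image_eqI[of _ _ "angle b x"]) auto
qed auto

text \<open>
  On the circle the argument is a piecewise combination of arc cosines of the real part, which avoids
  its discontinuity at the positive real axis.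
\<close>

lemma measurable_angle [measurable]: "angle b \<in> borel_measurable circle_borel"
proof -
  have "(\<lambda>y. Arg2pi y) \<in> borel_measurable circle_borel"
  proof -
    have "\<bar>Re y\<bar> \<le> 1" if "y \<in> circle" for y
      using that abs_Re_le_cmod[of y] by simp
    then have "continuous_on circle (\<lambda>y. arccos (Re y))"
      by (intro continuous_on_arccos continuous_intros) (auto simp: abs_le_iff)
    then have [measurable]: "(\<lambda>y. arccos (Re y)) \<in> borel_measurable circle_borel"
      by (rule borel_measurable_continuous_on_restrict)
    have [measurable]: "Im \<in> borel_measurable circle_borel"
      by (intro borel_measurable_continuous_on_restrict continuous_intros)
    have "(\<lambda>y. if 0 \<le> Im y then arccos (Re y) else 2*pi - arccos (Re y)) \<in> borel_measurable circle_borel"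
      by measurable
    moreover have "(if 0 \<le> Im y then arccos (Re y) else 2*pi - arccos (Re y)) = Arg2pi y" if "y \<in> circle" for y
    proof -
      have "y = cis (Arg2pi y)" using that Arg2pi_eq[of y] by (simp add: cis_conv_exp)
      then have e: "Re y = cos (Arg2pi y)" "Im y = sin (Arg2pi y)"
        by (metis cis.sel(1)) (metis \<open>y = cis (Arg2pi y)\<close> cis.sel(2))
      show ?thesis
      proof (cases "Arg2pi y \<le> pi")
        case True
        then show ?thesis using e Arg2pi[of y] Arg2pi_le_pi[of y] by (simp add: arccos_cos)
      next
        case False
        have "arccos (Re y) = arccos (cos (2*pi - Arg2pi y))" using e by simp
        also have "\<dots> = 2*pi - Arg2pi y" using False Arg2pi[of y] by (intro arccos_cos) auto
        finally show ?thesis using False Arg2pi_le_pi[of y] by simp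
      qed
    qed
    ultimately show ?thesis
      using measurable_cong[of circle_borel "\<lambda>y. if 0 \<le> Im y then arccos (Re y) else 2*pi - arccos (Re y)"
          Arg2pi borel]
      by (simp add: space_restrict_space)
  qed
  then show ?thesis unfolding angle_def by measurable
qed

lemma arc_dist_cis_eq:
  assumes "s \<in> {b..<b+2*pi}" "t \<in> {b..<b+2*pi}"
  shows "arc_dist (cis s) (cis t) = min \<bar>s - t\<bar> (2*pi - \<bar>s - t\<bar>)"
proof -
  have pos: "(x rmod (2*pi)) = x \<and> ((-x) rmod (2*pi)) = (if x = 0 then 0 else 2*pi - x)"
    if "0 \<le> x" "x < 2*pi" for x
    using that by (auto intro!: rmod_unique[of _ _ _ 0] rmod_unique[of _ _ _ "-1"])
  show ?thesis
    using pos[of "s - t"] pos[of "t - s"] assms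
    by (cases "s \<le> t") (auto simp: arc_dist_cis)
qed

lemma arc_dist_cis_le: "arc_dist (cis s) (cis t) \<le> \<bar>s - t\<bar>"
proof -
  have "x rmod (2*pi) \<le> x" if "x \<ge> 0" for x
  proof -
    have "of_int \<lfloor>x / (2*pi)\<rfloor> * (2*pi) \<ge> 0" using that by simp
    then show ?thesis by (simp add: rmod_def)
  qed
  from this[of "s - t"] this[of "t - s"] show ?thesis
    by (cases "s \<le> t") (auto simp: arc_dist_cis)
qed

lemma arc_dist_bounds: "0 \<le> arc_dist x y" "arc_dist x y \<le> 2*pi"
  by (auto simp: arc_dist_def rmod_nonneg rmod_le min_le_iff_disj)

section \<open>Signs between nodal points\<close>

lemma openin_cis_image_interval:
  assumes "b \<le> a + 2*pi"
  shows "openin circle_top (cis ` {a<..<b})"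
proof (cases "a < b")
  case True
  have "cis ` {a<..<b} = circle - cis ` {b..a+2*pi}"
  proof (intro equalityI subsetI)
    fix x assume "x \<in> cis ` {a<..<b}"
    then obtain t where t: "x = cis t" "a < t" "t < b" by auto
    moreover have "cis t \<noteq> cis u" if "u \<in> {b..a+2*pi}" for u
      using cis_inj_period[of t u] t that by auto
    ultimately show "x \<in> circle - cis ` {b..a+2*pi}" by (metis DiffI imageE norm_cis mem_sphere_0)
  next
    fix x assume x: "x \<in> circle - cis ` {b..a+2*pi}"
    then obtain t where t: "x = cis t" "t \<in> {a..<a+2*pi}" using circle_eq_cis_image[of a] by auto
    have "t \<noteq> a" using x t True assms cis_add_2pi[of a] by (metis Diff_iff atLeastAtMost_iff image_eqI order_refl)
    moreover have "t < b" using x t by (cases "t < b") auto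
    ultimately show "x \<in> cis ` {a<..<b}" using t by auto
  qed
  moreover have "closed (cis ` {b..a+2*pi})"
    by (intro compact_imp_closed compact_continuous_image continuous_intros) auto
  ultimately show ?thesis
    unfolding openin_open by (metis Diff_eq open_Compl)
qed auto

lemma arc_borel [measurable]: "b \<le> a + 2*pi \<Longrightarrow> cis ` {a<..<b} \<in> sets circle_borel"
  using openin_cis_image_interval[of b a]
  by (auto simp: openin_open sets_restrict_space)

lemma cis_mem_arc:
  assumes "b \<le> a + 2*pi" "t \<in> {a..<a+2*pi}"
  shows "cis t \<in> cis ` {a<..<b} \<longleftrightarrow> t \<in> {a<..<b}"
proof
  assume "cis t \<in> cis ` {a<..<b}"
  then obtain u where "cis t = cis u" "u \<in> {a<..<b}" by auto
  moreover from this assms have "\<bar>t - u\<bar> < 2*pi" by auto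
  ultimately show "t \<in> {a<..<b}" using cis_inj_period[of t u] by simp
qed auto

lemma connected_cis_image: "connected S \<Longrightarrow> connected (cis ` S)"
  by (intro connected_continuous_image continuous_intros)

lemma dist_cis_le: "dist (cis s) (cis t) \<le> \<bar>s - t\<bar>"
proof -
  have "dist (cis s) (cis t) = cmod (cis (s - t) - 1)"
  proof -
    have "cis s - cis t = cis t * (cis (s - t) - 1)" by (simp add: algebra_simps cis_mult)
    then show ?thesis by (simp add: dist_norm norm_mult)
  qed
  also have "\<dots> = 2 * \<bar>sin ((s - t) / 2)\<bar>"
    using dist_exp_i_1[of "s - t"] by (simp add: cis_conv_exp)
  also have "\<dots> \<le> \<bar>s - t\<bar>" using abs_sin_x_le_abs_x[of "(s - t) / 2"] by simp
  finally show ?thesis .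
qed

lemma cis_in_closure_of:
  assumes "\<And>e. e > 0 \<Longrightarrow> \<exists>t. \<bar>t - u\<bar> < e \<and> cis t \<in> S"
  shows "cis u \<in> circle_top closure_of S"
proof -
  have "cis u \<in> closure (circle \<inter> S)"
    unfolding closure_approachable
  proof (intro allI impI)
    fix e :: real assume "e > 0"
    then obtain t where "\<bar>t - u\<bar> < e" "cis t \<in> S" using assms by blast
    then show "\<exists>y\<in>circle \<inter> S. dist y (cis u) < e"
      using dist_cis_le[of t u] by (intro bexI[of _ "cis t"]) auto
  qed
  then show ?thesis by (simp add: closure_of_subtopology)
qed

lemma boundary_posI:
  assumes "\<And>e. e > 0 \<Longrightarrow> \<exists>t. \<bar>t - u\<bar> < e \<and> f (cis t) > 0"
    and "\<And>e. e > 0 \<Longrightarrow> \<exists>t. \<bar>t - u\<bar> < e \<and> f (cis t) \<le> 0"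
  shows "cis u \<in> boundary_pos f"
proof -
  have "cis u \<in> circle_top closure_of {x \<in> circle. f x > 0}"
    using assms(1) by (intro cis_in_closure_of) auto
  moreover have "cis u \<in> circle_top closure_of (topspace circle_top - {x \<in> circle. f x > 0})"
    using assms(2) by (intro cis_in_closure_of) (auto simp: not_less)
  ultimately show ?thesis unfolding boundary_pos_def frontier_of_closures by blast
qed

lemma boundary_uminus:
  "boundary_pos (\<lambda>x. - f x) = boundary_neg f" "boundary_neg (\<lambda>x. - f x) = boundary_pos f"
  by (simp_all add: boundary_pos_def boundary_neg_def)

lemma boundary_negI:
  assumes "\<And>e. e > 0 \<Longrightarrow> \<exists>t. \<bar>t - u\<bar> < e \<and> f (cis t) < 0"
    and "\<And>e. e > 0 \<Longrightarrow> \<exists>t. \<bar>t - u\<bar> < e \<and> f (cis t) \<ge> 0"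
  shows "cis u \<in> boundary_neg f"
  unfolding boundary_uminus(1)[symmetric] using assms by (intro boundary_posI) auto

lemma nodal1_uminus: "nodal1 (\<lambda>x. - f x) = nodal1 f"
  by (auto simp: nodal1_def boundary_uminus)

lemma sign_change_components_uminus: "sign_change_components (\<lambda>x. - f x) = sign_change_components f"
  by (auto simp: sign_change_components_def boundary_uminus zero_components_def)

text \<open>
  Let \<open>u\<close> be the last angle approached by positive values, and \<open>v\<close> the first one
  after \<open>u\<close> approached by negative values.  If \<open>u = v\<close>, that point lies on both boundaries.  Otherwise \<open>f\<close> vanishes
  in between, and the zero component containing the gap touches both boundaries;
  it cannot reach around the circle since it would have to pass \<open>cis s\<close> or \<open>cis t\<close>.
\<close>

lemma sign_change_between_pos_neg:
  assumes "s < t" "t < s + 2*pi" "f (cis s) > 0" "f (cis t) < 0"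
  shows "(\<exists>u\<in>{s..t}. cis u \<in> nodal1 f) \<or> (\<exists>J\<in>sign_change_components f. J \<subseteq> cis ` {s<..<t})"
proof -
  define P where "P = {u \<in> {s..t}. f (cis u) > 0}"
  define u where "u = Sup P"
  have P: "s \<in> P" "P \<noteq> {}" "bdd_above P"
    using assms by (auto simp: P_def intro!: bdd_aboveI exI[of _ s])
  have "s \<le> u" unfolding u_def using P by (intro cSup_upper) auto
  moreover have "u \<le> t" unfolding u_def using P(2) by (intro cSup_least) (auto simp: P_def)
  ultimately have u: "s \<le> u" "u \<le> t" by auto
  have u_nonpos: "f (cis x) \<le> 0" if "u < x" "x \<le> t" for x
  proof (rule ccontr)
    assume "\<not> ?thesis"
    then have "x \<in> P" using that u by (auto simp: P_def)
    then show False using that P cSup_upper[of x P] by (simp add: u_def)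
  qed
  have u_pos: "\<exists>x. \<bar>x - u\<bar> < e \<and> f (cis x) > 0" if e: "e > 0" for e
  proof -
    obtain x where "x \<in> P" "u - e < x" using less_cSupD[of P "u - e"] P e by (auto simp: u_def)
    moreover have "x \<le> u" using \<open>x \<in> P\<close> P by (simp add: u_def cSup_upper)
    ultimately show ?thesis by (intro exI[of _ x]) (auto simp: P_def)
  qed
  define Q where "Q = {x \<in> {u..t}. f (cis x) < 0}"
  define v where "v = Inf Q"
  have Q: "t \<in> Q" "Q \<noteq> {}" "bdd_below Q"
    using assms u by (auto simp: Q_def intro!: bdd_belowI exI[of _ t])
  have "u \<le> v" unfolding v_def using Q(2) by (intro cInf_greatest) (auto simp: Q_def)
  moreover have "v \<le> t" unfolding v_def using Q by (intro cInf_lower) auto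
  ultimately have v: "u \<le> v" "v \<le> t" by auto
  have v_nonneg: "f (cis x) \<ge> 0" if "u \<le> x" "x < v" for x
  proof (rule ccontr)
    assume "\<not> ?thesis"
    then have "x \<in> Q" using that v by (auto simp: Q_def)
    then show False using that Q cInf_lower[of x Q] by (simp add: v_def)
  qed
  have v_neg: "\<exists>x. \<bar>x - v\<bar> < e \<and> f (cis x) < 0" if e: "e > 0" for e
  proof -
    obtain x where "x \<in> Q" "x < v + e" using cInf_lessD[of Q "v + e"] Q e by (auto simp: v_def)
    moreover have "v \<le> x" using \<open>x \<in> Q\<close> Q by (simp add: v_def cInf_lower)
    ultimately show ?thesis by (intro exI[of _ x]) (auto simp: Q_def)
  qed
  show ?thesis
  proof (cases "u = v")
    case True
    have "cis u \<in> boundary_pos f"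
      using u_pos v_neg True by (intro boundary_posI) (metis less_imp_le)+
    moreover have "cis u \<in> boundary_neg f"
      using u_pos v_neg True by (intro boundary_negI) (metis less_imp_le)+
    ultimately show ?thesis using u by (auto simp: nodal1_def)
  next
    case False
    then have uv: "u < v" using v by simp
    have zero: "f (cis x) = 0" if "u < x" "x < v" for x
      using u_nonpos[of x] v_nonneg[of x] that v by auto
    define x where "x = (u + v) / 2"
    have x: "u < x" "x < v" using uv by (auto simp: x_def)
    define J where "J = connected_component_set {x \<in> circle. f x = 0} (cis x)"
    have J: "J \<in> zero_components f"
      using zero[OF x] by (auto simp: J_def zero_components_def components_def)
    have J_conn: "connected J" by (simp add: J_def)
    have J_zero: "J \<subseteq> {x \<in> circle. f x = 0}"
      unfolding J_def by (rule connected_component_subset)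
    have arc_J: "cis ` {u<..<v} \<subseteq> J"
      unfolding J_def using x zero
      by (intro connected_component_maximal connected_cis_image) auto
    have "cis u \<in> circle_top closure_of J"
    proof (rule cis_in_closure_of)
      fix e :: real assume "e > 0"
      then show "\<exists>t. \<bar>t - u\<bar> < e \<and> cis t \<in> J"
        using arc_J uv by (intro exI[of _ "u + min (e/2) ((v-u)/2)"]) (auto simp: min_def field_simps)
    qed
    moreover have "cis v \<in> circle_top closure_of J"
    proof (rule cis_in_closure_of)
      fix e :: real assume "e > 0"
      then show "\<exists>t. \<bar>t - v\<bar> < e \<and> cis t \<in> J"
        using arc_J uv by (intro exI[of _ "v - min (e/2) ((v-u)/2)"]) (auto simp: min_def field_simps)
    qed
    moreover have "cis u \<in> boundary_pos f"
    proof (rule boundary_posI[OF u_pos])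
      fix e :: real assume "e > 0"
      then show "\<exists>t. \<bar>t - u\<bar> < e \<and> f (cis t) \<le> 0"
        using zero uv by (intro exI[of _ "u + min (e/2) ((v-u)/2)"]) (auto simp: min_def field_simps)
    qed
    moreover have "cis v \<in> boundary_neg f"
    proof (rule boundary_negI[OF v_neg])
      fix e :: real assume "e > 0"
      then show "\<exists>t. \<bar>t - v\<bar> < e \<and> f (cis t) \<ge> 0"
        using zero uv by (intro exI[of _ "v - min (e/2) ((v-u)/2)"]) (auto simp: min_def field_simps)
    qed
    ultimately have "J \<in> sign_change_components f"
      using J by (auto simp: sign_change_components_def)
    moreover have "J \<subseteq> cis ` {s<..<t}"
    proof -
      have op: "openin (top_of_set J) (J \<inter> cis ` {a<..<b})" if ab: "b \<le> a + 2*pi" for a b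
      proof -
        obtain T where T: "open T" "cis ` {a<..<b} = circle \<inter> T"
          using openin_cis_image_interval[OF ab] unfolding openin_open by blast
        moreover have "J \<inter> cis ` {a<..<b} = J \<inter> T" using T(2) J_zero by blast
        ultimately show ?thesis unfolding openin_open by blast
      qed
      have "cis s \<notin> J" "cis t \<notin> J" using assms J_zero by auto
      then have "J \<subseteq> cis ` {s<..<t} \<union> cis ` {t<..<s+2*pi}"
      proof -
        have "J \<subseteq> cis ` {s..<s+2*pi}" using J_zero circle_eq_cis_image[of s] by auto
        moreover have "{s..<s+2*pi} \<subseteq> {s,t} \<union> {s<..<t} \<union> {t<..<s+2*pi}" by auto
        ultimately have "J \<subseteq> cis ` ({s,t} \<union> {s<..<t} \<union> {t<..<s+2*pi})" by blast
        with \<open>cis s \<notin> J\<close> \<open>cis t \<notin> J\<close> show ?thesis by auto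
      qed
      moreover have "cis ` {s<..<t} \<inter> cis ` {t<..<s+2*pi} = {}"
      proof -
        have "cis y \<noteq> cis z" if "y \<in> {s<..<t}" "z \<in> {t<..<s+2*pi}" for y z
          using cis_inj_period[of y z] that by auto
        then show ?thesis by blast
      qed
      moreover define E1 E2 where "E1 = J \<inter> cis ` {s<..<t}" and "E2 = J \<inter> cis ` {t<..<s+2*pi}"
      ultimately have cover: "J \<subseteq> E1 \<union> E2" "E1 \<inter> E2 = {}" by auto
      have "cis x \<in> E1" using arc_J x u v by (auto simp: E1_def)
      moreover have "openin (top_of_set J) E1" "openin (top_of_set J) E2"
        using assms by (auto intro!: op simp: E1_def E2_def)
      ultimately have "E2 = {}"
        using J_conn cover unfolding connected_openin by blast
      then have "J \<inter> cis ` {t<..<s+2*pi} = {}" by (simp add: E2_def)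
      with \<open>J \<subseteq> cis ` {s<..<t} \<union> cis ` {t<..<s+2*pi}\<close> show ?thesis by auto
    qed
    ultimately show ?thesis by blast
  qed
qed

lemma sign_change_between:
  assumes "s < t" "t < s + 2*pi" "f (cis s) * f (cis t) < 0"
  shows "(\<exists>u\<in>{s..t}. cis u \<in> nodal1 f) \<or> (\<exists>J\<in>sign_change_components f. J \<subseteq> cis ` {s<..<t})"
proof (cases "f (cis s) > 0")
  case True
  then show ?thesis using assms by (intro sign_change_between_pos_neg) (auto simp: mult_less_0_iff)
next
  case False
  then show ?thesis
    using assms sign_change_between_pos_neg[of s t "\<lambda>x. - f x"]
    by (auto simp: mult_less_0_iff nodal1_uminus sign_change_components_uminus)
qed

text \<open>
  The reason why the effective nodal set counts sign changes: every change of sign inside an arc leaves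
  in this arc either a point of the first kind or a whole zero component, and with it the point
  selected there.
\<close>

lemma constant_sign_between_nodal_points:
  assumes sel: "nodal_selection sel" and "b \<le> a + 2*pi"
    and no: "cis ` {a<..<b} \<inter> nodal_set sel f = {}"
  shows "(\<forall>t\<in>{a<..<b}. f (cis t) \<ge> 0) \<or> (\<forall>t\<in>{a<..<b}. f (cis t) \<le> 0)"
proof (rule ccontr)
  assume "\<not> ?thesis"
  then obtain x y where xy: "x \<in> {a<..<b}" "y \<in> {a<..<b}" "f (cis x) < 0" "f (cis y) > 0"
    by (auto simp: not_le)
  define s where "s = min x y"
  define t where "t = max x y"
  have st: "s < t" "t < s + 2*pi" "a < s" "t < b" "f (cis s) * f (cis t) < 0"
    using xy assms(2) by (auto simp: s_def t_def min_def max_def mult_less_0_iff le_less)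
  from sign_change_between[OF st(1,2,5)] show False
  proof
    assume "\<exists>u\<in>{s..t}. cis u \<in> nodal1 f"
    then obtain u where "u \<in> {s..t}" "cis u \<in> nodal1 f" by blast
    then have "cis u \<in> cis ` {a<..<b} \<inter> nodal_set sel f" using st by (auto simp: nodal_set_def)
    then show False using no by blast
  next
    assume "\<exists>J\<in>sign_change_components f. J \<subseteq> cis ` {s<..<t}"
    then obtain J where J: "J \<in> sign_change_components f" "J \<subseteq> cis ` {s<..<t}" by blast
    have "sel f J \<in> J" using sel J by (auto simp: nodal_selection_def)
    moreover have "cis ` {s<..<t} \<subseteq> cis ` {a<..<b}" using st by (intro image_mono) auto
    ultimately have "sel f J \<in> cis ` {a<..<b}" using J(2) by blast
    moreover have "sel f J \<in> nodal_set sel f" using J(1) by (auto simp: nodal_set_def nodal2_def)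
    ultimately show False using no by blast
  qed
qed

section \<open>Alternating step profiles\<close>

lemma partition_locate:
  fixes a :: "nat \<Rightarrow> real"
  assumes "a 0 \<le> t" "t < a N"
  obtains i where "i < N" "a i \<le> t" "t < a (Suc i)"
proof -
  have "\<exists>i<N. a i \<le> t \<and> t < a (Suc i)"
    using assms
  proof (induction N)
    case (Suc N)
    show ?case
    proof (cases "t < a N")
      case True
      then show ?thesis using Suc by (meson less_SucI)
    next
      case False
      then show ?thesis using Suc.prems by (intro exI[of _ N]) auto
    qed
  qed simp
  then show ?thesis using that by blast
qed

lemma emeasure_circ_arc:
  assumes "a \<le> b" "b \<le> a + 2*pi"
  shows "emeasure circ (cis ` {a<..<b}) = ennreal (b - a)"
proof -
  have [measurable]: "cis ` {a<..<b} \<in> sets circle_borel" using assms(2) by (rule arc_borel)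
  have "emeasure circ (cis ` {a<..<b}) = (\<integral>\<^sup>+x. indicator (cis ` {a<..<b}) x \<partial>circ)"
    by simp
  also have "\<dots> = (\<integral>\<^sup>+t. indicator (cis ` {a<..<b}) (cis t) * indicator {a..<a+2*pi} t \<partial>lborel)"
    by (rule nn_integral_circ) simp
  also have "\<dots> = (\<integral>\<^sup>+t. indicator {a<..<b} t \<partial>lborel)"
    using cis_mem_arc[OF assms(2)] assms(2)
    by (intro nn_integral_cong) (auto simp: indicator_def)
  finally show ?thesis using assms(1) by simp
qed

text \<open>
  Nodal points at the angles \<open>a 0 < \<dots> < a (N - 1)\<close>, far enough apart for arcs of width \<open>w\<close> on both sides
  of each of them, and a sign for every sector between consecutive ones.  The sector \<open>N - 1\<close> is closed
  by \<open>a N\<close>, which is the first nodal point after a full turn.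
\<close>

locale alternating_arcs =
  fixes c w :: real and N :: nat and a s :: "nat \<Rightarrow> real"
  assumes c_pos: "c > 0" and w_pos: "w > 0" and N_pos: "N > 0" and N_even: "even N"
    and gap: "\<And>i. i < N \<Longrightarrow> a i + 2 * w \<le> a (Suc i)"
    and turn: "a N = a 0 + 2 * pi"
    and sign: "s 0 \<in> {1, -1}" and alternate: "\<And>i. s (Suc i) = - s i"
begin

definition right_arc :: "nat \<Rightarrow> complex set" where
  "right_arc i = cis ` {a i<..<a i + w}"

definition left_arc :: "nat \<Rightarrow> complex set" where
  "left_arc i = cis ` {a i - w<..<a i}"

definition profile :: "complex \<Rightarrow> real" where
  "profile x = (\<Sum>i<N. c * s i * (indicator (right_arc i) x - indicator (left_arc i) x))"

definition nodes :: "complex set" where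
  "nodes = cis ` a ` {..<N}"

lemma s_cases: "s i = 1 \<or> s i = -1"
  using sign by (induction i) (auto simp: alternate)

lemma s_even: "even i \<Longrightarrow> s i = s 0"
proof (elim evenE)
  show "i = 2 * k \<Longrightarrow> s i = s 0" for k
    by (induction k arbitrary: i) (auto simp: alternate)
qed

lemma s_turn: "s N = s 0"
  using N_even by (rule s_even)

lemma a_gap: "i < j \<Longrightarrow> j \<le> N \<Longrightarrow> a i + 2 * w \<le> a j"
proof (induction j)
  case (Suc j)
  then show ?case using gap[of j] w_pos by (cases "i = j") fastforce+
qed simp

lemma a_mono: "i \<le> j \<Longrightarrow> j \<le> N \<Longrightarrow> a i \<le> a j"
  using a_gap[of i j] w_pos by (cases "i = j") auto

lemma w_le: "w \<le> pi"
  using a_gap[of 0 N] N_pos turn by auto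

lemma left_arc_turn: "left_arc N = left_arc 0"
proof -
  have "{a N - w<..<a N} = (+) (2*pi) ` {a 0 - w<..<a 0}"
  proof (intro equalityI subsetI)
    fix t assume "t \<in> {a N - w<..<a N}"
    then show "t \<in> (+) (2*pi) ` {a 0 - w<..<a 0}"
      by (intro image_eqI[of _ _ "t - 2*pi"]) (auto simp: turn)
  qed (auto simp: turn)
  then show ?thesis by (simp add: left_arc_def image_image add.commute[of "2*pi"])
qed

lemma arcs_measurable [measurable]: "right_arc i \<in> sets circle_borel" "left_arc i \<in> sets circle_borel"
  unfolding right_arc_def left_arc_def using w_le pi_gt_zero by (intro arc_borel; linarith)+

lemma mem_right_arc:
  assumes "i < N" "a 0 \<le> t" "t < a N"
  shows "cis t \<in> right_arc i \<longleftrightarrow> a i < t \<and> t < a i + w"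
proof
  assume "cis t \<in> right_arc i"
  then obtain u where u: "cis t = cis u" "a i < u" "u < a i + w" by (auto simp: right_arc_def)
  moreover have "\<bar>t - u\<bar> < 2*pi"
    using u assms a_mono[of 0 i] a_gap[of i N] turn w_pos by auto
  ultimately show "a i < t \<and> t < a i + w" using cis_inj_period by metis
qed (auto simp: right_arc_def)

lemma mem_left_arc:
  assumes "i < N" "a 0 \<le> t" "t < a N"
  shows "cis t \<in> left_arc (Suc i) \<longleftrightarrow> a (Suc i) - w < t \<and> t < a (Suc i)"
proof
  assume "cis t \<in> left_arc (Suc i)"
  then obtain u where u: "cis t = cis u" "a (Suc i) - w < u" "u < a (Suc i)" by (auto simp: left_arc_def)
  moreover have "\<bar>t - u\<bar> < 2*pi"
    using u assms a_gap[of 0 "Suc i"] a_mono[of "Suc i" N] turn w_pos by auto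
  ultimately show "a (Suc i) - w < t \<and> t < a (Suc i)" using cis_inj_period by metis
qed (auto simp: left_arc_def)

text \<open>
  Every sector between nodal points contains the right arc of its first end point and the left arc of
  its second one.  Grouping the arcs by sectors instead of nodal points makes the values of a profile
  visible; grouping by nodal points exhibits the antisymmetry.
\<close>

lemma sum_left_arc_shift:
  assumes "k N = k 0"
  shows "(\<Sum>i<N. k i * indicator (left_arc i) x) = (\<Sum>i<N. k (Suc i) * (indicator (left_arc (Suc i)) x :: real))"
proof -
  let ?f = "\<lambda>i. k i * (indicator (left_arc i) x :: real)"
  have "(\<Sum>i<N. ?f i) + ?f N = ?f 0 + (\<Sum>i<N. ?f (Suc i))"
    using sum.lessThan_Suc_shift[of ?f N] by simp
  then show ?thesis using assms by (simp add: left_arc_turn)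
qed

lemma sum_arcs_cis:
  assumes "i < N" "a i \<le> t" "t < a (Suc i)"
  shows "(\<Sum>j<N. k j * (indicator (right_arc j) (cis t) + indicator (left_arc (Suc j)) (cis t)))
    = k i * (if a i < t \<and> t < a i + w \<or> a (Suc i) - w < t then 1 else (0::real))"
proof -
  have t: "a 0 \<le> t" "t < a N" using assms a_mono[of 0 i] a_mono[of "Suc i" N] by auto
  have "indicator (right_arc j) (cis t) + indicator (left_arc (Suc j)) (cis t)
     = (if i = j \<and> (a i < t \<and> t < a i + w \<or> a (Suc i) - w < t) then 1 else (0::real))" if "j < N" for j
  proof (cases "i = j")
    case True
    then show ?thesis
      using assms gap[of i] w_pos by (auto simp: mem_right_arc mem_left_arc t indicator_def)
  next
    case False
    then consider "Suc i \<le> j" | "Suc j \<le> i" by linarith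
    then have "cis t \<notin> right_arc j \<and> cis t \<notin> left_arc (Suc j)"
    proof cases
      case 1
      then have "a (Suc i) \<le> a j" "a (Suc i) + 2*w \<le> a (Suc j)"
        using a_mono[of "Suc i" j] a_gap[of "Suc i" "Suc j"] that by auto
      then show ?thesis using assms that w_pos by (auto simp: mem_right_arc mem_left_arc t)
    next
      case 2
      then have "a (Suc j) \<le> a i" "a j + 2*w \<le> a i"
        using a_mono[of "Suc j" i] a_gap[of j i] assms by auto
      then show ?thesis using assms that w_pos by (auto simp: mem_right_arc mem_left_arc t)
    qed
    then show ?thesis using False by simp
  qed
  then have "(\<Sum>j<N. k j * (indicator (right_arc j) (cis t) + indicator (left_arc (Suc j)) (cis t)))
    = (\<Sum>j<N. if j = i then k i * (if a i < t \<and> t < a i + w \<or> a (Suc i) - w < t then 1 else (0::real)) else 0)"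
    by (intro sum.cong) auto
  then show ?thesis using assms(1) by simp
qed

lemma profile_eq:
  "profile x = (\<Sum>i<N. c * s i * (indicator (right_arc i) x + indicator (left_arc (Suc i)) x))"
proof -
  have "profile x = (\<Sum>i<N. c * s i * indicator (right_arc i) x) - (\<Sum>i<N. c * s i * indicator (left_arc i) x)"
    by (simp add: profile_def right_diff_distrib sum_subtractf)
  also have "(\<Sum>i<N. c * s i * indicator (left_arc i) x) = (\<Sum>i<N. c * s (Suc i) * indicator (left_arc (Suc i)) x)"
    using s_turn by (intro sum_left_arc_shift) simp
  finally show ?thesis
    by (simp add: alternate sum_negf distrib_left sum.distrib)
qed

lemma profile_cis:
  assumes "i < N" "a i \<le> t" "t < a (Suc i)"
  shows "profile (cis t) = c * s i * (if a i < t \<and> t < a i + w \<or> a (Suc i) - w < t then 1 else 0)"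
  unfolding profile_eq by (rule sum_arcs_cis[OF assms])

lemma circle_cases:
  assumes "x \<in> circle"
  obtains i t where "i < N" "a i \<le> t" "t < a (Suc i)" "x = cis t"
proof -
  obtain t where t: "x = cis t" "a 0 \<le> t" "t < a N"
    using assms circle_eq_cis_image[of "a 0"] turn by auto
  from partition_locate[OF t(2,3)] obtain i where "i < N" "a i \<le> t" "t < a (Suc i)" .
  then show ?thesis using t that by blast
qed

lemma map_profile:
  assumes "x \<in> circle" "\<phi> 0 = (0::real)"
  shows "\<phi> (profile x) = (\<Sum>j<N. \<phi> (c * s j) * (indicator (right_arc j) x + indicator (left_arc (Suc j)) x))"
proof -
  obtain i t where it: "i < N" "a i \<le> t" "t < a (Suc i)" "x = cis t"
    using circle_cases[OF assms(1)] .
  show ?thesis unfolding it(4) sum_arcs_cis[OF it(1-3)] profile_cis[OF it(1-3)]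
    by (simp add: assms(2))
qed

lemma profile_right: "i < N \<Longrightarrow> a i < t \<Longrightarrow> t < a i + w \<Longrightarrow> profile (cis t) = c * s i"
  using profile_cis[of i t] gap[of i] w_pos by simp

lemma profile_left_Suc: "i < N \<Longrightarrow> a (Suc i) - w < t \<Longrightarrow> t < a (Suc i) \<Longrightarrow> profile (cis t) = c * s i"
  using profile_cis[of i t] gap[of i] w_pos by simp

lemma profile_left:
  assumes "i < N" "a i - w < t" "t < a i"
  shows "profile (cis t) = - (c * s i)"
proof (cases i)
  case (Suc j)
  then show ?thesis using profile_left_Suc[of j t] assms by (simp add: alternate)
next
  case 0
  obtain k where k: "N = Suc k" using N_pos by (cases N) auto
  have "profile (cis (t + 2*pi)) = c * s k"
    using profile_left_Suc[of k "t + 2*pi"] assms turn by (simp add: k 0)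
  moreover have "s 0 = - s k" using s_turn alternate[of k] by (simp add: k)
  ultimately show ?thesis by (simp add: 0)
qed

lemma profile_node: "i < N \<Longrightarrow> profile (cis (a i)) = 0"
  using profile_cis[of i "a i"] gap[of i] w_pos by simp

lemma profile_gap: "i < N \<Longrightarrow> a i + w \<le> t \<Longrightarrow> t \<le> a (Suc i) - w \<Longrightarrow> profile (cis t) = 0"
  using profile_cis[of i t] w_pos by simp

lemma abs_profile_le: "x \<in> circle \<Longrightarrow> \<bar>profile x\<bar> \<le> c"
proof -
  assume "x \<in> circle"
  then obtain i t where it: "i < N" "a i \<le> t" "t < a (Suc i)" "x = cis t"
    using circle_cases by blast
  show ?thesis unfolding it(4) profile_cis[OF it(1-3)] using c_pos s_cases[of i] by auto
qed

lemma profile_range: "x \<in> circle \<Longrightarrow> profile x \<in> {c, - c, 0}"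
proof -
  assume "x \<in> circle"
  then obtain i t where it: "i < N" "a i \<le> t" "t < a (Suc i)" "x = cis t"
    using circle_cases by blast
  show ?thesis unfolding it(4) profile_cis[OF it(1-3)] using s_cases[of i] by auto
qed

lemma profile_nonzeroE:
  assumes "x \<in> circle" "profile x \<noteq> 0"
  obtains i where "i < N" "x \<in> right_arc i" | i where "i < N" "x \<in> left_arc i"
proof -
  have "\<exists>i<N. x \<in> right_arc i \<or> x \<in> left_arc i"
  proof (rule ccontr)
    assume "\<not> ?thesis"
    then have "profile x = 0" unfolding profile_def by (intro sum.neutral) auto
    then show False using assms by simp
  qed
  then show ?thesis using that by blast
qed

lemma profile_measurable [measurable]: "profile \<in> borel_measurable circle_borel"
  unfolding profile_def by measurable

lemma measure_arcs: "measure circ (right_arc i) = w" "measure circ (left_arc i) = w"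
  using w_le w_pos emeasure_circ_arc[of "a i" "a i + w"] emeasure_circ_arc[of "a i - w" "a i"]
  by (auto simp: right_arc_def left_arc_def measure_def)

lemma arcs_Int_circle [simp]: "right_arc i \<inter> circle = right_arc i" "left_arc i \<inter> circle = left_arc i"
  by (auto simp: right_arc_def left_arc_def)

lemma integrable_arcs [simp]:
  "integrable circ (indicator (right_arc i) :: complex \<Rightarrow> real)"
  "integrable circ (indicator (left_arc i) :: complex \<Rightarrow> real)"
  by (intro integrable_real_indicator; simp add: circ.emeasure_finite less_top[symmetric])+

lemma integrable_profile: "integrable circ profile"
  unfolding profile_def by (intro Bochner_Integration.integrable_sum) auto

lemma integral_profile: "(\<integral>x. profile x \<partial>circ) = 0"
  unfolding profile_def by (simp add: measure_arcs)

lemma integral_map_profile: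
  assumes "\<phi> 0 = (0::real)"
  shows "(\<integral>x. \<phi> (profile x) \<partial>circ) = (\<Sum>j<N. \<phi> (c * s j)) * (2 * w)"
proof -
  have "(\<integral>x. \<phi> (profile x) \<partial>circ) = (\<integral>x. (\<Sum>j<N. \<phi> (c * s j) * (indicator (right_arc j) x + indicator (left_arc (Suc j)) x)) \<partial>circ)"
    by (intro Bochner_Integration.integral_cong refl map_profile) (auto simp: assms)
  then show ?thesis by (simp add: measure_arcs sum_distrib_right)
qed

lemma integral_abs_profile: "(\<integral>x. \<bar>profile x\<bar> \<partial>circ) = 2 * w * c * N"
proof -
  have "\<bar>c * s j\<bar> = c" for j using s_cases[of j] c_pos by auto
  then show ?thesis by (subst integral_map_profile[of abs]) auto
qed

lemma esssup_profile: "esssup arc_length (\<lambda>x. ereal \<bar>profile x\<bar>) = ereal c"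
proof (rule antisym)
  have m: "(\<lambda>x. ereal \<bar>profile x\<bar>) \<in> borel_measurable arc_length"
    unfolding arc_length_eq_completion by (intro measurable_completion) measurable
  show "esssup arc_length (\<lambda>x. ereal \<bar>profile x\<bar>) \<le> ereal c"
    using m by (intro esssup_I AE_I2) (auto simp: abs_profile_le)
  show "ereal c \<le> esssup arc_length (\<lambda>x. ereal \<bar>profile x\<bar>)"
  proof (rule ccontr)
    assume "\<not> ?thesis"
    then have less: "esssup arc_length (\<lambda>x. ereal \<bar>profile x\<bar>) < ereal c" by simp
    have "AE x in circ. ereal \<bar>profile x\<bar> \<le> esssup arc_length (\<lambda>x. ereal \<bar>profile x\<bar>)"
      using esssup_AE[of "\<lambda>x. ereal \<bar>profile x\<bar>" arc_length]
      unfolding arc_length_eq_completion AE_completion_iff .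
    then have "AE x in circ. x \<notin> right_arc 0"
    proof eventually_elim
      case (elim x)
      show ?case
      proof
        assume "x \<in> right_arc 0"
        then have "\<bar>profile x\<bar> = c"
          using profile_right[of 0] N_pos s_cases[of 0] c_pos by (auto simp: right_arc_def)
        then show False using elim less by simp
      qed
    qed
    then have "right_arc 0 \<in> null_sets circ" by (subst AE_iff_null_sets) auto
    then show False using measure_arcs(1)[of 0] w_pos by (simp add: measure_def null_sets_def)
  qed
qed

lemma finite_nodes: "finite nodes"
  by (simp add: nodes_def)

lemma card_nodes: "card nodes = N"
proof -
  have "inj_on (\<lambda>i. cis (a i)) {..<N}"
  proof (rule inj_onI)
    fix i j assume ij: "i \<in> {..<N}" "j \<in> {..<N}" "cis (a i) = cis (a j)"
    have b: "a 0 \<le> a k \<and> a k < a 0 + 2*pi" if "k < N" for k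
      using a_mono[of 0 k] a_gap[of k N] that turn w_pos by auto
    have "a i = a j" using cis_inj_period[OF ij(3)] b[of i] b[of j] ij by auto
    then show "i = j" using a_gap[of i j] a_gap[of j i] ij w_pos
      by (cases i j rule: linorder_cases) auto
  qed
  then show ?thesis by (simp add: nodes_def image_image card_image)
qed

text \<open>
  The unions of the open sectors with positive and with negative sign.  They separate the
  circle without the nodal points into two open sets, each of which carries only one strict sign; hence a zero
  component that meets both boundaries must contain a nodal point.
\<close>

definition pos_region :: "complex set" where
  "pos_region = (\<Union>i\<in>{i. i < N \<and> s i = 1}. cis ` {a i<..<a (Suc i)})"

definition neg_region :: "complex set" where
  "neg_region = (\<Union>i\<in>{i. i < N \<and> s i = -1}. cis ` {a i<..<a (Suc i)})"

lemma sector_length: "i < N \<Longrightarrow> a (Suc i) \<le> a i + 2*pi"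
  using a_mono[of 0 i] a_mono[of "Suc i" N] turn by auto

lemma openin_regions: "openin circle_top pos_region" "openin circle_top neg_region"
  unfolding pos_region_def neg_region_def
  by (auto intro!: openin_Union openin_cis_image_interval sector_length)

lemma circle_regions: "circle = nodes \<union> pos_region \<union> neg_region"
proof (intro equalityI subsetI)
  fix x assume "x \<in> circle"
  then obtain i t where it: "i < N" "a i \<le> t" "t < a (Suc i)" "x = cis t"
    using circle_cases by blast
  show "x \<in> nodes \<union> pos_region \<union> neg_region"
    using it s_cases[of i] by (cases "t = a i") (auto simp: nodes_def pos_region_def neg_region_def)
qed (auto simp: nodes_def pos_region_def neg_region_def)

lemma sector_value:
  assumes "i < N" "t \<in> {a i<..<a (Suc i)}"
  shows "profile (cis t) * s i \<ge> 0"
  using profile_cis[of i t] assms c_pos by (auto simp: mult_ac zero_le_mult_iff s_cases)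

lemma profile_pos_region: "x \<in> pos_region \<Longrightarrow> profile x \<ge> 0"
  using sector_value by (fastforce simp: pos_region_def)

lemma profile_neg_region: "x \<in> neg_region \<Longrightarrow> profile x \<le> 0"
  using sector_value by (fastforce simp: neg_region_def)

lemma regions_disjoint: "pos_region \<inter> neg_region = {}"
proof (rule ccontr)
  assume "\<not> ?thesis"
  then obtain x where "x \<in> pos_region" "x \<in> neg_region" by blast
  then obtain i j t u where *: "i < N" "s i = 1" "t \<in> {a i<..<a (Suc i)}" "j < N" "s j = -1"
      "u \<in> {a j<..<a (Suc j)}" "x = cis t" "x = cis u"
    unfolding pos_region_def neg_region_def by blast
  then have "t = u" using a_mono[of 0 i] a_mono[of "Suc i" N] a_mono[of 0 j] a_mono[of "Suc j" N] turn
    by (intro cis_inj_period) (simp, auto)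
  moreover have "i \<noteq> j" using * by auto
  ultimately show False using a_mono[of "Suc i" j] a_mono[of "Suc j" i] *
    by (cases i j rule: linorder_cases) auto
qed

lemma boundary_pos_neg_region: "boundary_pos profile \<inter> neg_region = {}"
proof -
  have "neg_region \<inter> {x \<in> circle. profile x > 0} = {}" using profile_neg_region by force
  then have "neg_region \<inter> circle_top closure_of {x \<in> circle. profile x > 0} = {}"
    using openin_Int_closure_of_eq_empty[OF openin_regions(2)] by blast
  then show ?thesis unfolding boundary_pos_def frontier_of_def by blast
qed

lemma boundary_neg_pos_region: "boundary_neg profile \<inter> pos_region = {}"
proof -
  have "pos_region \<inter> {x \<in> circle. profile x < 0} = {}" using profile_pos_region by force
  then have "pos_region \<inter> circle_top closure_of {x \<in> circle. profile x < 0} = {}"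
    using openin_Int_closure_of_eq_empty[OF openin_regions(1)] by blast
  then show ?thesis unfolding boundary_neg_def frontier_of_def by blast
qed

lemma boundary_subset: "boundary_pos profile \<subseteq> circle" "boundary_neg profile \<subseteq> circle"
  unfolding boundary_pos_def boundary_neg_def
  using frontier_of_subset_topspace[of circle_top] by auto

lemma nodal1_profile: "nodal1 profile = nodes"
proof (intro equalityI subsetI)
  fix x assume "x \<in> nodal1 profile"
  then show "x \<in> nodes"
    using boundary_pos_neg_region boundary_neg_pos_region boundary_subset circle_regions
    unfolding nodal1_def by blast
next
  fix x assume "x \<in> nodes"
  then obtain i where i: "i < N" "x = cis (a i)" by (auto simp: nodes_def)
  have near: "\<exists>t. \<bar>t - a i\<bar> < e \<and> profile (cis t) = c * v" if "e > 0" "v \<in> {1, -1}" for e v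
  proof -
    define d where "d = min (e/2) (w/2)"
    have d: "0 < d" "d < e" "d < w" using that w_pos by (auto simp: d_def)
    show ?thesis
      using profile_right[of i "a i + d"] profile_left[of i "a i - d"] i d s_cases[of i] that(2)
      by (intro exI[of _ "if v = s i then a i + d else a i - d"]) auto
  qed
  have 1: "\<exists>t. \<bar>t - a i\<bar> < e \<and> profile (cis t) > 0" "\<exists>t. \<bar>t - a i\<bar> < e \<and> profile (cis t) < 0" if "e > 0" for e
    using near[OF that, of 1] near[OF that, of "-1"] c_pos by fastforce+
  have "x \<in> boundary_pos profile" unfolding i(2)
    using 1 by (intro boundary_posI) (meson less_imp_le)+
  moreover have "x \<in> boundary_neg profile" unfolding i(2)
    using 1 by (intro boundary_negI) (meson less_imp_le)+
  ultimately show "x \<in> nodal1 profile" by (simp add: nodal1_def)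
qed

lemma arcs_openin [simp]: "openin circle_top (right_arc i)" "openin circle_top (left_arc i)"
  unfolding right_arc_def left_arc_def using w_le pi_gt_zero
  by (intro openin_cis_image_interval; linarith)+

lemma profile_on_right_arc: "i < N \<Longrightarrow> x \<in> right_arc i \<Longrightarrow> profile x = c * s i"
  using profile_right by (auto simp: right_arc_def)

lemma profile_on_left_arc: "i < N \<Longrightarrow> x \<in> left_arc i \<Longrightarrow> profile x = - (c * s i)"
  using profile_left by (auto simp: left_arc_def)

lemma closedin_zero_set: "closedin circle_top {x \<in> circle. profile x = 0}"
proof -
  have nz: "c * s i \<noteq> 0" for i using c_pos s_cases[of i] by auto
  have "{x \<in> circle. profile x = 0} = circle - (\<Union>i<N. right_arc i \<union> left_arc i)"
  proof (intro equalityI subsetI)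
    fix x assume "x \<in> {x \<in> circle. profile x = 0}"
    then show "x \<in> circle - (\<Union>i<N. right_arc i \<union> left_arc i)"
      using profile_on_right_arc[of _ x] profile_on_left_arc[of _ x] nz by fastforce
  next
    fix x assume "x \<in> circle - (\<Union>i<N. right_arc i \<union> left_arc i)"
    then show "x \<in> {x \<in> circle. profile x = 0}"
      using profile_nonzeroE[of x] by blast
  qed
  moreover have "openin circle_top (\<Union>i<N. right_arc i \<union> left_arc i)"
    by (intro openin_Union) (auto intro: openin_Un)
  ultimately show ?thesis by (simp add: closedin_diff)
qed

lemma zero_near_node:
  assumes "i < N" "x \<in> cis ` {a i - w<..<a i + w}" "profile x = 0"
  shows "x = cis (a i)"
proof -
  obtain t where t: "x = cis t" "a i - w < t" "t < a i + w" using assms by auto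
  have "c * s i \<noteq> 0" using c_pos s_cases[of i] by auto
  then show ?thesis
    using t assms profile_right[of i t] profile_left[of i t] by (cases t "a i" rule: linorder_cases) auto
qed

text \<open>
  The zero set is closed, so the closure of a zero component is the component itself.  A component without
  nodal points stays in one of the two regions and sees one sign only; a component with a nodal point
  consists of this point, because nodal points are isolated zeros.
\<close>

lemma sign_change_component_profile:
  assumes "J \<in> sign_change_components profile"
  shows "J \<subseteq> nodes"
proof -
  let ?S = "{x \<in> circle. profile x = 0}"
  have J: "J \<in> components ?S"
    and b: "circle_top closure_of J \<inter> boundary_pos profile \<noteq> {}"
      "circle_top closure_of J \<inter> boundary_neg profile \<noteq> {}"
    using assms by (auto simp: sign_change_components_def zero_components_def)
  have JS: "J \<subseteq> ?S" "connected J" using J by (auto dest: in_components_subset in_components_connected)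
  have "closedin circle_top J"
    using closedin_component[OF J] closedin_zero_set closedin_trans by blast
  then have cl: "circle_top closure_of J = J" by (rule closure_of_closedin)
  have op: "openin (top_of_set J) (J \<inter> U)" if U: "openin circle_top U" for U
  proof -
    obtain T where T: "open T" "U = circle \<inter> T" using U unfolding openin_open by blast
    moreover have "J \<inter> U = J \<inter> T" using T(2) JS by blast
    ultimately show ?thesis unfolding openin_open by blast
  qed
  show ?thesis
  proof (cases "J \<inter> nodes = {}")
    case True
    have sub: "J \<subseteq> pos_region \<union> neg_region" using True JS circle_regions by blast
    obtain y z where yz: "y \<in> J" "y \<in> boundary_pos profile" "z \<in> J" "z \<in> boundary_neg profile"
      using b cl by blast
    define E1 E2 where "E1 = J \<inter> pos_region" and "E2 = J \<inter> neg_region"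
    have "y \<in> E1" "z \<in> E2"
      using yz sub boundary_pos_neg_region boundary_neg_pos_region by (auto simp: E1_def E2_def)
    moreover have "J \<subseteq> E1 \<union> E2" "E1 \<inter> E2 = {}"
      using sub regions_disjoint by (auto simp: E1_def E2_def)
    moreover have "openin (top_of_set J) E1" "openin (top_of_set J) E2"
      by (simp_all add: E1_def E2_def op openin_regions)
    ultimately have False using JS(2) unfolding connected_openin by blast
    then show ?thesis ..
  next
    case False
    then obtain i where i: "i < N" "cis (a i) \<in> J" by (auto simp: nodes_def)
    define E1 E2 where "E1 = J \<inter> cis ` {a i - w<..<a i + w}" and "E2 = J - {cis (a i)}"
    have E1: "E1 = {cis (a i)}"
      using zero_near_node[OF i(1)] JS i w_pos by (auto simp: E1_def)
    have "openin (top_of_set J) E1"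
      unfolding E1_def using w_le by (intro op openin_cis_image_interval) simp
    moreover have "openin (top_of_set J) E2"
      unfolding E2_def by (intro openin_diff) (use i in \<open>auto intro: closed_subset\<close>)
    moreover have "J \<subseteq> E1 \<union> E2" "E1 \<inter> E2 = {}" by (auto simp: E1 E2_def)
    moreover have "E1 \<noteq> {}" by (simp add: E1)
    ultimately have "E2 = {}" using JS(2) unfolding connected_openin by blast
    then show ?thesis using i by (auto simp: E2_def nodes_def)
  qed
qed

lemma nodal_set_profile:
  assumes "nodal_selection sel"
  shows "nodal_set sel profile = nodes"
proof -
  have "sel profile J \<in> nodes" if "J \<in> sign_change_components profile" for J
    using that assms sign_change_component_profile[OF that] by (auto simp: nodal_selection_def)
  then show ?thesis by (auto simp: nodal_set_def nodal2_def nodal1_profile)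
qed

lemma profile_in_class_X:
  assumes "nodal_selection sel"
  shows "profile \<in> class_X sel c (2 * w * c * N) N"
  using finite_nodes card_nodes esssup_profile integrable_profile integral_profile integral_abs_profile
    nodal_set_profile[OF assms] measurable_completion[of profile circ borel]
  by (simp add: class_X_def arc_length_eq_completion integrable_completion integral_completion)

lemma antisymmetric_steps_profile: "antisymmetric_steps c w nodes profile"
  unfolding antisymmetric_steps_def
proof (intro conjI ballI impI)
  fix z assume "z \<in> nodes"
  then obtain i where i: "i < N" "z = cis (a i)" by (auto simp: nodes_def)
  have val: "0 < t \<Longrightarrow> t < w \<Longrightarrow> profile (z * cis t) = c * s i"
       "t < 0 \<Longrightarrow> - w < t \<Longrightarrow> profile (z * cis t) = - (c * s i)" for t
    using i profile_right[of i "a i + t"] profile_left[of i "a i + t"] by (auto simp: cis_mult)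
  show "\<exists>v\<in>{c, - c}. \<forall>t\<in>{0<..<w}. profile (z * cis t) = v"
    using s_cases[of i] val(1) by fastforce
  show "\<forall>t. \<bar>t\<bar> < w \<longrightarrow> profile (z * cis (- t)) = - profile (z * cis t)"
  proof (intro allI impI)
    fix t :: real assume "\<bar>t\<bar> < w"
    then show "profile (z * cis (- t)) = - profile (z * cis t)"
      using val[of t] val[of "- t"] profile_node[OF i(1)] i(2)
      by (cases t "0 :: real" rule: linorder_cases) auto
  qed
next
  fix x assume x: "x \<in> circle" and far: "\<forall>z\<in>nodes. w \<le> arc_dist x z"
  show "profile x = 0"
  proof (rule ccontr)
    assume "profile x \<noteq> 0"
    then have "\<exists>i<N. \<exists>t. x = cis t \<and> \<bar>t - a i\<bar> < w"
      using x by (elim profile_nonzeroE[rotated]) (fastforce simp: right_arc_def left_arc_def)+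
    then obtain i t where "i < N" "x = cis t" "\<bar>t - a i\<bar> < w" by blast
    then have "arc_dist x (cis (a i)) < w" "cis (a i) \<in> nodes"
      using arc_dist_cis_le[of t "a i"] by (auto simp: nodes_def)
    then show False using far by fastforce
  qed
qed

lemma step_function_profile: "step_function profile"
proof -
  define F where "F = (\<lambda>i. {{cis (a i)}, cis ` {a i<..<a i + w}, cis ` {a i + w..a (Suc i) - w},
      cis ` {a (Suc i) - w<..<a (Suc i)}})"
  show ?thesis
    unfolding step_function_def
  proof (intro exI[of _ "\<Union>i<N. F i"] conjI ballI)
    show "finite (\<Union>i<N. F i)" by (auto simp: F_def)
    show "\<Union>(\<Union>i<N. F i) = circle"
    proof (intro equalityI subsetI)
      fix x assume "x \<in> circle"
      then obtain i t where it: "i < N" "a i \<le> t" "t < a (Suc i)" "x = cis t"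
        using circle_cases by blast
      then have "x \<in> \<Union>(F i)"
        by (auto simp: F_def image_iff) (metis atLeastAtMost_iff greaterThanLessThan_iff le_less not_le)
      then show "x \<in> \<Union>(\<Union>i<N. F i)" using it by blast
    qed (auto simp: F_def)
  next
    fix A assume "A \<in> (\<Union>i<N. F i)"
    then obtain i where i: "i < N" "A \<in> F i" by blast
    show "connected A" using i(2) by (auto simp: F_def intro!: connected_cis_image)
    show "profile constant_on A"
      unfolding constant_on_def using i profile_right[OF i(1)] profile_left_Suc[OF i(1)] profile_gap[OF i(1)]
      by (auto simp: F_def)
  qed
qed

lemma profile_in_class_X_step:
  assumes "nodal_selection sel"
  shows "profile \<in> class_X_step sel c (2 * w * c * N) N"
  unfolding class_X_step_def
proof (intro CollectI conjI profile_in_class_X step_function_profile assms ballI)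
  show "x \<in> circle \<Longrightarrow> profile x \<in> {c, - c, 0}" for x by (rule profile_range)
next
  fix v A assume v: "v \<in> {c, - c}" and A: "A \<in> components {x \<in> circle. profile x = v}"
  obtain x where "x \<in> A" using in_components_nonempty[OF A] by blast
  then have x: "x \<in> circle" "profile x = v" using in_components_subset[OF A] by auto
  have "\<exists>i<N. \<exists>Q. Q \<subseteq> A \<and> openin circle_top Q \<and> (Q = right_arc i \<or> Q = left_arc i)"
  proof -
    have "profile x \<noteq> 0" using x v c_pos by auto
    with x(1) consider i where "i < N" "x \<in> right_arc i" | i where "i < N" "x \<in> left_arc i"
      by (rule profile_nonzeroE)
    then show ?thesis
    proof cases
      case (1 i)
      have "right_arc i \<subseteq> {x \<in> circle. profile x = v}"
        using profile_on_right_arc 1 x(2) by (auto simp: right_arc_def)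
      moreover have "connected (right_arc i)" unfolding right_arc_def by (intro connected_cis_image) simp
      ultimately have "right_arc i \<subseteq> A" using components_maximal[OF A] 1 \<open>x \<in> A\<close> by blast
      then show ?thesis using 1 arcs_openin(1)[of i] by blast
    next
      case (2 i)
      have "left_arc i \<subseteq> {x \<in> circle. profile x = v}"
        using profile_on_left_arc 2 x(2) by (auto simp: left_arc_def)
      moreover have "connected (left_arc i)" unfolding left_arc_def by (intro connected_cis_image) simp
      ultimately have "left_arc i \<subseteq> A" using components_maximal[OF A] 2 \<open>x \<in> A\<close> by blast
      then show ?thesis using 2 arcs_openin(2)[of i] by blast
    qed
  qed
  then obtain i Q where Q: "i < N" "Q \<subseteq> A" "openin circle_top Q" "Q = right_arc i \<or> Q = left_arc i"
    by blast
  have ne: "Q \<noteq> {}" using Q(4) w_pos by (auto simp: right_arc_def left_arc_def)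
  have "Q \<subseteq> circle_top interior_of A" using Q by (intro interior_of_maximal)
  then show "circle_top interior_of A \<noteq> {}" using ne by blast
  have "cis (a i) \<in> circle_top closure_of Q"
  proof (rule cis_in_closure_of)
    fix e :: real assume "e > 0"
    define d where "d = min (e/2) (w/2)"
    have d: "0 < d" "d < e" "d < w" using \<open>e > 0\<close> w_pos by (auto simp: d_def)
    then have "cis (a i + d) \<in> right_arc i" "cis (a i - d) \<in> left_arc i"
      by (auto simp: right_arc_def left_arc_def)
    moreover have "\<bar>a i + d - a i\<bar> < e" "\<bar>a i - d - a i\<bar> < e" using d by auto
    ultimately show "\<exists>t. \<bar>t - a i\<bar> < e \<and> cis t \<in> Q" using Q(4) by metis
  qed
  then have "cis (a i) \<in> circle_top closure_of A" using closure_of_mono[OF Q(2)] by blast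
  moreover have "cis (a i) \<in> nodal_set sel profile"
    using Q(1) by (auto simp: nodal_set_profile[OF assms] nodes_def)
  ultimately show "circle_top closure_of A \<inter> nodal_set sel profile \<noteq> {}" by blast
qed

end

section \<open>Transporting a profile across its nodal points\<close>

lemma measurable_arc_dist [measurable]:
  assumes [measurable]: "f \<in> M \<rightarrow>\<^sub>M circle_borel" "g \<in> M \<rightarrow>\<^sub>M circle_borel"
  shows "(\<lambda>z. arc_dist (f z) (g z)) \<in> borel_measurable M"
proof -
  let ?d = "\<lambda>z. \<bar>angle 0 (f z) - angle 0 (g z)\<bar>"
  have "min (?d z) (2*pi - ?d z) = arc_dist (f z) (g z)" if "z \<in> space M" for z
  proof -
    have "f z \<in> circle" "g z \<in> circle"
      using measurable_space[OF assms(1) that] measurable_space[OF assms(2) that]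
      by (auto simp: space_restrict_space)
    then show ?thesis
      using arc_dist_cis_eq[of "angle 0 (f z)" 0 "angle 0 (g z)"] angle_bounds[of 0] cis_angle by simp
  qed
  moreover have "(\<lambda>z. min (?d z) (2*pi - ?d z)) \<in> borel_measurable M"
    by measurable
  ultimately show ?thesis by (simp cong: measurable_cong)
qed

lemma emeasure_density_arc_length:
  assumes "g \<in> borel_measurable arc_length" "A \<in> sets circle_borel"
  shows "emeasure (density arc_length (\<lambda>x. ennreal (g x))) A = (\<integral>\<^sup>+x. ennreal (g x) * indicator A x \<partial>circ)"
proof -
  have "A \<in> sets arc_length" using assms(2) unfolding arc_length_eq_completion by (auto intro: sets_completionI_sets)
  then show ?thesis using assms(1) by (simp add: emeasure_density arc_length_eq_completion nn_integral_completion)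
qed

lemma couplings_props:
  assumes "\<gamma> \<in> couplings \<mu> \<nu>"
  shows "sets \<gamma> = sets (circle_borel \<Otimes>\<^sub>M circle_borel)" "space \<gamma> = circle \<times> circle"
    "emeasure \<gamma> (space \<gamma>) = emeasure \<mu> circle"
proof -
  show 1: "sets \<gamma> = sets (circle_borel \<Otimes>\<^sub>M circle_borel)" using assms by (simp add: couplings_def)
  show 2: "space \<gamma> = circle \<times> circle"
    using sets_eq_imp_space_eq[OF 1] by (simp add: space_pair_measure space_restrict_space)
  have "circle \<in> sets circle_borel" using sets.top[of circle_borel] by (simp add: space_restrict_space)
  then show "emeasure \<gamma> (space \<gamma>) = emeasure \<mu> circle" using assms 2 by (auto simp: couplings_def)
qed

lemma wasserstein_le:
  assumes "\<gamma> \<in> couplings \<mu> \<nu>"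
  shows "wasserstein p \<mu> \<nu> \<le> (\<integral>z. arc_dist (fst z) (snd z) powr p \<partial>\<gamma>) powr (1 / p)"
  unfolding wasserstein_def by (intro cINF_lower bdd_belowI[of _ 0]) (use assms in auto)

context alternating_arcs
begin

lemma pos_part_profile:
  assumes "x \<in> circle"
  shows "pos_part profile x = (\<Sum>j<N. c * ((if s j = 1 then indicator (right_arc j) x else indicator (left_arc j) x)))"
    and "\<bar>neg_part profile x\<bar> = (\<Sum>j<N. c * ((if s j = 1 then indicator (left_arc j) x else indicator (right_arc j) x)))"
proof -
  have gen: "\<phi> (profile x) = (\<Sum>j<N. \<phi> (c * s j) * indicator (right_arc j) x + \<phi> (- (c * s j)) * indicator (left_arc j) x)"
    if "\<phi> 0 = (0::real)" for \<phi>
    using map_profile[of x \<phi>, OF assms that]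
      sum_left_arc_shift[of "\<lambda>j. \<phi> (- (c * s j))" x] s_turn
    by (simp add: distrib_left sum.distrib alternate)
  have "max (c * s j) 0 * indicator (right_arc j) x + max (- (c * s j)) 0 * indicator (left_arc j) x
      = c * (if s j = 1 then indicator (right_arc j) x else indicator (left_arc j) x)" for j
    using s_cases[of j] c_pos by auto
  then show "pos_part profile x = (\<Sum>j<N. c * ((if s j = 1 then indicator (right_arc j) x else indicator (left_arc j) x)))"
    using gen[of "\<lambda>y. max y 0"] by (simp add: pos_part_def)
  have "\<bar>- max (- (c * s j)) 0\<bar> * indicator (right_arc j) x + \<bar>- max (- (- (c * s j))) 0\<bar> * indicator (left_arc j) x
      = c * (if s j = 1 then indicator (left_arc j) x else indicator (right_arc j) x)" for j
    using s_cases[of j] c_pos by auto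
  then show "\<bar>neg_part profile x\<bar> = (\<Sum>j<N. c * ((if s j = 1 then indicator (left_arc j) x else indicator (right_arc j) x)))"
    using gen[of "\<lambda>y. \<bar>- max (- y) 0\<bar>"] by (simp only: neg_part_def)
qed

lemma right_left_arc_disjoint: "i < N \<Longrightarrow> j < N \<Longrightarrow> right_arc i \<inter> left_arc j = {}"
proof (rule ccontr)
  assume ij: "i < N" "j < N" and "\<not> ?thesis"
  then obtain x where x: "x \<in> right_arc i" "x \<in> left_arc j" by blast
  then have "x \<in> circle" by (auto simp: right_arc_def)
  then obtain k t where k: "k < N" "a k \<le> t" "t < a (Suc k)" "x = cis t" using circle_cases by blast
  have "(\<Sum>m<N. 1 * (indicator (right_arc m) x + indicator (left_arc (Suc m)) x)) \<le> (1::real)"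
    unfolding k(4) by (subst sum_arcs_cis[OF k(1-3)]) auto
  then have "(\<Sum>m<N. indicator (right_arc m) x) + (\<Sum>m<N. indicator (left_arc m) x) \<le> (1::real)"
    using sum_left_arc_shift[of "\<lambda>_. 1" x] by (simp add: sum.distrib)
  moreover have "(1::real) \<le> (\<Sum>m<N. indicator (right_arc m) x)"
    using member_le_sum[of i "{..<N}" "\<lambda>m. indicator (right_arc m) x :: real"] ij x by simp
  moreover have "(1::real) \<le> (\<Sum>m<N. indicator (left_arc m) x)"
    using member_le_sum[of j "{..<N}" "\<lambda>m. indicator (left_arc m) x :: real"] ij x by simp
  ultimately show False by linarith
qed

text \<open>
  The transport map: the positive mass next to a nodal point is rotated by the width of the arc onto
  the negative mass on the other side.  Only its values on the positive arcs matter, where the side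
  decides on the direction.
\<close>

definition swap :: "complex \<Rightarrow> complex" where
  "swap x = (if x \<in> (\<Union>i<N. right_arc i) then x * cis (- w) else x * cis w)"

lemma swap_measurable [measurable]: "swap \<in> circle_borel \<rightarrow>\<^sub>M circle_borel"
  unfolding swap_def by measurable

lemma rotate_arcs:
  "x * cis (- w) \<in> left_arc i \<longleftrightarrow> x \<in> right_arc i"
  "x * cis w \<in> right_arc i \<longleftrightarrow> x \<in> left_arc i"
proof -
  have inv: "x * cis w * cis (- w) = x" "x * cis (- w) * cis w = x" by (simp_all add: mult.assoc cis_mult)
  have "y * cis (- w) \<in> left_arc i" if "y \<in> right_arc i" for y
    using that by (auto simp: left_arc_def right_arc_def cis_mult)
  moreover have r: "y * cis w \<in> right_arc i" if "y \<in> left_arc i" for y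
    using that by (auto simp: left_arc_def right_arc_def cis_mult)
  ultimately show "x * cis (- w) \<in> left_arc i \<longleftrightarrow> x \<in> right_arc i"
    "x * cis w \<in> right_arc i \<longleftrightarrow> x \<in> left_arc i" using inv by metis+
qed

lemma arc_dist_swap: "x \<in> circle \<Longrightarrow> arc_dist x (swap x) \<le> w"
proof -
  assume "x \<in> circle"
  then obtain t where "x = cis t" using circle_eq_cis_image[of 0] by auto
  then show ?thesis
    using arc_dist_cis_le[of t "t - w"] arc_dist_cis_le[of t "t + w"] w_pos
    by (auto simp: swap_def cis_mult)
qed

lemma swap_pushforward:
  assumes [measurable]: "A \<in> sets circle_borel"
  shows "(\<integral>\<^sup>+x. ennreal (pos_part profile x) * indicator A (swap x) \<partial>circ)
    = (\<integral>\<^sup>+x. ennreal \<bar>neg_part profile x\<bar> * indicator A x \<partial>circ)"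
proof -
  define P where "P j = (if s j = 1 then right_arc j else left_arc j)" for j
  define Q where "Q j = (if s j = 1 then left_arc j else right_arc j)" for j
  define \<theta> where "\<theta> j = (if s j = 1 then - w else w)" for j
  have [measurable]: "P j \<in> sets circle_borel" "Q j \<in> sets circle_borel" for j
    by (auto simp: P_def Q_def)
  have sum: "ennreal (\<Sum>j<N. c * r j) = (\<Sum>j<N. ennreal c * ennreal (r j))" if "\<And>j. 0 \<le> r j" for r
    using c_pos that by (simp add: sum_ennreal[symmetric] ennreal_mult del: sum_ennreal)
  have P: "ennreal (if s j = 1 then indicator (right_arc j) x else indicator (left_arc j) x) = indicator (P j) x"
    and Q: "ennreal (if s j = 1 then indicator (left_arc j) x else indicator (right_arc j) x) = indicator (Q j) x"
    for j x by (simp_all add: P_def Q_def indicator_def)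
  have pos: "ennreal (pos_part profile x) = (\<Sum>j<N. ennreal c * indicator (P j) x)" if "x \<in> circle" for x
    unfolding pos_part_profile(1)[OF that]
    by (subst sum) (simp_all add: P)
  have neg: "ennreal \<bar>neg_part profile x\<bar> = (\<Sum>j<N. ennreal c * indicator (Q j) x)" if "x \<in> circle" for x
    unfolding pos_part_profile(2)[OF that]
    by (subst sum) (simp_all add: Q)
  have swap: "indicator (P j) x * indicator A (swap x) = (indicator (Q j) (x * cis (\<theta> j)) * indicator A (x * cis (\<theta> j)) :: ennreal)"
    if "j < N" for x j
  proof (cases "x \<in> P j")
    case True
    moreover have "x * cis (\<theta> j) \<in> Q j"
      using True by (auto simp: P_def Q_def \<theta>_def rotate_arcs)
    moreover have "swap x = x * cis (\<theta> j)"
      using True that right_left_arc_disjoint by (auto simp: P_def \<theta>_def swap_def split: if_splits)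
    ultimately show ?thesis by simp
  next
    case False
    moreover have "x * cis (\<theta> j) \<notin> Q j"
      using False by (auto simp: P_def Q_def \<theta>_def rotate_arcs split: if_splits)
    ultimately show ?thesis by simp
  qed
  have "(\<integral>\<^sup>+x. ennreal (pos_part profile x) * indicator A (swap x) \<partial>circ)
      = (\<integral>\<^sup>+x. (\<Sum>j<N. ennreal c * (indicator (P j) x * indicator A (swap x))) \<partial>circ)"
    by (intro nn_integral_cong) (simp only: space_circ pos sum_distrib_right mult.assoc)
  also have "\<dots> = (\<Sum>j<N. ennreal c * (\<integral>\<^sup>+x. indicator (P j) x * indicator A (swap x) \<partial>circ))"
    by (subst nn_integral_sum) (auto simp: nn_integral_cmult)
  also have "\<dots> = (\<Sum>j<N. ennreal c * (\<integral>\<^sup>+x. indicator (Q j) x * indicator A x \<partial>circ))"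
  proof (intro sum.cong refl arg_cong[where f = "(*) (ennreal c)"])
    fix j assume "j \<in> {..<N}"
    then show "(\<integral>\<^sup>+x. indicator (P j) x * indicator A (swap x) \<partial>circ) = (\<integral>\<^sup>+x. indicator (Q j) x * indicator A x \<partial>circ)"
      using nn_integral_circ_rotate[of "\<lambda>x. indicator (Q j) x * indicator A x" "\<theta> j"] by (simp add: swap)
  qed
  also have "\<dots> = (\<integral>\<^sup>+x. (\<Sum>j<N. ennreal c * (indicator (Q j) x * indicator A x)) \<partial>circ)"
    by (subst nn_integral_sum) (auto simp: nn_integral_cmult)
  also have "\<dots> = (\<integral>\<^sup>+x. ennreal \<bar>neg_part profile x\<bar> * indicator A x \<partial>circ)"
    by (intro nn_integral_cong) (simp only: space_circ neg sum_distrib_right mult.assoc)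
  finally show ?thesis .
qed

lemma parts_measurable [measurable]:
  "pos_part profile \<in> borel_measurable circle_borel" "neg_part profile \<in> borel_measurable circle_borel"
  unfolding pos_part_def neg_part_def by measurable

lemma integral_pos_part_profile: "(\<integral>x. pos_part profile x \<partial>circ) = c * w * N"
proof -
  have "(\<integral>x. pos_part profile x \<partial>circ) = (\<integral>x. (\<bar>profile x\<bar> + profile x) / 2 \<partial>circ)"
    by (intro Bochner_Integration.integral_cong) (auto simp: pos_part_def)
  also have "\<dots> = c * w * N"
    using integrable_profile by (simp add: integral_abs_profile integral_profile)
  finally show ?thesis .
qed

text \<open>
  The plan that moves all positive mass by the same distance \<open>w\<close>.
\<close>

lemma W_profile_le:
  assumes "p \<ge> 1"
  shows "W p profile \<le> w * (c * w * N) powr (1 / p)"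
proof -
  define \<gamma> where "\<gamma> = distr (density circ (\<lambda>x. ennreal (pos_part profile x))) (circle_borel \<Otimes>\<^sub>M circle_borel) (\<lambda>x. (x, swap x))"
  have m: "(\<lambda>x. (x, swap x)) \<in> density circ (\<lambda>x. ennreal (pos_part profile x)) \<rightarrow>\<^sub>M circle_borel \<Otimes>\<^sub>M circle_borel"
    by measurable
  have circle_sets: "circle \<in> sets circle_borel" using sets.top[of circle_borel] by (simp add: space_restrict_space)
  have meas: "pos_part profile \<in> borel_measurable arc_length" "(\<lambda>x. \<bar>neg_part profile x\<bar>) \<in> borel_measurable arc_length"
    unfolding arc_length_eq_completion by (intro measurable_completion; measurable)+
  have coupling: "\<gamma> \<in> couplings (density arc_length (\<lambda>x. ennreal (pos_part profile x)))
                         (density arc_length (\<lambda>x. ennreal \<bar>neg_part profile x\<bar>))"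
    unfolding couplings_def
  proof (intro CollectI conjI ballI)
    show "sets \<gamma> = sets (circle_borel \<Otimes>\<^sub>M circle_borel)" by (simp add: \<gamma>_def)
    fix A assume A [measurable]: "A \<in> sets circle_borel"
    have Asub: "A \<subseteq> circle" using sets.sets_into_space[OF A] by (simp add: space_restrict_space)
    show "emeasure \<gamma> (A \<times> circle) = emeasure (density arc_length (\<lambda>x. ennreal (pos_part profile x))) A"
    proof -
      have "(\<lambda>x. (x, swap x)) -` (A \<times> circle) \<inter> circle = A"
        using Asub measurable_space[OF swap_measurable] by (auto simp: space_restrict_space)
      then show ?thesis
        unfolding \<gamma>_def emeasure_density_arc_length[OF meas(1) A]
        using circle_sets by (subst emeasure_distr[OF m]) (auto simp: emeasure_density)
    qed
    show "emeasure \<gamma> (circle \<times> A) = emeasure (density arc_length (\<lambda>x. ennreal \<bar>neg_part profile x\<bar>)) A"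
    proof -
      have "(\<lambda>x. (x, swap x)) -` (circle \<times> A) \<inter> circle = swap -` A \<inter> circle" by auto
      moreover have "swap -` A \<inter> circle \<in> sets circle_borel"
        using measurable_sets[OF swap_measurable A] by (simp add: space_restrict_space)
      ultimately have "emeasure \<gamma> (circle \<times> A) = (\<integral>\<^sup>+x. ennreal (pos_part profile x) * indicator (swap -` A \<inter> circle) x \<partial>circ)"
        unfolding \<gamma>_def using circle_sets by (subst emeasure_distr[OF m]) (auto simp: emeasure_density)
      also have "\<dots> = (\<integral>\<^sup>+x. ennreal (pos_part profile x) * indicator A (swap x) \<partial>circ)"
        by (intro nn_integral_cong) (auto simp: indicator_def)
      also have "\<dots> = emeasure (density arc_length (\<lambda>x. ennreal \<bar>neg_part profile x\<bar>)) A"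
        unfolding emeasure_density_arc_length[OF meas(2) A] by (rule swap_pushforward[OF A])
      finally show ?thesis .
    qed
  qed
  have intp: "integrable circ (pos_part profile)"
    unfolding pos_part_def using integrable_profile by simp
  have "(\<integral>z. arc_dist (fst z) (snd z) powr p \<partial>\<gamma>)
      = (\<integral>x. arc_dist x (swap x) powr p \<partial>density circ (\<lambda>x. ennreal (pos_part profile x)))"
    unfolding \<gamma>_def by (subst integral_distr[OF m]) simp_all
  also have "\<dots> = (\<integral>x. pos_part profile x * arc_dist x (swap x) powr p \<partial>circ)"
  proof (subst integral_density)
    show "(\<lambda>x. arc_dist x (swap x) powr p) \<in> borel_measurable circ"
      by measurable
  qed (auto simp: pos_part_def)
  also have "\<dots> \<le> (\<integral>x. pos_part profile x * w powr p \<partial>circ)"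
  proof (rule integral_mono')
    show "integrable circ (\<lambda>x. pos_part profile x * w powr p)" using intp by simp
    fix x assume "x \<in> space circ"
    then show "pos_part profile x * arc_dist x (swap x) powr p \<le> pos_part profile x * w powr p"
      using assms arc_dist_swap[of x] arc_dist_bounds[of x "swap x"]
      by (intro mult_left_mono powr_mono2) (auto simp: pos_part_def)
  qed (auto simp: pos_part_def)
  also have "\<dots> = (c * w * N) * w powr p" by (simp add: integral_pos_part_profile)
  finally have le: "(\<integral>z. arc_dist (fst z) (snd z) powr p \<partial>\<gamma>) \<le> (c * w * N) * w powr p" .
  have "W p profile \<le> (\<integral>z. arc_dist (fst z) (snd z) powr p \<partial>\<gamma>) powr (1 / p)"
    unfolding W_def by (rule wasserstein_le[OF coupling])
  also have "\<dots> \<le> ((c * w * N) * w powr p) powr (1 / p)"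
    using le assms by (intro powr_mono2) (auto intro!: Bochner_Integration.integral_nonneg)
  also have "\<dots> = w * (c * w * N) powr (1 / p)"
    using assms w_pos c_pos by (simp add: powr_mult powr_powr)
  finally show ?thesis .
qed

end

section \<open>Transport costs at least the flux\<close>

lemma set_integrable_bounded_borel:
  fixes g :: "real \<Rightarrow> real"
  assumes [measurable]: "g \<in> borel_measurable borel" and bd: "\<And>t. \<bar>g t\<bar> \<le> C"
  shows "set_integrable lborel {x..y} g"
  unfolding set_integrable_def
proof (rule Bochner_Integration.integrable_bound)
  show "integrable lborel (\<lambda>t. C * indicator {x..y} t :: real)"
    by (intro integrable_mult_right integrable_real_indicator) (auto simp: emeasure_lborel_Icc_eq)
  have "0 \<le> C" using bd[of 0] by linarith
  then show "AE t in lborel. norm (indicator {x..y} t *\<^sub>R g t) \<le> norm (C * indicator {x..y} t)"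
    using bd by (auto simp: indicator_def)
qed simp

lemma bounded_borel_integrable_on:
  fixes g :: "real \<Rightarrow> real"
  assumes "g \<in> borel_measurable borel" "\<And>t. \<bar>g t\<bar> \<le> C"
  shows "g integrable_on {x..y}" "(LINT t:{x..y}|lborel. g t) = integral {x..y} g"
  using set_borel_integral_eq_integral[OF set_integrable_bounded_borel[OF assms]] by auto

lemma integral_circ_interval:
  fixes \<phi> :: "complex \<Rightarrow> real"
  assumes [measurable]: "\<phi> \<in> borel_measurable circle_borel" and bd: "\<And>x. \<bar>\<phi> x\<bar> \<le> C"
  shows "(\<integral>x. \<phi> x \<partial>circ) = integral {b..b+2*pi} (\<lambda>t. \<phi> (cis t))"
proof -
  have m [measurable]: "(\<lambda>t. \<phi> (cis t)) \<in> borel_measurable borel" by measurable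
  have "(\<integral>x. \<phi> x \<partial>circ) = (LINT t:{b..<b+2*pi}|lborel. \<phi> (cis t))" using integral_circ[of \<phi> b] by simp
  also have "\<dots> = (LINT t:{b..b+2*pi}|lborel. \<phi> (cis t))"
    unfolding set_lebesgue_integral_def
  proof (rule integral_cong_AE)
    show "AE t in lborel. indicator {b..<b+2*pi} t *\<^sub>R \<phi> (cis t) = indicator {b..b+2*pi} t *\<^sub>R \<phi> (cis t)"
      using AE_lborel_singleton[of "b+2*pi"] by eventually_elim (auto simp: indicator_def)
  qed auto
  also have "\<dots> = integral {b..b+2*pi} (\<lambda>t. \<phi> (cis t))"
    using bounded_borel_integrable_on(2)[OF m] bd by blast
  finally show ?thesis .
qed

lemma integral_circ_angle_le:
  fixes h :: "complex \<Rightarrow> real"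
  assumes [measurable]: "h \<in> borel_measurable circle_borel" and bd: "\<And>x. \<bar>h x\<bar> \<le> C"
    and u: "u \<in> {b..b+2*pi}"
  shows "(\<integral>x. h x * indicator {x \<in> circle. angle b x \<le> u} x \<partial>circ) = integral {b..u} (\<lambda>t. h (cis t))"
proof -
  let ?A = "{x \<in> circle. angle b x \<le> u}"
  have A [measurable]: "?A \<in> sets circle_borel"
    using measurable_sets[OF measurable_angle[of b], of "{..u}"]
    by (simp add: space_restrict_space vimage_def Int_def conj_commute)
  have m [measurable]: "(\<lambda>t. h (cis t)) \<in> borel_measurable borel" by measurable
  have m2: "(\<lambda>x. h x * indicator ?A x) \<in> borel_measurable circle_borel" by measurable
  have "(\<integral>x. h x * indicator ?A x \<partial>circ) = (LINT t:{b..<b+2*pi}|lborel. h (cis t) * indicator ?A (cis t))"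
    by (rule integral_circ[OF m2])
  also have "\<dots> = (LINT t:{b..u}|lborel. h (cis t))"
    unfolding set_lebesgue_integral_def
  proof (rule integral_cong_AE)
    show "AE t in lborel. indicator {b..<b+2*pi} t *\<^sub>R (h (cis t) * indicator ?A (cis t)) = indicator {b..u} t *\<^sub>R h (cis t)"
      using AE_lborel_singleton[of "b+2*pi"]
      by eventually_elim (use u in \<open>auto simp: indicator_def angle_cis\<close>)
    show "(\<lambda>t. indicator {b..<b+2*pi} t *\<^sub>R (h (cis t) * indicator ?A (cis t))) \<in> borel_measurable lborel"
      by measurable
  qed simp
  also have "\<dots> = integral {b..u} (\<lambda>t. h (cis t))"
    using bounded_borel_integrable_on(2)[OF m] bd by blast
  finally show ?thesis .
qed

lemma integrable_circ_bounded:
  fixes \<phi> :: "complex \<Rightarrow> real"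
  assumes "\<phi> \<in> borel_measurable circle_borel" "\<And>x. \<bar>\<phi> x\<bar> \<le> C"
  shows "integrable circ \<phi>"
  using assms by (intro circ.integrable_const_bound[where B = C]) auto

text \<open>
  Cut the circle at \<open>b\<close> and count, for a pair \<open>(x, y)\<close> and an angle \<open>u\<close>, how often the shortest arc from
  \<open>x\<close> to \<open>y\<close> crosses \<open>u\<close>, with orientation.  This count is \<open>1\<close> or \<open>-1\<close> or \<open>0\<close>, it
  is the difference of the indicators of \<open>X \<le> u\<close> and \<open>Y \<le> u\<close> up to a correction \<open>m\<close> for
  arcs that run through the cut, and the length of the arc is the integral of its absolute value over \<open>u\<close>.  Exchanging the
  order of integration bounds the cost of a plan below by the integral over \<open>u\<close> of the absolute value
  of the net flow through \<open>u\<close>.  The marginals determine this flow up to a constant \<open>k\<close>, where \<open>- k\<close> is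
  the net flow through the cut.
\<close>

lemma transport_cost_ge:
  fixes h :: "complex \<Rightarrow> real" and b c :: real
  assumes h [measurable]: "h \<in> borel_measurable circle_borel" and hb: "\<And>x. \<bar>h x\<bar> \<le> c"
    and coup: "\<gamma> \<in> couplings \<mu> \<nu>"
    and mu: "\<And>A. A \<in> sets circle_borel \<Longrightarrow> emeasure \<mu> A = (\<integral>\<^sup>+x. ennreal (max (h x) 0) * indicator A x \<partial>circ)"
    and nu: "\<And>A. A \<in> sets circle_borel \<Longrightarrow> emeasure \<nu> A = (\<integral>\<^sup>+x. ennreal (max (- h x) 0) * indicator A x \<partial>circ)"
  shows "\<exists>k. \<bar>k\<bar> \<le> measure \<gamma> (space \<gamma>) \<and>
    integral {b..b+2*pi} (\<lambda>u. \<bar>integral {b..u} (\<lambda>t. h (cis t)) - k\<bar>) \<le> (\<integral>z. arc_dist (fst z) (snd z) \<partial>\<gamma>)"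
    and "finite_measure \<gamma>"
proof -
  note sets_\<gamma> [measurable_cong] = couplings_props(1)[OF coup]
  note space_\<gamma> = couplings_props(2)[OF coup]
  have circle_sets: "circle \<in> sets circle_borel" using sets.top[of circle_borel] by (simp add: space_restrict_space)
  have nn: "(\<integral>\<^sup>+x. ennreal (max (g x) 0) * indicator A x \<partial>circ) = ennreal (\<integral>x. max (g x) 0 * indicator A x \<partial>circ)"
    if [measurable]: "A \<in> sets circle_borel" "g \<in> borel_measurable circle_borel" and "\<And>x. \<bar>g x\<bar> \<le> c"
    for A and g :: "complex \<Rightarrow> real"
  proof -
    have "(\<integral>\<^sup>+x. ennreal (max (g x) 0) * indicator A x \<partial>circ) = (\<integral>\<^sup>+x. ennreal (max (g x) 0 * indicator A x) \<partial>circ)"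
      by (intro nn_integral_cong) (auto simp: indicator_def)
    also have "\<dots> = ennreal (\<integral>x. max (g x) 0 * indicator A x \<partial>circ)"
    proof (intro nn_integral_eq_integral integrable_circ_bounded[where C = c])
      fix x show "\<bar>max (g x) 0 * indicator A x\<bar> \<le> c" using that(3)[of x] by (auto simp: indicator_def)
    qed auto
    finally show ?thesis .
  qed
  have marg1: "measure \<gamma> (A \<times> circle) = (\<integral>x. max (h x) 0 * indicator A x \<partial>circ)"
    and marg2: "measure \<gamma> (circle \<times> A) = (\<integral>x. max (- h x) 0 * indicator A x \<partial>circ)"
    if A: "A \<in> sets circle_borel" for A
  proof -
    have "emeasure \<gamma> (A \<times> circle) = ennreal (\<integral>x. max (h x) 0 * indicator A x \<partial>circ)"
      using coup A mu[OF A] nn[OF A h hb] by (simp add: couplings_def)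
    then show "measure \<gamma> (A \<times> circle) = (\<integral>x. max (h x) 0 * indicator A x \<partial>circ)"
      by (simp add: measure_def integral_nonneg_AE)
    have "emeasure \<gamma> (circle \<times> A) = ennreal (\<integral>x. max (- h x) 0 * indicator A x \<partial>circ)"
      using coup A nu[OF A] nn[OF A, of "\<lambda>x. - h x"] hb by (simp add: couplings_def)
    then show "measure \<gamma> (circle \<times> A) = (\<integral>x. max (- h x) 0 * indicator A x \<partial>circ)"
      by (simp add: measure_def integral_nonneg_AE)
  qed
  show fin: "finite_measure \<gamma>"
    using couplings_props(3)[OF coup] mu[OF circle_sets] nn[OF circle_sets h hb] by (intro finite_measureI) simp
  interpret G: finite_measure \<gamma> by (rule fin)
  define X where "X z = angle b (fst z)" for z :: "complex \<times> complex"
  define Y where "Y z = angle b (snd z)" for z :: "complex \<times> complex"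
  \<comment> \<open>Between angles that differ by more than half a turn the shortest arc runs through the cut, so the
      crossings are the complementary ones with the opposite orientation.\<close>
  define m :: "complex \<times> complex \<Rightarrow> real" where "m z = (if Y z - X z > pi then 1 else if X z - Y z > pi then -1 else 0)" for z
  define K :: "complex \<times> complex \<Rightarrow> real \<Rightarrow> real" where "K z u = indicator {..u} (X z) - indicator {..u} (Y z) - m z" for z u
  have XY [measurable]: "X \<in> borel_measurable \<gamma>" "Y \<in> borel_measurable \<gamma>"
    unfolding X_def Y_def by measurable
  have m_meas [measurable]: "m \<in> borel_measurable \<gamma>" unfolding m_def by measurable
  have XYb: "b \<le> X z" "X z < b + 2*pi" "b \<le> Y z" "Y z < b + 2*pi" for z
    using angle_bounds by (auto simp: X_def Y_def)
  have m_abs: "\<bar>m z\<bar> \<le> 1" for z by (simp add: m_def)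
  have Kb: "\<bar>K z u\<bar> \<le> 3" for z u using m_abs[of z] by (auto simp: K_def indicator_def)
  define L where "L = restrict_space lborel {b..b+2*pi}"
  have spL: "space L = {b..b+2*pi}" by (simp add: L_def space_restrict_space)
  interpret L: finite_measure L
    by (rule finite_measureI) (simp add: L_def emeasure_restrict_space space_restrict_space)
  interpret P: pair_sigma_finite \<gamma> L ..
  interpret PF: finite_measure "\<gamma> \<Otimes>\<^sub>M L"
    by (rule finite_measure_pair_measure) unfold_locales
  have K_meas: "(\<lambda>(z, u). K z u) \<in> borel_measurable (\<gamma> \<Otimes>\<^sub>M L)"
  proof -
    have [measurable]: "(\<lambda>u. u) \<in> borel_measurable L" unfolding L_def by (intro measurable_restrict_space1) simp
    have "(\<lambda>(z, u). (if X z \<le> u then 1 else 0) - (if Y z \<le> u then 1 else 0) - m z) \<in> borel_measurable (\<gamma> \<Otimes>\<^sub>M L)"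
      by measurable
    then show ?thesis by (simp add: K_def indicator_def)
  qed
  then have absK_meas: "(\<lambda>(z, u). \<bar>K z u\<bar>) \<in> borel_measurable (\<gamma> \<Otimes>\<^sub>M L)"
    by (simp add: case_prod_unfold)
  have absK_int: "integrable (\<gamma> \<Otimes>\<^sub>M L) (\<lambda>(z, u). \<bar>K z u\<bar>)"
    using absK_meas Kb by (intro PF.integrable_const_bound[where B = 3]) auto
  have dist_eq: "(\<integral>u. \<bar>K z u\<bar> \<partial>L) = arc_dist (fst z) (snd z)" if z: "z \<in> space \<gamma>" for z
  proof -
    define S where "S = {min (X z) (Y z)..<max (X z) (Y z)}"
    have sub: "S \<subseteq> {b..b+2*pi}" using XYb[of z] by (auto simp: S_def)
    have "\<bar>K z u\<bar> = \<bar>m z\<bar> + (1 - 2 * \<bar>m z\<bar>) * indicator S u" for u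
      by (auto simp: K_def m_def S_def indicator_def min_def max_def) (use pi_gt_zero in linarith)+
    then have e: "indicator {b..b+2*pi} u *\<^sub>R \<bar>K z u\<bar> = \<bar>m z\<bar> * indicator {b..b+2*pi} u + (1 - 2 * \<bar>m z\<bar>) * indicator S u" for u
      using sub by (auto simp: indicator_def)
    have "(\<integral>u. \<bar>K z u\<bar> \<partial>L) = (\<integral>u. indicator {b..b+2*pi} u *\<^sub>R \<bar>K z u\<bar> \<partial>lborel)"
      unfolding L_def by (rule integral_restrict_space) simp
    also have "\<dots> = \<bar>m z\<bar> * (2*pi) + (1 - 2 * \<bar>m z\<bar>) * \<bar>X z - Y z\<bar>"
      unfolding e by (subst Bochner_Integration.integral_add)
        (auto simp: S_def integrable_indicator_iff)
    also have "\<dots> = min \<bar>X z - Y z\<bar> (2*pi - \<bar>X z - Y z\<bar>)"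
      using XYb[of z] by (auto simp: m_def)
    also have "\<dots> = arc_dist (cis (X z)) (cis (Y z))"
      using XYb[of z] by (intro arc_dist_cis_eq[symmetric]) auto
    also have "\<dots> = arc_dist (fst z) (snd z)"
      using z by (auto simp: X_def Y_def cis_angle space_\<gamma>)
    finally show ?thesis .
  qed
  define k where "k = (\<integral>z. m z \<partial>\<gamma>)"
  have m_int: "integrable \<gamma> m" using m_abs by (intro G.integrable_const_bound[where B = 1]) auto
  have ind_int: "integrable \<gamma> (\<lambda>z. indicator {..u} (X z) :: real)" "integrable \<gamma> (\<lambda>z. indicator {..u} (Y z) :: real)" for u
    by (intro G.integrable_const_bound[where B = 1]; simp)+
  have flux: "(\<integral>z. K z u \<partial>\<gamma>) = integral {b..u} (\<lambda>t. h (cis t)) - k" if u: "u \<in> {b..b+2*pi}" for u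
  proof -
    let ?A = "{x \<in> circle. angle b x \<le> u}"
    have A [measurable]: "?A \<in> sets circle_borel"
      using measurable_sets[OF measurable_angle[of b], of "{..u}"]
      by (simp add: space_restrict_space vimage_def Int_def conj_commute)
    have "(\<integral>z. indicator {..u} (X z) \<partial>\<gamma>) = (\<integral>z. indicator (?A \<times> circle) z \<partial>\<gamma>)"
      by (intro Bochner_Integration.integral_cong) (auto simp: X_def indicator_def space_\<gamma>)
    also have "(?A \<times> circle) \<inter> space \<gamma> = ?A \<times> circle" by (auto simp: space_\<gamma>)
    then have "(\<integral>z. indicator (?A \<times> circle) z \<partial>\<gamma>) = measure \<gamma> (?A \<times> circle)"
      by simp
    finally have 1: "(\<integral>z. indicator {..u} (X z) \<partial>\<gamma>) = (\<integral>x. max (h x) 0 * indicator ?A x \<partial>circ)"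
      using marg1[OF A] by simp
    have "(\<integral>z. indicator {..u} (Y z) \<partial>\<gamma>) = (\<integral>z. indicator (circle \<times> ?A) z \<partial>\<gamma>)"
      by (intro Bochner_Integration.integral_cong) (auto simp: Y_def indicator_def space_\<gamma>)
    also have "(circle \<times> ?A) \<inter> space \<gamma> = circle \<times> ?A" by (auto simp: space_\<gamma>)
    then have "(\<integral>z. indicator (circle \<times> ?A) z \<partial>\<gamma>) = measure \<gamma> (circle \<times> ?A)"
      by simp
    finally have 2: "(\<integral>z. indicator {..u} (Y z) \<partial>\<gamma>) = (\<integral>x. max (- h x) 0 * indicator ?A x \<partial>circ)"
      using marg2[OF A] by simp
    have i: "integrable circ (\<lambda>x. max (h x) 0 * indicator ?A x)" "integrable circ (\<lambda>x. max (- h x) 0 * indicator ?A x)"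
    proof -
      have m: "(\<lambda>x. max (h x) 0 * indicator ?A x) \<in> borel_measurable circle_borel"
          "(\<lambda>x. max (- h x) 0 * indicator ?A x) \<in> borel_measurable circle_borel"
        by measurable
      have bd: "\<bar>max (h x) 0 * indicator ?A x\<bar> \<le> c" "\<bar>max (- h x) 0 * indicator ?A x\<bar> \<le> c" for x
        using hb[of x] by (auto simp: indicator_def)
      show "integrable circ (\<lambda>x. max (h x) 0 * indicator ?A x)"
        by (rule integrable_circ_bounded[OF m(1) bd(1)])
      show "integrable circ (\<lambda>x. max (- h x) 0 * indicator ?A x)"
        by (rule integrable_circ_bounded[OF m(2) bd(2)])
    qed
    have "(\<integral>z. K z u \<partial>\<gamma>) = (\<integral>z. indicator {..u} (X z) \<partial>\<gamma>) - (\<integral>z. indicator {..u} (Y z) \<partial>\<gamma>) - k"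
      unfolding K_def k_def using ind_int m_int by simp
    also have "\<dots> = (\<integral>x. max (h x) 0 * indicator ?A x - max (- h x) 0 * indicator ?A x \<partial>circ) - k"
      unfolding 1 2 using i by simp
    also have "(\<integral>x. max (h x) 0 * indicator ?A x - max (- h x) 0 * indicator ?A x \<partial>circ) = (\<integral>x. h x * indicator ?A x \<partial>circ)"
      by (intro Bochner_Integration.integral_cong) (auto simp: max_def indicator_def)
    also have "\<dots> = integral {b..u} (\<lambda>t. h (cis t))"
      by (rule integral_circ_angle_le[OF h hb u])
    finally show ?thesis .
  qed
  define F where "F u = integral {b..u} (\<lambda>t. h (cis t))" for u
  have hc: "(\<lambda>t. h (cis t)) \<in> borel_measurable borel" by measurable
  have contF: "continuous_on {b..b+2*pi} F"
    unfolding F_def by (intro indefinite_integral_continuous_1 bounded_borel_integrable_on(1)[OF hc]) (rule hb)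
  have contFk: "continuous_on {b..b+2*pi} (\<lambda>u. \<bar>F u - k\<bar>)" by (intro continuous_intros contF)
  have FkL: "(\<integral>u. \<bar>F u - k\<bar> \<partial>L) = integral {b..b+2*pi} (\<lambda>u. \<bar>F u - k\<bar>)" "integrable L (\<lambda>u. \<bar>F u - k\<bar>)"
  proof -
    have si: "set_integrable lborel {b..b+2*pi} (\<lambda>u. \<bar>F u - k\<bar>)"
      unfolding set_integrable_def by (rule borel_integrable_compact[OF compact_Icc contFk])
    show "(\<integral>u. \<bar>F u - k\<bar> \<partial>L) = integral {b..b+2*pi} (\<lambda>u. \<bar>F u - k\<bar>)"
      using set_borel_integral_eq_integral(2)[OF si]
      by (simp add: L_def integral_restrict_space set_lebesgue_integral_def)
    show "integrable L (\<lambda>u. \<bar>F u - k\<bar>)"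
      using si by (simp add: L_def integrable_restrict_space set_integrable_def)
  qed
  have "(\<integral>u. \<bar>F u - k\<bar> \<partial>L) \<le> (\<integral>u. (\<integral>z. \<bar>K z u\<bar> \<partial>\<gamma>) \<partial>L)"
  proof (rule integral_mono)
    show "integrable L (\<lambda>u. \<integral>z. \<bar>K z u\<bar> \<partial>\<gamma>)" using P.integrable_snd[OF absK_int] .
    fix u assume "u \<in> space L"
    then have "F u - k = (\<integral>z. K z u \<partial>\<gamma>)" using flux[of u] by (simp add: F_def spL)
    then show "\<bar>F u - k\<bar> \<le> (\<integral>z. \<bar>K z u\<bar> \<partial>\<gamma>)" using integral_abs_bound by metis
  qed (rule FkL)
  also have "\<dots> = (\<integral>z. (\<integral>u. \<bar>K z u\<bar> \<partial>L) \<partial>\<gamma>)" by (rule P.Fubini_integral[OF absK_int])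
  also have "\<dots> = (\<integral>z. arc_dist (fst z) (snd z) \<partial>\<gamma>)"
    by (intro Bochner_Integration.integral_cong refl dist_eq)
  finally have "integral {b..b+2*pi} (\<lambda>u. \<bar>F u - k\<bar>) \<le> (\<integral>z. arc_dist (fst z) (snd z) \<partial>\<gamma>)"
    by (simp add: FkL)
  moreover have "\<bar>k\<bar> \<le> measure \<gamma> (space \<gamma>)"
  proof -
    have "\<bar>k\<bar> \<le> (\<integral>z. \<bar>m z\<bar> \<partial>\<gamma>)" unfolding k_def by (rule integral_abs_bound)
    also have "\<dots> \<le> (\<integral>z. 1 \<partial>\<gamma>)" using m_int m_abs by (intro integral_mono) auto
    finally show ?thesis by simp
  qed
  ultimately show "\<exists>k. \<bar>k\<bar> \<le> measure \<gamma> (space \<gamma>) \<and>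
    integral {b..b+2*pi} (\<lambda>u. \<bar>integral {b..u} (\<lambda>t. h (cis t)) - k\<bar>) \<le> (\<integral>z. arc_dist (fst z) (snd z) \<partial>\<gamma>)"
    unfolding F_def by blast
qed

text \<open>
  Integrating the tangent of \<open>x powr p\<close> at the width \<open>w\<close> of the optimal arcs reduces the cost with exponent \<open>p\<close> to
  the cost with exponent one; this replaces Jensen's inequality and gives the sharp constant directly.
\<close>

lemma powr_ge_tangent:
  fixes x w p :: real
  assumes "p \<ge> 1" "w > 0" "x \<ge> 0"
  shows "w powr p + p * w powr (p - 1) * (x - w) \<le> x powr p"
proof (cases "x = 0")
  case True
  have "w powr (p - 1) * w = w powr p"
    using assms(2) powr_add[of w "p - 1" 1] by simp
  then have "w powr p + p * w powr (p - 1) * (0 - w) = (1 - p) * w powr p" by (simp add: algebra_simps)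
  also have "\<dots> \<le> 0" using assms(1) by (intro mult_nonpos_nonneg) auto
  finally show ?thesis using True by simp
next
  case False
  have "(p * w powr (p - 1)) * (x - w) \<le> x powr p - w powr p"
    by (rule convex_on_imp_above_tangent[OF powr_convex[OF assms(1)]])
       (use assms False in \<open>auto intro!: derivative_eq_intros simp: interior_open\<close>)
  then show ?thesis by simp
qed

section \<open>The flux of a function with finitely many nodal points\<close>

lemma circle_enumerate:
  assumes "Z \<subseteq> circle" "finite Z" "card Z = N" "N > 0"
  obtains a :: "nat \<Rightarrow> real" where "\<And>i. i < N \<Longrightarrow> a i < a (Suc i)" "a N = a 0 + 2*pi" "Z = cis ` a ` {..<N}"
proof -
  define A where "A = angle 0 ` Z"
  have "inj_on (angle 0) Z"
    using assms(1) cis_angle by (intro inj_on_inverseI[of _ cis]) auto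
  then have A: "finite A" "card A = N" "cis ` A = Z"
    using assms cis_angle by (auto simp: A_def card_image image_image subset_iff)
  have A_bd: "0 \<le> x \<and> x < 2*pi" if "x \<in> A" for x using that angle_bounds[of 0] by (auto simp: A_def)
  define xs where "xs = sorted_list_of_set A"
  have xs: "set xs = A" "length xs = N" "sorted_wrt (<) xs"
    using A by (auto simp: xs_def)
  define a where "a i = (if i < N then xs ! i else xs ! 0 + 2*pi)" for i
  show ?thesis
  proof (rule that)
    fix i assume i: "i < N"
    show "a i < a (Suc i)"
    proof (cases "Suc i < N")
      case True
      then show ?thesis using sorted_wrt_nth_less[OF xs(3), of i "Suc i"] xs(2) by (simp add: a_def)
    next
      case False
      have "xs ! i \<in> A" "xs ! 0 \<in> A" using xs i assms(4) nth_mem[of _ xs] by auto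
      then have "xs ! i < xs ! 0 + 2*pi" using A_bd[of "xs ! i"] A_bd[of "xs ! 0"] by linarith
      then show ?thesis using i False by (simp add: a_def)
    qed
  next
    show "a N = a 0 + 2*pi" using assms(4) by (simp add: a_def)
    have "a ` {..<N} = (!) xs ` {..<N}" by (intro image_cong) (auto simp: a_def)
    also have "\<dots> = A" using xs nth_image[of N xs] by (simp add: lessThan_atLeast0)
    finally show "Z = cis ` a ` {..<N}" using A by simp
  qed
qed

lemma nodal_set_subset_circle:
  assumes "nodal_selection sel"
  shows "nodal_set sel f \<subseteq> circle"
proof -
  have "boundary_pos f \<subseteq> circle"
    unfolding boundary_pos_def using frontier_of_subset_topspace[of circle_top] by auto
  moreover have "J \<subseteq> circle" if "J \<in> sign_change_components f" for J
    using that in_components_subset by (fastforce simp: sign_change_components_def zero_components_def)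
  ultimately show ?thesis
    using assms by (fastforce simp: nodal_set_def nodal1_def nodal2_def nodal_selection_def)
qed

text \<open>
  A Borel version of \<open>f\<close> that obeys the \<open>L\<^sup>\<infinity>\<close> bound everywhere; truncation changes \<open>f\<close> on a null set only.
\<close>

lemma class_X_version:
  assumes f: "f \<in> class_X sel c c\<^sub>1 N" and "c > 0"
  obtains h where "h \<in> borel_measurable circle_borel" "\<And>x. \<bar>h x\<bar> \<le> c" "AE x in circ. f x = h x"
    "(\<integral>x. h x \<partial>circ) = 0" "(\<integral>x. \<bar>h x\<bar> \<partial>circ) = c\<^sub>1"
proof -
  have fm: "f \<in> borel_measurable (completion circ)"
    and es: "esssup (completion circ) (\<lambda>x. ereal \<bar>f x\<bar>) = ereal c"
    and i: "(\<integral>x. \<bar>f x\<bar> \<partial>completion circ) = c\<^sub>1" "(\<integral>x. f x \<partial>completion circ) = 0"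
    using f by (auto simp: class_X_def arc_length_eq_completion)
  obtain h0 where h0 [measurable]: "h0 \<in> borel_measurable circ" "AE x in circ. f x = h0 x"
    using completion_ex_borel_measurable_real[OF fm] by blast
  define h where "h x = max (- c) (min c (h0 x))" for x
  have h_meas [measurable]: "h \<in> borel_measurable circ" unfolding h_def by measurable
  have "AE x in circ. ereal \<bar>f x\<bar> \<le> ereal c"
    using esssup_AE[of "\<lambda>x. ereal \<bar>f x\<bar>" "completion circ"] unfolding es AE_completion_iff .
  with h0(2) have ae: "AE x in circ. f x = h x"
    by eventually_elim (auto simp: h_def)
  have "(\<integral>x. h x \<partial>circ) = (\<integral>x. f x \<partial>completion circ)"
    using ae fm by (subst integral_completion[symmetric], simp, intro integral_cong_AE)
      (auto simp: AE_completion_iff measurable_completion)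
  moreover have "(\<integral>x. \<bar>h x\<bar> \<partial>circ) = (\<integral>x. \<bar>f x\<bar> \<partial>completion circ)"
    using ae fm by (subst integral_completion[symmetric], simp, intro integral_cong_AE)
      (auto simp: AE_completion_iff measurable_completion)
  moreover have "\<bar>h x\<bar> \<le> c" for x using assms(2) by (auto simp: h_def)
  moreover have "h \<in> borel_measurable circle_borel"
    using h_meas unfolding measurable_cong_sets[OF sets_circ refl] .
  ultimately show ?thesis by (intro that[of h] ae) (simp_all only: i)
qed

lemma AE_zero_of_integral_zero:
  fixes g :: "real \<Rightarrow> real"
  assumes g: "g \<in> borel_measurable borel" "\<And>t. \<bar>g t\<bar> \<le> C"
    and nn: "AE t in lborel. t \<in> {x..y} \<longrightarrow> 0 \<le> g t" and z: "integral {x..y} g = 0"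
  shows "AE t in lborel. t \<in> {x..y} \<longrightarrow> g t = 0"
proof -
  have si: "integrable lborel (\<lambda>t. indicator {x..y} t * g t)"
    using set_integrable_bounded_borel[OF g] by (simp add: set_integrable_def)
  have "(\<integral>t. indicator {x..y} t * g t \<partial>lborel) = 0"
    using bounded_borel_integrable_on(2)[OF g] z by (simp add: set_lebesgue_integral_def)
  moreover have "AE t in lborel. 0 \<le> indicator {x..y} t * g t"
    using nn by eventually_elim (auto simp: indicator_def)
  ultimately have "AE t in lborel. indicator {x..y} t * g t = 0"
    using integral_nonneg_eq_0_iff_AE[OF si] by blast
  then show ?thesis by eventually_elim (auto simp: indicator_def)
qed

lemma integral_abs_constant_sign:
  fixes g :: "real \<Rightarrow> real"
  assumes g: "g \<in> borel_measurable borel" "\<And>t. \<bar>g t\<bar> \<le> C"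
    and sg: "(AE t in lborel. t \<in> {x<..<y} \<longrightarrow> 0 \<le> g t) \<or> (AE t in lborel. t \<in> {x<..<y} \<longrightarrow> g t \<le> 0)"
  shows "integral {x..y} (\<lambda>t. \<bar>g t\<bar>) = \<bar>integral {x..y} g\<bar>"
proof -
  have ga: "(\<lambda>t. \<bar>g t\<bar>) \<in> borel_measurable borel" "\<And>t. \<bar>\<bar>g t\<bar>\<bar> \<le> C" using g by auto
  have key: "integral {x..y} (\<lambda>t. \<bar>g t\<bar>) = \<sigma> * integral {x..y} g"
    if ae: "AE t in lborel. t \<in> {x<..<y} \<longrightarrow> \<bar>g t\<bar> = \<sigma> * g t" for \<sigma> :: real
  proof -
    have "(LINT t:{x..y}|lborel. \<bar>g t\<bar>) = (LINT t:{x..y}|lborel. \<sigma> * g t)"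
      unfolding set_lebesgue_integral_def
    proof (rule integral_cong_AE)
      show "AE t in lborel. indicator {x..y} t *\<^sub>R \<bar>g t\<bar> = indicator {x..y} t *\<^sub>R (\<sigma> * g t)"
        using ae AE_lborel_singleton[of x] AE_lborel_singleton[of y]
        by eventually_elim (auto simp: indicator_def)
    qed (use g in auto)
    then show ?thesis
      using bounded_borel_integrable_on(2)[OF g] bounded_borel_integrable_on(2)[OF ga] by simp
  qed
  have nn: "0 \<le> integral {x..y} (\<lambda>t. \<bar>g t\<bar>)"
    by (intro Henstock_Kurzweil_Integration.integral_nonneg bounded_borel_integrable_on(1)[OF ga]) auto
  from sg show ?thesis
  proof
    assume "AE t in lborel. t \<in> {x<..<y} \<longrightarrow> 0 \<le> g t"
    then have "AE t in lborel. t \<in> {x<..<y} \<longrightarrow> \<bar>g t\<bar> = 1 * g t" by eventually_elim auto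
    from key[OF this] nn show ?thesis by simp
  next
    assume "AE t in lborel. t \<in> {x<..<y} \<longrightarrow> g t \<le> 0"
    then have "AE t in lborel. t \<in> {x<..<y} \<longrightarrow> \<bar>g t\<bar> = - 1 * g t" by eventually_elim auto
    from key[OF this] nn show ?thesis by simp
  qed
qed

text \<open>
  What the lower bound uses of a function in the class: it is bounded by \<open>c\<close>, has mean zero and \<open>L\<^sup>1\<close> norm \<open>V\<close>,
  and is almost everywhere of one sign in each of \<open>N\<close> sectors.
\<close>

locale sign_partition =
  fixes h :: "complex \<Rightarrow> real" and c V :: real and N :: nat and a :: "nat \<Rightarrow> real"
  assumes h_meas [measurable]: "h \<in> borel_measurable circle_borel" and h_bound: "\<And>x. \<bar>h x\<bar> \<le> c"
    and c_pos: "c > 0" and V_pos: "V > 0" and N_pos: "N > 0"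
    and incr: "\<And>i. i < N \<Longrightarrow> a i < a (Suc i)" and turn: "a N = a 0 + 2*pi"
    and sign: "\<And>i. i < N \<Longrightarrow> (AE t in lborel. t \<in> {a i<..<a (Suc i)} \<longrightarrow> 0 \<le> h (cis t)) \<or>
                 (AE t in lborel. t \<in> {a i<..<a (Suc i)} \<longrightarrow> h (cis t) \<le> 0)"
    and mean: "(\<integral>x. h x \<partial>circ) = 0" and total: "(\<integral>x. \<bar>h x\<bar> \<partial>circ) = V"
begin

definition flux :: "real \<Rightarrow> real" where
  "flux u = integral {a 0..u} (\<lambda>t. h (cis t))"

lemma hcis: "(\<lambda>t. h (cis t)) \<in> borel_measurable borel" "\<bar>h (cis t)\<bar> \<le> c"
  using h_bound by auto

lemma hcis_integrable: "(\<lambda>t. h (cis t)) integrable_on {x..y}"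
  by (rule bounded_borel_integrable_on(1)[OF hcis])

lemma flux_diff: "a 0 \<le> x \<Longrightarrow> x \<le> y \<Longrightarrow> flux y - flux x = integral {x..y} (\<lambda>t. h (cis t))"
  using Henstock_Kurzweil_Integration.integral_combine[OF _ _ hcis_integrable, of "a 0" x y]
  by (simp add: flux_def)

lemma flux_lipschitz: "a 0 \<le> x \<Longrightarrow> x \<le> y \<Longrightarrow> \<bar>flux y - flux x\<bar> \<le> c * (y - x)"
proof -
  assume xy: "a 0 \<le> x" "x \<le> y"
  have "norm (integral {x..y} (\<lambda>t. h (cis t))) \<le> integral {x..y} (\<lambda>t. c)"
    by (intro integral_norm_bound_integral hcis_integrable) (use hcis(2) in auto)
  then show ?thesis using xy by (simp add: flux_diff mult.commute)
qed

lemma a_mono: "i \<le> j \<Longrightarrow> j \<le> N \<Longrightarrow> a i \<le> a j"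
  using partition_mono[of N a i j] incr by (simp add: less_imp_le)

lemma flux_continuous: "continuous_on {a 0..a N} flux"
  unfolding flux_def by (intro indefinite_integral_continuous_1 hcis_integrable)

text \<open>
  Constant sign turns the mass of \<open>h\<close> in a part of a sector into a variation of the flux.
\<close>

lemma sector_integral_abs:
  assumes "i < N" "a i \<le> x" "x \<le> y" "y \<le> a (Suc i)"
  shows "integral {x..y} (\<lambda>t. \<bar>h (cis t)\<bar>) = \<bar>flux y - flux x\<bar>"
proof -
  have "a 0 \<le> x" using a_mono[of 0 i] assms by simp
  then have "flux y - flux x = integral {x..y} (\<lambda>t. h (cis t))" using assms(3) by (rule flux_diff)
  moreover have "(AE t in lborel. t \<in> {x<..<y} \<longrightarrow> 0 \<le> h (cis t)) \<or>
      (AE t in lborel. t \<in> {x<..<y} \<longrightarrow> h (cis t) \<le> 0)"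
    using sign[OF assms(1)]
  proof (elim disjE)
    assume "AE t in lborel. t \<in> {a i<..<a (Suc i)} \<longrightarrow> 0 \<le> h (cis t)"
    then have "AE t in lborel. t \<in> {x<..<y} \<longrightarrow> 0 \<le> h (cis t)"
      by eventually_elim (use assms in auto)
    then show ?thesis ..
  next
    assume "AE t in lborel. t \<in> {a i<..<a (Suc i)} \<longrightarrow> h (cis t) \<le> 0"
    then have "AE t in lborel. t \<in> {x<..<y} \<longrightarrow> h (cis t) \<le> 0"
      by eventually_elim (use assms in auto)
    then show ?thesis ..
  qed
  ultimately show ?thesis using integral_abs_constant_sign[OF hcis] by simp
qed

lemma flux_total_variation: "(\<Sum>i<N. \<bar>flux (a (Suc i)) - flux (a i)\<bar>) = V"
proof -
  have m: "(\<lambda>x. \<bar>h x\<bar>) \<in> borel_measurable circle_borel" "\<bar>\<bar>h x\<bar>\<bar> \<le> c" for x using h_bound by auto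
  have "V = integral {a 0..a N} (\<lambda>t. \<bar>h (cis t)\<bar>)"
    using integral_circ_interval[OF m, of "a 0"] total by (simp add: turn)
  also have "\<dots> = (\<Sum>i<N. integral {a i..a (Suc i)} (\<lambda>t. \<bar>h (cis t)\<bar>))"
    using incr m by (intro integral_partition_sum bounded_borel_integrable_on(1)[where C = c])
      (auto simp: less_imp_le hcis)
  also have "\<dots> = (\<Sum>i<N. \<bar>flux (a (Suc i)) - flux (a i)\<bar>)"
    by (intro sum.cong refl sector_integral_abs) (auto simp: less_imp_le incr)
  finally show ?thesis ..
qed

text \<open>
  The cost with exponent one that is forced by a net flow \<open>- k\<close> through the cut.
\<close>

definition transported :: "real \<Rightarrow> real" where
  "transported k = integral {a 0..a 0 + 2*pi} (\<lambda>u. \<bar>flux u - k\<bar>)"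

lemma shifted_flux:
  "(\<lambda>u. \<bar>flux u - k\<bar>) integrable_on {a 0..a N}"
  "V = (\<Sum>i<N. \<bar>(flux (a (Suc i)) - k) - (flux (a i) - k)\<bar>)"
  "a 0 \<le> x \<Longrightarrow> x \<le> y \<Longrightarrow> y \<le> a N \<Longrightarrow> \<bar>(flux y - k) - (flux x - k)\<bar> \<le> c * (y - x)"
  using flux_total_variation flux_lipschitz[of x y]
  by (auto intro!: integrable_continuous_interval continuous_intros flux_continuous)

lemma transported_ge: "V\<^sup>2 / (4 * c * N) \<le> transported k"
  unfolding transported_def turn[symmetric]
  by (rule lipschitz_partition_integral_abs_ge(1)[OF N_pos c_pos _ shifted_flux(3) shifted_flux(2) shifted_flux(1)])
     (auto simp: incr less_imp_le)

lemma transported_lipschitz: "\<bar>transported k - transported l\<bar> \<le> 2*pi * \<bar>k - l\<bar>"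
proof -
  have "norm (integral {a 0..a 0 + 2*pi} (\<lambda>u. \<bar>flux u - k\<bar> - \<bar>flux u - l\<bar>)) \<le> integral {a 0..a 0 + 2*pi} (\<lambda>u. \<bar>k - l\<bar>)"
    using shifted_flux(1)[of k] shifted_flux(1)[of l]
    by (intro integral_norm_bound_integral) (auto simp: turn intro!: Henstock_Kurzweil_Integration.integrable_diff)
  then show ?thesis
    using shifted_flux(1)[of k] shifted_flux(1)[of l]
    by (simp add: transported_def turn Henstock_Kurzweil_Integration.integral_diff)
qed

lemma transported_continuous: "continuous_on S transported"
proof (rule continuous_onI)
  fix x e :: real assume e: "e > 0"
  show "\<exists>d>0. \<forall>x'\<in>S. dist x' x < d \<longrightarrow> dist (transported x') (transported x) \<le> e"
  proof (intro exI[of _ "e / (2*pi)"] conjI ballI impI)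
    fix y assume "dist y x < e / (2*pi)"
    then have "2*pi * \<bar>y - x\<bar> \<le> e" by (simp add: dist_real_def field_simps)
    then show "dist (transported y) (transported x) \<le> e"
      using transported_lipschitz[of y x] by (simp add: dist_real_def)
  qed (use e in simp)
qed

text \<open>
  In the case of equality the flux has the same variation \<open>2 * c * w\<close> on every sector, and on each of them it is a
  pair of ramps of slope \<open>c\<close> and width \<open>w\<close> that meet the value \<open>k\<close> in the middle part.  So it
  ends a sector with the sign opposite to the one it started with, whence the signs alternate; its
  slope \<open>\<plusminus>c\<close> forces \<open>\<bar>h\<bar> = c\<close> next to the nodal points, and where it rests \<open>h\<close> has no mass.
\<close>

lemma transported_eq:
  assumes "even N" and eq: "transported k = V\<^sup>2 / (4 * c * N)"
  defines "w \<equiv> V / (2 * c * N)"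
  shows "\<exists>s. alternating_arcs c w N a s \<and> (AE x in circ. h x = alternating_arcs.profile c w N a s x)"
proof -
  define G where "G u = flux u - k" for u
  define \<sigma> where "\<sigma> i = sgn (G (a (Suc i)) - G (a i))" for i
  have w_pos: "w > 0" using V_pos c_pos N_pos by (simp add: w_def)
  have cw: "2 * (c * w) = V / N" using c_pos N_pos by (simp add: w_def field_simps)
  have piece: "\<bar>G (a (Suc i)) - G (a i)\<bar> = 2 * (c * w) \<and>
      integral {a i..a (Suc i)} (\<lambda>x. \<bar>G x\<bar>) = (G (a (Suc i)) - G (a i))\<^sup>2 / (4*c)" if "i < N" for i
    unfolding cw G_def
    by (rule lipschitz_partition_integral_abs_ge(2)[OF N_pos c_pos _ shifted_flux(3) shifted_flux(2) shifted_flux(1) _ that])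
       (use eq in \<open>auto simp: incr less_imp_le transported_def turn\<close>)
  have lip: "\<bar>G y - G x\<bar> \<le> c * (y - x)" if "a 0 \<le> x" "x \<le> y" for x y
    using flux_lipschitz[OF that] by (simp add: G_def)
  have gap: "a i + 2 * w \<le> a (Suc i)" if "i < N" for i
  proof -
    have "2 * (c * w) \<le> c * (a (Suc i) - a i)"
      using piece[OF that] lip[of "a i" "a (Suc i)"] a_mono[of 0 i] incr[OF that] that by auto
    then have "c * (2 * w) \<le> c * (a (Suc i) - a i)" by simp
    then show ?thesis using c_pos by (simp only: mult_le_cancel_left_pos)
  qed
  have \<sigma>: "\<sigma> i = 1 \<or> \<sigma> i = -1" if "i < N" for i
    using piece[OF that] c_pos w_pos by (auto simp: \<sigma>_def sgn_if)
  have G: "G x = \<sigma> i * (max 0 (c * w - c * (a (Suc i) - x)) - max 0 (c * w - c * (x - a i)))"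
    if i: "i < N" and x: "x \<in> {a i..a (Suc i)}" for i x
  proof -
    have v: "\<bar>G (a (Suc i)) - G (a i)\<bar> / 2 = c * w" using piece[OF i] by simp
    have "a 0 \<le> a i" using a_mono[of 0 i] i by simp
    then have L: "\<bar>G z - G y\<bar> \<le> c * (z - y)" if "a i \<le> y" "y \<le> z" "z \<le> a (Suc i)" for y z
      using lip that by simp
    have ne: "G (a i) \<noteq> G (a (Suc i))" using piece[OF i] c_pos w_pos by auto
    show ?thesis
      using lipschitz_integral_abs_ge(2)[of "a i" "a (Suc i)" c G x] L ne piece[OF i] x c_pos incr[OF i]
      unfolding v \<sigma>_def by (simp add: less_imp_le)
  qed
  have cgap: "c * w + c * w \<le> c * (a (Suc i) - a i)" if "i < N" for i
    using mult_left_mono[OF gap[OF that], of c] c_pos by (simp add: algebra_simps)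
  have G_left: "G (a i) = - \<sigma> i * (c * w)" and G_right: "G (a (Suc i)) = \<sigma> i * (c * w)"
    and G_first: "G (a i + w) = 0" and G_last: "G (a (Suc i) - w) = 0" if i: "i < N" for i
  proof -
    have cw0: "c * w > 0" using c_pos w_pos by simp
    note g = cgap[OF i] cw0 gap[OF i] w_pos incr[OF i]
    show "G (a i) = - \<sigma> i * (c * w)" using G[OF i, of "a i"] g by (simp add: max_def)
    show "G (a (Suc i)) = \<sigma> i * (c * w)" using G[OF i, of "a (Suc i)"] g by (simp add: max_def)
    have "c * (a (Suc i) - (a i + w)) = c * (a (Suc i) - a i) - c * w" by (simp add: algebra_simps)
    then show "G (a i + w) = 0" using G[OF i, of "a i + w"] g by (simp add: max_def)
    have "c * (a (Suc i) - w - a i) = c * (a (Suc i) - a i) - c * w" by (simp add: algebra_simps)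
    then show "G (a (Suc i) - w) = 0" using G[OF i, of "a (Suc i) - w"] g by (simp add: max_def)
  qed
  have \<sigma>_alt: "\<sigma> (Suc i) = - \<sigma> i" if "Suc i < N" for i
  proof -
    have "(\<sigma> (Suc i) + \<sigma> i) * (c * w) = 0"
      using G_left[OF that] G_right[of i] that by (simp add: distrib_right)
    then show ?thesis using c_pos w_pos by simp
  qed
  define s where "s i = \<sigma> 0 * (-1) ^ i" for i :: nat
  have s: "s i = \<sigma> i" if "i < N" for i
    using that by (induction i) (auto simp: s_def \<sigma>_alt)
  have arcs: "alternating_arcs c w N a s"
    using c_pos w_pos N_pos assms(1) gap turn \<sigma>[OF N_pos]
    by unfold_locales (auto simp: s_def)
  interpret alternating_arcs c w N a s by (rule arcs)
  have diffG: "integral {x..y} (\<lambda>t. h (cis t)) = G y - G x" if "a 0 \<le> x" "x \<le> y" for x y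
    using flux_diff[OF that] by (simp add: G_def)
  \<comment> \<open>A flux gaining \<open>c * w\<close> over the width \<open>w\<close> leaves no room below the bound \<open>c\<close>.\<close>
  have steep: "AE t in lborel. t \<in> {x..x + w} \<longrightarrow> h (cis t) = c * \<tau>"
    if x: "a 0 \<le> x" and \<tau>: "\<tau> = 1 \<or> \<tau> = -1" and d: "G (x + w) - G x = \<tau> * (c * w)" for x \<tau> :: real
  proof -
    have "AE t in lborel. t \<in> {x..x+w} \<longrightarrow> c - \<tau> * h (cis t) = 0"
    proof (rule AE_zero_of_integral_zero[where C = "2 * c"])
      show "(\<lambda>t. c - \<tau> * h (cis t)) \<in> borel_measurable borel" using hcis by simp
      have bd: "\<bar>\<tau> * h (cis t)\<bar> \<le> c" for t using hcis(2)[of t] \<tau> by auto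
      then show "\<bar>c - \<tau> * h (cis t)\<bar> \<le> 2 * c" for t using bd[of t] by linarith
      show "AE t in lborel. t \<in> {x..x+w} \<longrightarrow> 0 \<le> c - \<tau> * h (cis t)"
        using bd by (intro AE_I2) (auto simp: abs_le_iff)
      have "integral {x..x+w} (\<lambda>t. c - \<tau> * h (cis t)) = c * w - \<tau> * (G (x + w) - G x)"
        using integrable_cmul[OF hcis_integrable[of x "x + w"], of \<tau>] w_pos x
        by (subst Henstock_Kurzweil_Integration.integral_diff) (auto simp: diffG mult.commute[of w])
      also have "\<dots> = 0" using \<tau> unfolding d by auto
      finally show "integral {x..x+w} (\<lambda>t. c - \<tau> * h (cis t)) = 0" .
    qed
    then show ?thesis by eventually_elim (use \<tau> in auto)
  qed
  have sector: "AE t in lborel. t \<in> {a i<..<a (Suc i)} \<longrightarrow> h (cis t) = profile (cis t)" if i: "i < N" for i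
  proof -
    have a0: "a 0 \<le> a i" using a_mono[of 0 i] i by simp
    have 1: "AE t in lborel. t \<in> {a i..a i + w} \<longrightarrow> h (cis t) = c * s i"
      using G_left[OF i] G_first[OF i] \<sigma>[OF i] a0 by (intro steep) (auto simp: s i)
    have "AE t in lborel. t \<in> {a (Suc i) - w..(a (Suc i) - w) + w} \<longrightarrow> h (cis t) = c * s i"
      using G_right[OF i] G_last[OF i] \<sigma>[OF i] a0 gap[OF i] w_pos by (intro steep) (auto simp: s i)
    then have 2: "AE t in lborel. t \<in> {a (Suc i) - w..a (Suc i)} \<longrightarrow> h (cis t) = c * s i" by simp
    have "integral {a i + w..a (Suc i) - w} (\<lambda>t. \<bar>h (cis t)\<bar>) = 0"
      using sector_integral_abs[OF i, of "a i + w" "a (Suc i) - w"] G_first[OF i] G_last[OF i] gap[OF i] w_pos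
      by (simp add: G_def)
    then have "AE t in lborel. t \<in> {a i + w..a (Suc i) - w} \<longrightarrow> \<bar>h (cis t)\<bar> = 0"
      using hcis by (intro AE_zero_of_integral_zero[where C = c]) auto
    then show ?thesis
      using 1 2 AE_lborel_singleton[of "a i + w"] AE_lborel_singleton[of "a (Suc i) - w"]
    proof eventually_elim
      case (elim t)
      show ?case
      proof
        assume t: "t \<in> {a i<..<a (Suc i)}"
        consider "t < a i + w" | "a (Suc i) - w < t" | "a i + w \<le> t" "t \<le> a (Suc i) - w" by linarith
        then show "h (cis t) = profile (cis t)"
          using elim t profile_right[OF i, of t] profile_left_Suc[OF i, of t] profile_gap[OF i, of t]
          by cases auto
      qed
    qed
  qed
  have "AE t in lborel. \<forall>i\<in>{..<N}. (t \<in> {a i<..<a (Suc i)} \<longrightarrow> h (cis t) = profile (cis t)) \<and> t \<noteq> a i"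
    using sector AE_lborel_singleton by (intro AE_finite_allI) auto
  then have "AE t in lborel. t \<in> {a 0..<a 0 + 2*pi} \<longrightarrow> h (cis t) = profile (cis t)"
  proof eventually_elim
    case (elim t)
    show ?case
    proof
      assume "t \<in> {a 0..<a 0 + 2*pi}"
      then obtain i where "i < N" "a i \<le> t" "t < a (Suc i)"
        using partition_locate[of a t N] turn by auto
      then show "h (cis t) = profile (cis t)"
        using elim by (metis greaterThanLessThan_iff lessThan_iff le_less)
    qed
  qed
  then have "AE x in circ. h x = profile x"
  proof (subst AE_circ_cis_iff[where b = "a 0"])
    have "{x \<in> space circle_borel. h x = profile x} \<in> sets circle_borel" by measurable
    then show "{x \<in> circle. h x = profile x} \<in> sets circle_borel" by (simp add: space_restrict_space)
  qed
  then show ?thesis using arcs by blast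
qed

end

section \<open>The minimum and the minimizers\<close>

text \<open>
  An infimum over the empty set would be an unspecified real number, so lower bounds for
  the Wasserstein distance require a coupling; the normalized product measure is one.
\<close>

lemma couplings_nonempty:
  assumes m: "m > 0" "measure \<mu> circle = m" "measure \<nu> circle = m"
    and fin: "finite_measure \<mu>" "finite_measure \<nu>"
    and sets: "sets \<mu> = sets circle_borel" "sets \<nu> = sets circle_borel"
  shows "couplings \<mu> \<nu> \<noteq> {}"
proof -
  interpret M: finite_measure \<mu> by fact
  interpret N: finite_measure \<nu> by fact
  have e: "emeasure \<mu> circle = ennreal m" "emeasure \<nu> circle = ennreal m"
    using m by (simp_all add: M.emeasure_eq_measure N.emeasure_eq_measure)
  have circle_sets: "circle \<in> sets circle_borel" using sets.top[of circle_borel] by (simp add: space_restrict_space)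
  have cancel: "ennreal (1 / m) * (x * ennreal m) = x" for x
  proof -
    have "ennreal (1 / m) * (x * ennreal m) = x * (ennreal (1 / m) * ennreal m)" by (simp add: mult_ac)
    also have "ennreal (1 / m) * ennreal m = 1" using m(1) by (simp add: ennreal_mult[symmetric])
    finally show ?thesis by simp
  qed
  have cancel': "ennreal (1 / m) * (ennreal m * x) = x" for x
    using cancel[of x] by (simp add: mult.commute)
  have "scale_measure (ennreal (1 / m)) (\<mu> \<Otimes>\<^sub>M \<nu>) \<in> couplings \<mu> \<nu>"
    unfolding couplings_def
  proof (intro CollectI conjI ballI)
    show "sets (scale_measure (ennreal (1 / m)) (\<mu> \<Otimes>\<^sub>M \<nu>)) = sets (circle_borel \<Otimes>\<^sub>M circle_borel)"
      using sets by (simp cong: sets_pair_measure_cong)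
    fix A assume "A \<in> sets circle_borel"
    then show "emeasure (scale_measure (ennreal (1 / m)) (\<mu> \<Otimes>\<^sub>M \<nu>)) (A \<times> circle) = emeasure \<mu> A"
      "emeasure (scale_measure (ennreal (1 / m)) (\<mu> \<Otimes>\<^sub>M \<nu>)) (circle \<times> A) = emeasure \<nu> A"
      using circle_sets sets by (simp_all add: N.emeasure_pair_measure_Times e cancel cancel')
  qed
  then show ?thesis by blast
qed

context sign_partition
begin

lemma integral_parts: "(\<integral>x. max (h x) 0 \<partial>circ) = V / 2" "(\<integral>x. max (- h x) 0 \<partial>circ) = V / 2"
proof -
  have i: "integrable circ h" using integrable_circ_bounded[OF h_meas h_bound] .
  have "(\<integral>x. max (h x) 0 \<partial>circ) = (\<integral>x. (\<bar>h x\<bar> + h x) / 2 \<partial>circ)"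
    by (intro Bochner_Integration.integral_cong) auto
  then show "(\<integral>x. max (h x) 0 \<partial>circ) = V / 2" using i by (simp add: mean total)
  have "(\<integral>x. max (- h x) 0 \<partial>circ) = (\<integral>x. (\<bar>h x\<bar> - h x) / 2 \<partial>circ)"
    by (intro Bochner_Integration.integral_cong) auto
  then show "(\<integral>x. max (- h x) 0 \<partial>circ) = V / 2" using i by (simp add: mean total)
qed

lemma nn_integral_parts:
  "(\<integral>\<^sup>+x. ennreal (max (h x) 0) \<partial>circ) = ennreal (V / 2)"
  "(\<integral>\<^sup>+x. ennreal (max (- h x) 0) \<partial>circ) = ennreal (V / 2)"
  using nn_integral_eq_integral[of circ "\<lambda>x. max (h x) 0"] nn_integral_eq_integral[of circ "\<lambda>x. max (- h x) 0"]
    integrable_circ_bounded[OF h_meas h_bound]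
  by (simp_all add: integral_parts)

text \<open>
  A single constant \<open>k\<close> serves all couplings: the flows through the cut are bounded by the total mass \<open>V / 2\<close>
  and \<open>transported\<close> is continuous, so a minimum over a compact interval of flows exists.  This makes
  the case of equality accessible without an optimal coupling.
\<close>

lemma W_ge_transported:
  assumes fm: "f \<in> borel_measurable arc_length" and ae: "AE x in circ. f x = h x" and p: "p \<ge> 1" and w: "w > 0"
  shows "\<exists>k. 0 \<le> V / 2 * w powr p + p * w powr (p - 1) * (transported k - V / 2 * w) \<longrightarrow>
      (V / 2 * w powr p + p * w powr (p - 1) * (transported k - V / 2 * w)) powr (1 / p) \<le> W p f"
proof -
  define \<mu> where "\<mu> = density arc_length (\<lambda>x. ennreal (pos_part f x))"
  define \<nu> where "\<nu> = density arc_length (\<lambda>x. ennreal \<bar>neg_part f x\<bar>)"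
  have circle_sets: "circle \<in> sets circle_borel" using sets.top[of circle_borel] by (simp add: space_restrict_space)
  have parts_m: "pos_part f \<in> borel_measurable arc_length" "(\<lambda>x. \<bar>neg_part f x\<bar>) \<in> borel_measurable arc_length"
    unfolding pos_part_def neg_part_def using fm by measurable
  have mu: "emeasure \<mu> A = (\<integral>\<^sup>+x. ennreal (max (h x) 0) * indicator A x \<partial>circ)" if "A \<in> sets circle_borel" for A
    unfolding \<mu>_def emeasure_density_arc_length[OF parts_m(1) that]
    by (rule nn_integral_cong_AE) (use ae in eventually_elim, simp add: pos_part_def)
  have nu: "emeasure \<nu> A = (\<integral>\<^sup>+x. ennreal (max (- h x) 0) * indicator A x \<partial>circ)" if "A \<in> sets circle_borel" for A
    unfolding \<nu>_def emeasure_density_arc_length[OF parts_m(2) that]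
    by (rule nn_integral_cong_AE) (use ae in eventually_elim, simp add: neg_part_def)
  have ind: "(\<integral>\<^sup>+x. g x * indicator circle x \<partial>circ) = (\<integral>\<^sup>+x. g x \<partial>circ)" for g
    by (intro nn_integral_cong) (auto simp: indicator_def)
  have mass: "emeasure \<mu> circle = ennreal (V / 2)" "emeasure \<nu> circle = ennreal (V / 2)"
    using mu[OF circle_sets] nu[OF circle_sets] nn_integral_parts by (simp_all add: ind)
  have ne: "couplings \<mu> \<nu> \<noteq> {}"
  proof -
    define \<mu>' where "\<mu>' = density circ (\<lambda>x. ennreal (max (h x) 0))"
    define \<nu>' where "\<nu>' = density circ (\<lambda>x. ennreal (max (- h x) 0))"
    have e: "emeasure \<mu>' A = emeasure \<mu> A" "emeasure \<nu>' A = emeasure \<nu> A" if "A \<in> sets circle_borel" for A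
      using that mu[OF that] nu[OF that] by (simp_all add: \<mu>'_def \<nu>'_def emeasure_density)
    have "couplings \<mu> \<nu> = couplings \<mu>' \<nu>'"
      by (simp add: couplings_def e)
    moreover have "couplings \<mu>' \<nu>' \<noteq> {}"
    proof (rule couplings_nonempty[where m = "V / 2"])
      show "finite_measure \<mu>'" "finite_measure \<nu>'"
        using e[OF circle_sets] mass by (intro finite_measureI; simp add: \<mu>'_def \<nu>'_def)+
      show "measure \<mu>' circle = V / 2" "measure \<nu>' circle = V / 2"
        using e[OF circle_sets] mass V_pos by (simp_all add: measure_def)
    qed (use V_pos in \<open>simp_all add: \<mu>'_def \<nu>'_def\<close>)
    ultimately show ?thesis by simp
  qed
  obtain k where k: "\<And>l. \<bar>l\<bar> \<le> V / 2 \<Longrightarrow> transported k \<le> transported l"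
  proof -
    have "\<exists>x\<in>{- (V/2)..V/2}. \<forall>y\<in>{- (V/2)..V/2}. transported x \<le> transported y"
      using V_pos by (intro continuous_attains_inf transported_continuous) auto
    then obtain x where x: "\<forall>y\<in>{- (V/2)..V/2}. transported x \<le> transported y" by blast
    show ?thesis
    proof (rule that)
      fix l assume "\<bar>l\<bar> \<le> V / 2"
      then have "l \<in> {- (V/2)..V/2}" by auto
      then show "transported x \<le> transported l" using x by blast
    qed
  qed
  define B where "B = V / 2 * w powr p + p * w powr (p - 1) * (transported k - V / 2 * w)"
  have cost: "B \<le> (\<integral>z. arc_dist (fst z) (snd z) powr p \<partial>\<gamma>)" if \<gamma>: "\<gamma> \<in> couplings \<mu> \<nu>" for \<gamma>
  proof -
    note sets_\<gamma> [measurable_cong] = couplings_props(1)[OF \<gamma>]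
    have tc: "\<exists>l. \<bar>l\<bar> \<le> measure \<gamma> (space \<gamma>) \<and> transported l \<le> (\<integral>z. arc_dist (fst z) (snd z) \<partial>\<gamma>)"
      unfolding transported_def flux_def by (rule transport_cost_ge(1)[OF h_meas h_bound \<gamma> mu nu])
    interpret finite_measure \<gamma> using transport_cost_ge(2)[OF h_meas h_bound \<gamma> mu nu] .
    have M: "measure \<gamma> (space \<gamma>) = V / 2"
      using couplings_props(3)[OF \<gamma>] mass V_pos by (simp add: measure_def)
    let ?d = "\<lambda>z. arc_dist (fst z) (snd z)"
    have d_m [measurable]: "?d \<in> borel_measurable \<gamma>" by measurable
    have d_int: "integrable \<gamma> ?d"
      using arc_dist_bounds by (intro integrable_const_bound[where B = "2*pi"]) auto
    have dp_int: "integrable \<gamma> (\<lambda>z. ?d z powr p)"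
    proof (intro integrable_const_bound[where B = "(2*pi) powr p"] AE_I2)
      fix z show "norm (?d z powr p) \<le> (2*pi) powr p"
        using arc_dist_bounds[of "fst z" "snd z"] p by (simp add: powr_mono2)
    qed measurable
    from tc obtain l where "\<bar>l\<bar> \<le> V / 2" "transported l \<le> (\<integral>z. ?d z \<partial>\<gamma>)" unfolding M by blast
    then have "transported k \<le> (\<integral>z. ?d z \<partial>\<gamma>)" using k[of l] by linarith
    then have "B \<le> V / 2 * w powr p + p * w powr (p - 1) * ((\<integral>z. ?d z \<partial>\<gamma>) - V / 2 * w)"
      unfolding B_def using p by (intro add_left_mono mult_left_mono) auto
    also have "\<dots> = (\<integral>z. w powr p + p * w powr (p - 1) * (?d z - w) \<partial>\<gamma>)"
      using d_int by (simp add: M right_diff_distrib)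
    also have "\<dots> \<le> (\<integral>z. ?d z powr p \<partial>\<gamma>)"
      using d_int dp_int powr_ge_tangent[OF p w] arc_dist_bounds by (intro integral_mono) auto
    finally show ?thesis .
  qed
  have "B powr (1 / p) \<le> W p f" if "0 \<le> B"
    unfolding W_def wasserstein_def \<mu>_def[symmetric] \<nu>_def[symmetric]
    using ne cost that p by (intro cINF_greatest powr_mono2) auto
  then show ?thesis unfolding B_def by blast
qed

lemma W_ge:
  assumes fm: "f \<in> borel_measurable arc_length" and ae: "AE x in circ. f x = h x" and p: "p \<ge> 1"
  defines "w \<equiv> V / (2 * c * N)"
  shows "w * (V / 2) powr (1 / p) \<le> W p f"
    and "W p f \<le> w * (V / 2) powr (1 / p) \<Longrightarrow> \<exists>k. transported k = V\<^sup>2 / (4 * c * N)"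
proof -
  have w: "w > 0" using V_pos c_pos N_pos by (simp add: w_def)
  have Vw: "V / 2 * w = V\<^sup>2 / (4 * c * N)" by (simp add: w_def power2_eq_square)
  obtain k where k: "0 \<le> V / 2 * w powr p + p * w powr (p - 1) * (transported k - V / 2 * w) \<longrightarrow>
      (V / 2 * w powr p + p * w powr (p - 1) * (transported k - V / 2 * w)) powr (1 / p) \<le> W p f"
    using W_ge_transported[OF fm ae p w] by blast
  define e where "e = p * w powr (p - 1) * (transported k - V / 2 * w)"
  have e: "e \<ge> 0"
    unfolding e_def Vw using transported_ge[of k] p by (intro mult_nonneg_nonneg) auto
  have base: "V / 2 * w powr p > 0" using V_pos w by simp
  have We: "(V / 2 * w powr p + e) powr (1 / p) \<le> W p f"
    using k e base unfolding e_def[symmetric] by auto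
  have val: "(V / 2 * w powr p) powr (1 / p) = w * (V / 2) powr (1 / p)"
  proof -
    have "(V / 2 * w powr p) powr (1 / p) = (V / 2) powr (1 / p) * (w powr p) powr (1 / p)"
      by (rule powr_mult)
    then show ?thesis using w p by (simp add: powr_powr)
  qed
  have "(V / 2 * w powr p) powr (1 / p) \<le> (V / 2 * w powr p + e) powr (1 / p)"
    using base e p by (intro powr_mono2) auto
  then show "w * (V / 2) powr (1 / p) \<le> W p f" using We val by linarith
  assume le: "W p f \<le> w * (V / 2) powr (1 / p)"
  have "e = 0"
  proof (rule ccontr)
    assume "e \<noteq> 0"
    then have "(V / 2 * w powr p) powr (1 / p) < (V / 2 * w powr p + e) powr (1 / p)"
      using base e p by (intro powr_less_mono2) auto
    then show False using We val le by linarith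
  qed
  then have "transported k = V / 2 * w" using p w by (simp add: e_def)
  then show "\<exists>k. transported k = V\<^sup>2 / (4 * c * N)" using Vw by metis
qed

end

lemma class_X_sign_partition:
  assumes sel: "nodal_selection sel" and f: "f \<in> class_X sel c c\<^sub>1 N"
    and pos: "c > 0" "c\<^sub>1 > 0" "N > 0"
  obtains h a where "sign_partition h c c\<^sub>1 N a" "AE x in circ. f x = h x" "nodal_set sel f = cis ` a ` {..<N}"
proof -
  obtain h where h: "h \<in> borel_measurable circle_borel" "\<And>x. \<bar>h x\<bar> \<le> c" "AE x in circ. f x = h x"
    "(\<integral>x. h x \<partial>circ) = 0" "(\<integral>x. \<bar>h x\<bar> \<partial>circ) = c\<^sub>1"
    using class_X_version[OF f pos(1)] by blast
  have Z: "finite (nodal_set sel f)" "card (nodal_set sel f) = N" using f by (auto simp: class_X_def)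
  obtain a where a: "\<And>i. i < N \<Longrightarrow> a i < a (Suc i)" "a N = a 0 + 2*pi" "nodal_set sel f = cis ` a ` {..<N}"
    using circle_enumerate[OF nodal_set_subset_circle[OF sel] Z pos(3)] by blast
  have mono: "a i \<le> a j" if "i \<le> j" "j \<le> N" for i j
    using partition_mono[of N a i j] that a(1) by (simp add: less_imp_le)
  have sector: "(AE t in lborel. t \<in> {a i<..<a (Suc i)} \<longrightarrow> 0 \<le> h (cis t)) \<or>
      (AE t in lborel. t \<in> {a i<..<a (Suc i)} \<longrightarrow> h (cis t) \<le> 0)" if i: "i < N" for i
  proof -
    have bd: "a 0 \<le> a i" "a (Suc i) \<le> a N" using mono[of 0 i] mono[of "Suc i" N] i by auto
    have "cis ` {a i<..<a (Suc i)} \<inter> nodal_set sel f = {}"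
    proof (rule ccontr)
      assume "\<not> ?thesis"
      then obtain t j where t: "a i < t" "t < a (Suc i)" "j < N" "cis t = cis (a j)"
        unfolding a(3) by auto
      have "a 0 \<le> a j" "a j < a N"
        using mono[of 0 j] a(1)[OF t(3)] mono[of "Suc j" N] t(3) by auto
      then have "\<bar>t - a j\<bar> < 2*pi" using t bd a(2) by auto
      then have "t = a j" using cis_inj_period[OF t(4)] by simp
      then show False using t mono[of j i] mono[of "Suc i" j] i by (cases "j \<le> i") auto
    qed
    moreover have "a (Suc i) \<le> a i + 2*pi" using bd a(2) by simp
    ultimately have sgn: "(\<forall>t\<in>{a i<..<a (Suc i)}. f (cis t) \<ge> 0) \<or> (\<forall>t\<in>{a i<..<a (Suc i)}. f (cis t) \<le> 0)"
      by (intro constant_sign_between_nodal_points[OF sel])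
    have "AE t in lborel. t \<in> {a 0..<a 0 + 2*pi} \<longrightarrow> f (cis t) = h (cis t)"
      using h(3) by (rule AE_circ_cis)
    then have ae: "AE t in lborel. t \<in> {a i<..<a (Suc i)} \<longrightarrow> f (cis t) = h (cis t)"
      by eventually_elim (use bd a(2) in auto)
    from sgn show ?thesis
    proof
      assume s: "\<forall>t\<in>{a i<..<a (Suc i)}. f (cis t) \<ge> 0"
      have "AE t in lborel. t \<in> {a i<..<a (Suc i)} \<longrightarrow> 0 \<le> h (cis t)"
        using ae by eventually_elim (use s in metis)
      then show ?thesis ..
    next
      assume s: "\<forall>t\<in>{a i<..<a (Suc i)}. f (cis t) \<le> 0"
      have "AE t in lborel. t \<in> {a i<..<a (Suc i)} \<longrightarrow> h (cis t) \<le> 0"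
        using ae by eventually_elim (use s in metis)
      then show ?thesis ..
    qed
  qed
  have "sign_partition h c c\<^sub>1 N a"
    using h a pos sector by unfold_locales auto
  then show ?thesis using h(3) a(3) that by blast
qed

lemma W_class_X_ge:
  assumes sel: "nodal_selection sel" and f: "f \<in> class_X sel c c\<^sub>1 N"
    and pos: "c > 0" "c\<^sub>1 > 0" "N > 0" and p: "p \<ge> 1"
  defines "w \<equiv> c\<^sub>1 / (2 * c * N)"
  shows "w * (c\<^sub>1 / 2) powr (1 / p) \<le> W p f"
    and "even N \<Longrightarrow> W p f \<le> w * (c\<^sub>1 / 2) powr (1 / p) \<Longrightarrow>
      \<exists>a s. alternating_arcs c w N a s \<and> nodal_set sel f = cis ` a ` {..<N} \<and>
        (AE x in arc_length. f x = alternating_arcs.profile c w N a s x)"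
proof -
  obtain h a where sp: "sign_partition h c c\<^sub>1 N a" and ae: "AE x in circ. f x = h x"
    and Z: "nodal_set sel f = cis ` a ` {..<N}"
    using class_X_sign_partition[OF sel f pos] .
  interpret sign_partition h c c\<^sub>1 N a by fact
  have fm: "f \<in> borel_measurable arc_length" using f by (simp add: class_X_def)
  show "w * (c\<^sub>1 / 2) powr (1 / p) \<le> W p f"
    unfolding w_def by (rule W_ge(1)[OF fm ae p])
  assume ev: "even N" and le: "W p f \<le> w * (c\<^sub>1 / 2) powr (1 / p)"
  obtain k where "transported k = c\<^sub>1\<^sup>2 / (4 * c * N)"
    using W_ge(2)[OF fm ae p] le unfolding w_def by blast
  from transported_eq[OF ev this] obtain s where s: "alternating_arcs c w N a s"
    "AE x in circ. h x = alternating_arcs.profile c w N a s x"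
    unfolding w_def by blast
  have "AE x in circ. f x = alternating_arcs.profile c w N a s x"
    using ae s(2) by eventually_elim simp
  then have "AE x in arc_length. f x = alternating_arcs.profile c w N a s x"
    unfolding arc_length_eq_completion by (rule AE_completion)
  then show "\<exists>a s. alternating_arcs c w N a s \<and> nodal_set sel f = cis ` a ` {..<N} \<and>
        (AE x in arc_length. f x = alternating_arcs.profile c w N a s x)"
    using s(1) Z by blast
qed

lemma alternating_arcs_equispaced:
  assumes "c > 0" "w > 0" "N > 0" "even N" "w * N \<le> pi"
  shows "alternating_arcs c w N (\<lambda>i. 2*pi * i / N) (\<lambda>i. (-1) ^ i)"
proof
  fix i
  have "2 * w \<le> 2*pi / N" using assms by (simp add: field_simps)
  then show "2*pi * i / N + 2 * w \<le> 2*pi * Suc i / N" by (simp add: field_simps add_divide_distrib)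
qed (use assms in auto)

text \<open>
  Equidistant nodal points attain the lower bound, so every minimizer attains it as well, and the case of equality applies.
\<close>

theorem theorem7:
  fixes p c_inf c_1 :: real and N :: nat
    and sel :: "(complex \<Rightarrow> real) \<Rightarrow> complex set \<Rightarrow> complex"
  assumes "p \<ge> 1" and "c_inf > 0" and "c_1 \<in> {0<..2 * c_inf * pi}"
    and "N > 0" and "even N" and "nodal_selection sel"
  defines "X \<equiv> class_X sel c_inf c_1 N"
    and "X\<^sub>s \<equiv> class_X_step sel c_inf c_1 N"
  shows "(\<forall>f. is_arg_min (W p) (\<lambda>g. g \<in> X) f \<longrightarrow>
            (\<exists>g \<in> X\<^sub>s. (AE x in arc_length. f x = g x) \<and> nodal_set sel g = nodal_set sel f \<and>
               antisymmetric_steps c_inf (c_1 / (2 * c_inf * real N)) (nodal_set sel f) g)) \<and>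
         (\<exists>f. is_arg_min (W p) (\<lambda>g. g \<in> X) f \<and>
            W p f = 2 powr (- 1 - 1 / p) * (c_1 / (real N * c_inf)) * c_1 powr (1 / p))"
proof -
  define w where "w = c_1 / (2 * c_inf * real N)"
  define m where "m = w * (c_1 / 2) powr (1 / p)"
  have c1: "c_1 > 0" "c_1 \<le> 2 * c_inf * pi" using assms(3) by auto
  have w: "w > 0" "w * N \<le> pi" using c1 assms(2,4) by (auto simp: w_def field_simps)
  have c1_eq: "2 * w * c_inf * N = c_1" using assms(2,4) by (simp add: w_def)
  have m_eq: "m = 2 powr (- 1 - 1 / p) * (c_1 / (real N * c_inf)) * c_1 powr (1 / p)"
  proof -
    have "(2::real) powr (- 1 - 1 / p) = 2 powr (- 1) * 2 powr (- (1 / p))"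
      using powr_add[of 2 "- 1" "- (1 / p)"] by simp
    also have "\<dots> = 1 / 2 / 2 powr (1 / p)" by (simp add: powr_minus_divide)
    finally show ?thesis using c1(1) by (simp add: m_def w_def powr_divide)
  qed
  have lower: "m \<le> W p g" if "g \<in> X" for g
    unfolding m_def w_def using W_class_X_ge(1)[OF assms(6) _ assms(2) c1(1) assms(4,1)] that
    by (simp add: X_def)
  define a where "a i = 2*pi * real i / real N" for i
  define s where "s i = (-1 :: real) ^ i" for i
  interpret E: alternating_arcs c_inf w N a s
    unfolding a_def s_def by (rule alternating_arcs_equispaced[OF assms(2) w(1) assms(4,5) w(2)])
  have EX: "E.profile \<in> X" using E.profile_in_class_X[OF assms(6)] unfolding c1_eq X_def .
  have "W p E.profile \<le> m"
  proof -
    have half: "c_inf * w * N = c_1 / 2" using c1_eq by (simp add: mult_ac)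
    show ?thesis using E.W_profile_le[OF assms(1)] unfolding m_def half .
  qed
  then have E_min: "W p E.profile = m" using lower[OF EX] by simp
  have arg_min: "is_arg_min (W p) (\<lambda>g. g \<in> X) E.profile"
    using EX lower E_min by (auto simp: is_arg_min_def not_less)
  have minimizer: "\<exists>g \<in> X\<^sub>s. (AE x in arc_length. f x = g x) \<and> nodal_set sel g = nodal_set sel f \<and>
      antisymmetric_steps c_inf w (nodal_set sel f) g" if f: "is_arg_min (W p) (\<lambda>g. g \<in> X) f" for f
  proof -
    have "f \<in> X" "W p f \<le> m" using f EX E_min by (auto simp: is_arg_min_def not_less)
    then obtain b r where br: "alternating_arcs c_inf w N b r" "nodal_set sel f = cis ` b ` {..<N}"
      "AE x in arc_length. f x = alternating_arcs.profile c_inf w N b r x"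
      using W_class_X_ge(2)[OF assms(6) _ assms(2) c1(1) assms(4,1,5)]
      unfolding X_def m_def w_def by blast
    interpret B: alternating_arcs c_inf w N b r by fact
    have nodes: "B.nodes = nodal_set sel f" by (simp add: B.nodes_def br(2))
    show ?thesis
      using B.profile_in_class_X_step[OF assms(6)] B.nodal_set_profile[OF assms(6)]
        B.antisymmetric_steps_profile br(3)
      unfolding nodes c1_eq X\<^sub>s_def by blast
  qed
  show ?thesis
    using minimizer arg_min E_min m_eq unfolding w_def by blast
qed

end
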